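(* In the setting of the context, let $0<\varepsilon\le\varepsilon_0$, $\omega=(\omega_1,\omega_2)\in\Omega_\varepsilon$, and let $z^\varepsilon_t=z^\varepsilon(t,\omega)=(u^\varepsilon_t,v^\varepsilon_t)$, $t\ge0$, be any solution of $$ \dot u^\varepsilon=\tfrac1\varepsilon Au^\varepsilon+\tfrac1\varepsilon U(u^\varepsilon,v^\varepsilon)+\tfrac{\sigma_1}{\varepsilon^{1/\alpha}}\dot L^{\alpha\pm},\qquad \dot v^\varepsilon=Bv^\varepsilon+V(u^\varepsilon,v^\varepsilon)+\sigma_2\dot L^\pm $$ with initial data $z^\varepsilon_0=(u_0,v_0)\in\mathbb{R}^n\times\mathbb{R}^m$. Then for the reduced low-dimensional system on the random invariant manifold $\mathcal M^\varepsilon$, $$ \begin{cases} \tilde u^\varepsilon_t=F^\varepsilon(\theta_t\omega,\tilde v^\varepsilon_t-\varsigma(\theta^2_t\omega_2))+\zeta^\varepsilon(\theta^1_t\omega_1),\\ d\tilde v^\varepsilon_t=B\tilde v^\varepsilon_t\,dt+V(\tilde u^\varepsilon_t,\tilde v^\varepsilon_t)\,dt+\sigma_2\,dL^\pm_t, \end{cases} $$ there exists an initial value $\tilde z^\varepsilon_0=\tilde z^\varepsilon_0(\omega)\in\mathcal M^\varepsilon(\omega)$ such that the solution $\tilde z^\varepsilon(t,\omega)=(\tilde u^\varepsilon_t,\tilde v^\varepsilon_t)$ of the reduced system with initial value $\tilde z^\varepsilon_0$ satisfies $$ |z^\varepsilon(t,\omega)-\tilde z^\varepsilon(t,\omega)|\le\frac{e^{-\frac\mu\varepsilon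 t}}{1-\Big(\frac{L}{\gamma_1-\mu}+\frac{\varepsilon L}{\mu-\varepsilon\gamma_2}\Big)}\Big(2(|u_0-u|+|v_0-v|)+2\frac{M_U}{\gamma_1}+\frac{M_V}{\gamma_2}\Big),\qquad t\ge0, $$ where $u=\zeta^\varepsilon(\omega_1)$ and $v=\varsigma(\omega_2)$.
   Context: **Noise.** Let $\alpha\in(1,2)$. $L^{\alpha\pm}=(L^{\alpha\pm}_t)_{t\in\mathbb{R}}$ is a two-sided $n$-dimensional symmetric $\alpha$-stable Lévy process: càdlàg, zero at time $0$, with stationary independent increments, and $\mathbb{E}e^{i\langle z,L^{\alpha\pm}_t\rangle}=\exp(-tC_1(n,\alpha)|z|^\alpha)$ for $t\ge0$, where $C_1(n,\alpha)=\pi^{-1/2}\Gamma((1+\alpha)/2)\Gamma(n/2)/\Gamma((n+\alpha)/2)$. $L^{\pm}=(L^\pm_t)_{t\in\mathbb{R}}$ is a two-sided $m$-dimensional Lévy process, independent of $L^{\alpha\pm}$, with $\mathbb{E}e^{i\langle z,L^\pm_t\rangle}=\exp\big(t\{-\frac12\langle z,Qz\rangle+\int_{0<|u|\le\delta}(e^{i\langle z,u\rangle}-1-i\langle z,u\rangle)\nu(du)\}\big)$ for $t\ge 0$, where $Q$ is nonnegative definite, $0<\delta<1$, and $\nu$ is a Lévy measure. These are realized canonically: $\Omega^1=D(\mathbb{R},\mathbb{R}^n)$, $\Omega^2=D(\mathbb{R},\mathbb{R}^m)$ (càdlàg functions, Borel $\sigma$-algebras of the Skorohod topology), $\mathbb{Q}^1,\mathbb{Q}^2$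 the laws of $L^{\alpha\pm},L^\pm$, $\theta^i_t\omega_i(\cdot)=\omega_i(\cdot+t)-\omega_i(t)$, $\Omega=\Omega^1\times\Omega^2$, $\mathbb{Q}=\mathbb{Q}^1\times\mathbb{Q}^2$, $\theta_t=\theta^1_t\times\theta^2_t$, $\omega=(\omega_1,\omega_2)$. Since the noise is additive, the equations are understood pathwise in integrated form. **Coefficients and hypotheses.** $A\in\mathbb{R}^{n\times n}$, $B\in\mathbb{R}^{m\times m}$, $U:\mathbb{R}^n\times\mathbb{R}^m\to\mathbb{R}^n$, $V:\mathbb{R}^n\times\mathbb{R}^m\to\mathbb{R}^m$ Borel measurable, $\sigma_1,\sigma_2$ nonzero reals, $\varepsilon>0$. It is assumed that: (H1) there is $\gamma_1>0$ with $\langle Ax,x\rangle\le-\gamma_1|x|^2$ for all $x\in\mathbb{R}^n$; (H2) there are $\gamma_2>0$, $\gamma_3\ge0$ with $\|e^{Bt}\|\le e^{-\gamma_2 t}$ for $t\le 0$ and $\|e^{Bt}\|\le e^{-\gamma_3 t}$ for $t>0$; (H3) there is $L>0$ such that $|U(x_1,y_1)-U(x_2,y_2)|\le L(|x_1-x_2|+|y_1-y_2|)$ and $|V(x_1,y_1)-V(x_2,y_2)|\le L(|x_1-x_2|+|y_1-y_2|)$ for all arguments; (H4) $\gamma_1>L$; (H5) $\sup|U|=M_U<\infty$ and $\sup|V|=M_V<\infty$. **Stationary solutions.** For each $\varepsilon>0$, $\zeta^\varepsilon:\Omega^1\to\mathbb{R}^n$ and $\varsigma:\Omega^2\to\mathbb{R}^m$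 are fixed random vectors which are stationary solutions of $d\zeta_t=\frac1\varepsilon A\zeta_t\,dt+\frac{\sigma_1}{\varepsilon^{1/\alpha}}dL^{\alpha\pm}_t$ and $d\varsigma_t=B\varsigma_t\,dt+\sigma_2\,dL^\pm_t$: there is a $\theta$-invariant set $\Omega_\varepsilon\subset\Omega$ of full $\mathbb{Q}$-measure such that for $\omega\in\Omega_\varepsilon$ the càdlàg functions $t\mapsto\zeta^\varepsilon(\theta^1_t\omega_1)$, $t\mapsto\varsigma(\theta^2_t\omega_2)$, $t\in\mathbb{R}$, solve these equations along $\omega$ (existence of such random vectors is taken as given). **Constants.** $\mu>0$ is a fixed constant with $\gamma_1-\mu>L$, and $\varepsilon_0>0$ is such that for all $0<\varepsilon\le\varepsilon_0$, $\mu-\varepsilon\gamma_2>0$ and $\frac{L}{\gamma_1-\mu}+\frac{\varepsilon L}{\mu-\varepsilon\gamma_2}<1$. On $\mathbb{R}^n\times\mathbb{R}^m$ the norm is $|(u,v)|=|u|+|v|$. **Manifold.** For $0<\varepsilon\le\varepsilon_0$, $\omega\in\Omega_\varepsilon$, $y\in\mathbb{R}^m$, let $(\hat u^\varepsilon_t,\hat v^\varepsilon_t)_{t\le0}$ be the unique continuous solution of $$\hat u^\varepsilon_t=\int_{-\infty}^t e^{\frac{A}{\varepsilon}(t-r)}\tfrac1\varepsilon U(\hat u^\varepsilon_r+\zeta^\varepsilon(\theta^1_r\omega_1),\hat v^\varepsilon_r+\varsigma(\theta^2_r\omega_2))dr,\quad \hat v^\varepsilon_t=e^{Bt}y-\int_t^0e^{B(t-r)}V(\hat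 u^\varepsilon_r+\zeta^\varepsilon(\theta^1_r\omega_1),\hat v^\varepsilon_r+\varsigma(\theta^2_r\omega_2))dr,\quad t\le0.$$ Put $F^\varepsilon(\omega,y)=\hat u^\varepsilon_0=\frac1\varepsilon\int_{-\infty}^0e^{-\frac A\varepsilon s}U(\hat u^\varepsilon_s+\zeta^\varepsilon(\theta^1_s\omega_1),\hat v^\varepsilon_s+\varsigma(\theta^2_s\omega_2))ds$ and $$\mathcal M^\varepsilon(\omega)=\{(F^\varepsilon(\omega,y)+\zeta^\varepsilon(\omega_1),\,y+\varsigma(\omega_2)):y\in\mathbb{R}^m\}.$$ *)

theory Defs
  imports "HOL-Probability.Probability"
begin

section \<open>Cadlag paths and the Skorohod path space\<close>

definition cadlag_on :: "real set \<Rightarrow> (real \<Rightarrow> 'a::topological_space) \<Rightarrow> bool" where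
  "cadlag_on T x \<longleftrightarrow>
     (\<forall>t\<in>T. (x \<longlongrightarrow> x t) (at t within T \<inter> {t<..}) \<and>
            (\<exists>l. (x \<longlongrightarrow> l) (at t within T \<inter> {..<t})))"

definition cadlag_space :: "(real \<Rightarrow> 'a::real_normed_vector) set" where
  "cadlag_space = {w. cadlag_on UNIV w}"

definition skorohod_nbhd :: "(real \<Rightarrow> 'a::real_normed_vector) \<Rightarrow> real \<Rightarrow> real \<Rightarrow> (real \<Rightarrow> 'a) set" where
  "skorohod_nbhd x N e =
     {y \<in> cadlag_space. \<exists>c. strict_mono c \<and> surj c \<and> continuous_on UNIV c \<and>
        (\<forall>t. \<bar>c t - t\<bar> < e) \<and> (\<forall>t. \<bar>t\<bar> \<le> N \<longrightarrow> norm (y (c t) - x t) < e)}"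

text \<open>
  The Skorohod (J1) topology on the two-sided path space: \<open>y\<^sub>k\<close> converges to \<open>x\<close> iff there are
  time changes \<open>c\<^sub>k\<close> of the line with \<open>c\<^sub>k \<rightarrow> id\<close> uniformly and \<open>y\<^sub>k \<circ> c\<^sub>k \<rightarrow> x\<close> uniformly on
  bounded intervals.
\<close>

definition skorohod_open :: "(real \<Rightarrow> 'a::real_normed_vector) set \<Rightarrow> bool" where
  "skorohod_open W \<longleftrightarrow> W \<subseteq> cadlag_space \<and> (\<forall>x\<in>W. \<exists>N>0. \<exists>e>0. skorohod_nbhd x N e \<subseteq> W)"

definition skorohod_topology :: "(real \<Rightarrow> 'a::real_normed_vector) topology" where
  "skorohod_topology = topology skorohod_open"

lemma skorohod_nbhd_mono:
  "N \<le> N' \<Longrightarrow> e' \<le> e \<Longrightarrow> skorohod_nbhd x N' e' \<subseteq> skorohod_nbhd x N e"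
  unfolding skorohod_nbhd_def
proof (intro subsetI CollectI conjI; elim CollectE conjE exE)
  fix y c
  assume le: "N \<le> N'" "e' \<le> e"
    and c: "strict_mono c" "surj c" "continuous_on UNIV c" "\<forall>t. \<bar>c t - t\<bar> < e'"
      "\<forall>t. \<bar>t\<bar> \<le> N' \<longrightarrow> norm (y (c t) - x t) < e'"
  have "\<forall>t. \<bar>c t - t\<bar> < e" using c(4) le(2) less_le_trans by blast
  moreover have "\<forall>t. \<bar>t\<bar> \<le> N \<longrightarrow> norm (y (c t) - x t) < e"
    using c(5) le less_le_trans order_trans by blast
  ultimately show "\<exists>c. strict_mono c \<and> surj c \<and> continuous_on UNIV c \<and>
      (\<forall>t. \<bar>c t - t\<bar> < e) \<and> (\<forall>t. \<bar>t\<bar> \<le> N \<longrightarrow> norm (y (c t) - x t) < e)"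
    using c(1-3) by (intro exI[of _ c] conjI)
qed

lemma istopology_skorohod_open: "istopology skorohod_open"
  unfolding istopology_def
proof (intro conjI allI impI)
  fix S T :: "(real \<Rightarrow> 'a) set"
  assume S: "skorohod_open S" and T: "skorohod_open T"
  show "skorohod_open (S \<inter> T)"
    unfolding skorohod_open_def
  proof (intro conjI ballI)
    show "S \<inter> T \<subseteq> cadlag_space" using S by (auto simp: skorohod_open_def)
    fix x assume x: "x \<in> S \<inter> T"
    obtain N e where Ne: "N > 0" "e > 0" "skorohod_nbhd x N e \<subseteq> S"
      using S x unfolding skorohod_open_def by blast
    obtain N' e' where Ne': "N' > 0" "e' > 0" "skorohod_nbhd x N' e' \<subseteq> T"
      using T x unfolding skorohod_open_def by blast
    have "skorohod_nbhd x (max N N') (min e e') \<subseteq> S \<inter> T"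
      using Ne(3) Ne'(3) skorohod_nbhd_mono[of N "max N N'" "min e e'" e x]
        skorohod_nbhd_mono[of N' "max N N'" "min e e'" e' x] by auto
    then show "\<exists>N>0. \<exists>e>0. skorohod_nbhd x N e \<subseteq> S \<inter> T"
      using Ne(1,2) Ne'(2)
      by (intro exI[of _ "max N N'"] exI[of _ "min e e'"] conjI) auto
  qed
next
  fix K :: "(real \<Rightarrow> 'a) set set"
  assume "\<forall>S\<in>K. skorohod_open S"
  then show "skorohod_open (\<Union>K)"
    unfolding skorohod_open_def by (intro conjI ballI) (blast, meson Union_iff Union_upper subset_trans)
qed

lemma openin_skorohod: "openin skorohod_topology W \<longleftrightarrow> skorohod_open W"
  unfolding skorohod_topology_def topology_inverse'[OF istopology_skorohod_open] ..

definition skorohod_borel :: "(real \<Rightarrow> 'a::real_normed_vector) measure" where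
  "skorohod_borel = sigma cadlag_space {W. openin skorohod_topology W}"

section \<open>Laws of two-sided Levy processes\<close>

text \<open>
  \<open>P\<close> is the law on the path space of a two-sided Levy process, the process being the coordinate
  process \<open>\<lambda>w. w t\<close>; \<open>\<psi>\<close> is its characteristic exponent.
\<close>

definition two_sided_levy_law ::
  "(real \<Rightarrow> 'a::euclidean_space) measure \<Rightarrow> ('a \<Rightarrow> complex) \<Rightarrow> bool" where
  "two_sided_levy_law P \<psi> \<longleftrightarrow>
     prob_space P \<and> space P = cadlag_space \<and> sets P = sets skorohod_borel \<and>
     (AE w in P. w 0 = 0) \<and>
     (\<forall>s t h. s \<le> t \<longrightarrow>
        distr P borel (\<lambda>w. w (t + h) - w (s + h)) = distr P borel (\<lambda>w. w t - w s)) \<and>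
     (\<forall>(\<tau> :: nat \<Rightarrow> real) k. strict_mono_on {..k} \<tau> \<longrightarrow>
        prob_space.indep_vars P (\<lambda>_. borel) (\<lambda>i w. w (\<tau> (Suc i)) - w (\<tau> i)) {..<k}) \<and>
     (\<forall>t\<ge>0. \<forall>z. (\<integral>w. iexp (z \<bullet> w t) \<partial>P) = exp (complex_of_real t * \<psi> z))"

definition stable_const :: "nat \<Rightarrow> real \<Rightarrow> real" where
  "stable_const n \<alpha> = pi powr (- 1 / 2) * Gamma ((1 + \<alpha>) / 2) * Gamma (real n / 2)
                        / Gamma ((real n + \<alpha>) / 2)"

definition stable_exponent :: "real \<Rightarrow> real ^ 'n \<Rightarrow> complex" where
  "stable_exponent \<alpha> z = - complex_of_real (stable_const CARD('n) \<alpha> * norm z powr \<alpha>)"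

definition levy_measure :: "'a::euclidean_space measure \<Rightarrow> bool" where
  "levy_measure \<nu> \<longleftrightarrow> sets \<nu> = sets borel \<and> emeasure \<nu> {0} = 0 \<and>
     (\<integral>\<^sup>+u. ennreal (min 1 ((norm u)\<^sup>2)) \<partial>\<nu>) < \<infinity>"

definition levy_khintchine_exponent ::
  "real ^ 'm ^ 'm \<Rightarrow> real \<Rightarrow> (real ^ 'm) measure \<Rightarrow> real ^ 'm \<Rightarrow> complex" where
  "levy_khintchine_exponent Q \<delta> \<nu> z =
     - complex_of_real (z \<bullet> (Q *v z) / 2) +
     set_lebesgue_integral \<nu> {u. 0 < norm u \<and> norm u \<le> \<delta>}
       (\<lambda>u. iexp (z \<bullet> u) - 1 - \<i> * complex_of_real (z \<bullet> u))"

definition path_shift :: "real \<Rightarrow> (real \<Rightarrow> 'a::real_normed_vector) \<Rightarrow> real \<Rightarrow> 'a" where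
  "path_shift t w = (\<lambda>s. w (s + t) - w t)"

definition shift_pair ::
  "real \<Rightarrow> (real \<Rightarrow> 'a::real_normed_vector) \<times> (real \<Rightarrow> 'b::real_normed_vector)
     \<Rightarrow> (real \<Rightarrow> 'a) \<times> (real \<Rightarrow> 'b)" where
  "shift_pair t \<omega> = (path_shift t (fst \<omega>), path_shift t (snd \<omega>))"

text \<open>
  Invariance is equality of \<open>W\<close> with its images. As \<open>path_shift 0 w = w - w 0\<close>, every path in an
  invariant set vanishes at time 0, so that \<open>shift_pair 0\<close> is the identity on such a set although
  the path space itself contains paths with \<open>w 0 \<noteq> 0\<close>.
\<close>

definition shift_invariant ::
  "((real \<Rightarrow> 'a::real_normed_vector) \<times> (real \<Rightarrow> 'b::real_normed_vector)) set \<Rightarrow> bool" where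
  "shift_invariant W \<longleftrightarrow> (\<forall>t. shift_pair t ` W = W)"

section \<open>Equations with additive noise, pathwise in integrated form\<close>

text \<open>The cadlag function \<open>x\<close> solves \<open>dx = f dt + dg\<close> on the time set \<open>T\<close>.\<close>

definition solves_on ::
  "real set \<Rightarrow> (real \<Rightarrow> 'a::euclidean_space) \<Rightarrow> (real \<Rightarrow> 'a) \<Rightarrow> (real \<Rightarrow> 'a) \<Rightarrow> bool" where
  "solves_on T x f g \<longleftrightarrow> cadlag_on T x \<and>
     (\<forall>s\<in>T. \<forall>t\<in>T. s \<le> t \<longrightarrow>
        f absolutely_integrable_on {s..t} \<and> x t - x s = integral {s..t} f + (g t - g s))"

text \<open>
  The type of square matrices carries componentwise multiplication as \<open>*\<close>, so the library's \<open>exp\<close>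
  is not available as the matrix exponential.
\<close>

definition mat_exp :: "real ^ 'n ^ 'n \<Rightarrow> real ^ 'n ^ 'n" where
  "mat_exp M = (\<Sum>k. (1 / fact k) *\<^sub>R (((**) M ^^ k) (mat 1)))"

section \<open>The random invariant manifold\<close>

text \<open>
  Below, \<open>\<zeta>\<close> and \<open>\<xi>\<close> are the random vectors defining the stationary solutions of the fast and the
  slow linear equation; \<open>\<zeta>\<close> is the one belonging to the given value of \<open>\<epsilon>\<close>.
\<close>

definition lyapunov_perron ::
  "real ^ 'n ^ 'n \<Rightarrow> real ^ 'm ^ 'm \<Rightarrow>
   ((real ^ 'n) \<times> (real ^ 'm) \<Rightarrow> real ^ 'n) \<Rightarrow> ((real ^ 'n) \<times> (real ^ 'm) \<Rightarrow> real ^ 'm) \<Rightarrow>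
   ((real \<Rightarrow> real ^ 'n) \<Rightarrow> real ^ 'n) \<Rightarrow> ((real \<Rightarrow> real ^ 'm) \<Rightarrow> real ^ 'm) \<Rightarrow> real \<Rightarrow>
   (real \<Rightarrow> real ^ 'n) \<times> (real \<Rightarrow> real ^ 'm) \<Rightarrow> real ^ 'm \<Rightarrow>
   (real \<Rightarrow> (real ^ 'n) \<times> (real ^ 'm)) \<Rightarrow> bool" where
  "lyapunov_perron A B U V \<zeta> \<xi> \<epsilon> \<omega> y w \<longleftrightarrow>
     (let p = (\<lambda>r. (fst (w r) + \<zeta> (path_shift r (fst \<omega>)), snd (w r) + \<xi> (path_shift r (snd \<omega>))));
          f = (\<lambda>t r. mat_exp (((t - r) / \<epsilon>) *\<^sub>R A) *v ((1 / \<epsilon>) *\<^sub>R U (p r)));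
          g = (\<lambda>t r. mat_exp ((t - r) *\<^sub>R B) *v V (p r))
      in continuous_on {..0} w \<and>
         (\<forall>t\<le>0. f t absolutely_integrable_on {..t} \<and> fst (w t) = integral {..t} (f t) \<and>
                g t absolutely_integrable_on {t..0} \<and>
                snd (w t) = mat_exp (t *\<^sub>R B) *v y - integral {t..0} (g t)))"

text \<open>
  The solution lives on the half line \<open>{..0}\<close>; as HOL functions are total, uniqueness is
  expressed for functions that are \<open>extensional\<close> there.
\<close>

definition lyapunov_perron_solution ::
  "real ^ 'n ^ 'n \<Rightarrow> real ^ 'm ^ 'm \<Rightarrow>
   ((real ^ 'n) \<times> (real ^ 'm) \<Rightarrow> real ^ 'n) \<Rightarrow> ((real ^ 'n) \<times> (real ^ 'm) \<Rightarrow> real ^ 'm) \<Rightarrow>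
   ((real \<Rightarrow> real ^ 'n) \<Rightarrow> real ^ 'n) \<Rightarrow> ((real \<Rightarrow> real ^ 'm) \<Rightarrow> real ^ 'm) \<Rightarrow> real \<Rightarrow>
   (real \<Rightarrow> real ^ 'n) \<times> (real \<Rightarrow> real ^ 'm) \<Rightarrow> real ^ 'm \<Rightarrow>
   real \<Rightarrow> (real ^ 'n) \<times> (real ^ 'm)" where
  "lyapunov_perron_solution A B U V \<zeta> \<xi> \<epsilon> \<omega> y =
     (THE w. w \<in> extensional {..0} \<and> lyapunov_perron A B U V \<zeta> \<xi> \<epsilon> \<omega> y w)"

definition manifold_map ::
  "real ^ 'n ^ 'n \<Rightarrow> real ^ 'm ^ 'm \<Rightarrow>
   ((real ^ 'n) \<times> (real ^ 'm) \<Rightarrow> real ^ 'n) \<Rightarrow> ((real ^ 'n) \<times> (real ^ 'm) \<Rightarrow> real ^ 'm) \<Rightarrow>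
   ((real \<Rightarrow> real ^ 'n) \<Rightarrow> real ^ 'n) \<Rightarrow> ((real \<Rightarrow> real ^ 'm) \<Rightarrow> real ^ 'm) \<Rightarrow> real \<Rightarrow>
   (real \<Rightarrow> real ^ 'n) \<times> (real \<Rightarrow> real ^ 'm) \<Rightarrow> real ^ 'm \<Rightarrow> real ^ 'n" where
  "manifold_map A B U V \<zeta> \<xi> \<epsilon> \<omega> y = fst (lyapunov_perron_solution A B U V \<zeta> \<xi> \<epsilon> \<omega> y 0)"

definition random_manifold ::
  "real ^ 'n ^ 'n \<Rightarrow> real ^ 'm ^ 'm \<Rightarrow>
   ((real ^ 'n) \<times> (real ^ 'm) \<Rightarrow> real ^ 'n) \<Rightarrow> ((real ^ 'n) \<times> (real ^ 'm) \<Rightarrow> real ^ 'm) \<Rightarrow>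
   ((real \<Rightarrow> real ^ 'n) \<Rightarrow> real ^ 'n) \<Rightarrow> ((real \<Rightarrow> real ^ 'm) \<Rightarrow> real ^ 'm) \<Rightarrow> real \<Rightarrow>
   (real \<Rightarrow> real ^ 'n) \<times> (real \<Rightarrow> real ^ 'm) \<Rightarrow> ((real ^ 'n) \<times> (real ^ 'm)) set" where
  "random_manifold A B U V \<zeta> \<xi> \<epsilon> \<omega> =
     {(manifold_map A B U V \<zeta> \<xi> \<epsilon> \<omega> y + \<zeta> (fst \<omega>), y + \<xi> (snd \<omega>)) | y. True}"

definition reduced_solution ::
  "real ^ 'n ^ 'n \<Rightarrow> real ^ 'm ^ 'm \<Rightarrow>
   ((real ^ 'n) \<times> (real ^ 'm) \<Rightarrow> real ^ 'n) \<Rightarrow> ((real ^ 'n) \<times> (real ^ 'm) \<Rightarrow> real ^ 'm) \<Rightarrow>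
   ((real \<Rightarrow> real ^ 'n) \<Rightarrow> real ^ 'n) \<Rightarrow> ((real \<Rightarrow> real ^ 'm) \<Rightarrow> real ^ 'm) \<Rightarrow> real \<Rightarrow> real \<Rightarrow>
   (real \<Rightarrow> real ^ 'n) \<times> (real \<Rightarrow> real ^ 'm) \<Rightarrow>
   (real \<Rightarrow> real ^ 'n) \<Rightarrow> (real \<Rightarrow> real ^ 'm) \<Rightarrow> bool" where
  "reduced_solution A B U V \<zeta> \<xi> \<epsilon> \<sigma>\<^sub>2 \<omega> u v \<longleftrightarrow>
     (\<forall>t\<ge>0. u t = manifold_map A B U V \<zeta> \<xi> \<epsilon> (shift_pair t \<omega>) (v t - \<xi> (path_shift t (snd \<omega>)))
                    + \<zeta> (path_shift t (fst \<omega>))) \<and>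
     solves_on {0..} v (\<lambda>t. B *v v t + V (u t, v t)) (\<lambda>t. \<sigma>\<^sub>2 *\<^sub>R snd \<omega> t)"

end

theory Submission
  imports Defs
begin

text \<open>
  Subtracting the stationary solutions \<open>N t = (\<zeta>(\<theta>\<^sub>t \<omega>\<^sub>1), \<xi>(\<theta>\<^sub>t \<omega>\<^sub>2))\<close> from the system removes the noise: the
  difference \<open>z - N\<close> solves the random equation \<open>x' = A x / \<epsilon> + U(x + N\<^sub>1, y + N\<^sub>2) / \<epsilon>\<close>, \<open>y' = B y + V(x + N\<^sub>1, y + N\<^sub>2)\<close>
  in integrated form, whose forcing is only right-continuous in time. From here on the argument concerns one
  fixed path.

  Up to the translation by \<open>N 0\<close>, the manifold consists of the values at time 0 of the orbits on \<open>(-\<infinity>, 0]\<close> which grow at most like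
  \<open>e\<^bsup>-ct\<^esup>\<close>, \<open>c = \<mu> / \<epsilon>\<close>, as \<open>t \<rightarrow> -\<infinity>\<close>, and the assertion asks for an orbit on the manifold whose distance to
  the given solution is of the order \<open>e\<^bsup>-ct\<^esup>\<close> as \<open>t \<rightarrow> \<infinity>\<close>. Both requirements carry the same weight. So the
  given solution \<open>q\<close> of the random equation is extended to negative times by its initial value, and a single curve \<open>w\<close> on the
  whole line is sought with \<open>sup\<^sub>t e\<^sup>c\<^sup>t |w t - q t| < \<infinity>\<close>. It is a fixed point of the Lyapunov--Perron operator
  which integrates the fast equation from \<open>-\<infinity>\<close> and the difference of the slow equations from \<open>+\<infinity>\<close>. In the
  weighted norm this operator is a contraction with constant
  \<open>\<kappa> = L / (\<gamma>\<^sub>1 - \<mu>) + \<epsilon> L / (\<mu> - \<epsilon> \<gamma>\<^sub>2) < 1\<close>, so \<open>w\<close> exists, and its distance to \<open>q\<close> is at most the defect of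
  \<open>q\<close> divided by \<open>1 - \<kappa>\<close>. Boundedness of \<open>U\<close> and \<open>V\<close> bounds that defect by
  \<open>M\<^sub>U / \<gamma>\<^sub>1 + |q\<^sub>1(0)| + 2 |q\<^sub>2(0)| + M\<^sub>V / \<gamma>\<^sub>2\<close>. These steps are \<open>weighted_fixed_point\<close> and
  \<open>tracking_orbit\<close>.

  By the variation of constants formula the past of \<open>w\<close> seen from any time \<open>t \<ge> 0\<close> solves the
  Lyapunov--Perron equation for the shifted path, so that \<open>w + N\<close> stays on the moving manifold and solves
  the reduced system. The same contraction estimate shows that the map defining the manifold exists and is
  Lipschitz (\<open>backward_orbit_exists\<close>, \<open>backward_orbit_dist\<close>); Gronwall's inequality then gives uniqueness for
  the reduced system.
\<close>

section \<open>The matrix exponential\<close>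

text \<open>
  For a bounded operator \<open>T\<close> and a vector \<open>x\<close> the exponential series \<open>\<Sum>k. t\<^sup>k / k! T\<^sup>k x\<close> solves
  \<open>y' = T y\<close>. The derivative is taken coordinate by coordinate, where the series is a real power
  series. With \<open>T\<close> the left multiplication by a matrix and \<open>x\<close> the unit matrix this gives the matrix
  exponential.
\<close>

lemma power_series_operator:
  fixes T :: "'a \<Rightarrow> 'a::euclidean_space"
  assumes T: "bounded_linear T"
  shows "summable (\<lambda>k. (t ^ k / fact k) *\<^sub>R (T ^^ k) x)"
    and "((\<lambda>t. \<Sum>k. (t ^ k / fact k) *\<^sub>R (T ^^ k) x) has_vector_derivative
           T (\<Sum>k. (t ^ k / fact k) *\<^sub>R (T ^^ k) x)) (at t)"
proof -
  interpret T: bounded_linear T by fact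
  let ?g = "\<lambda>t. \<Sum>k. (t ^ k / fact k) *\<^sub>R (T ^^ k) x"
  obtain c where c: "c > 0" "\<And>y. norm (T y) \<le> norm y * c"
    using T.pos_bounded by blast
  have pow: "norm ((T ^^ k) x) \<le> c ^ k * norm x" for k
  proof (induction k)
    case (Suc k)
    have "norm ((T ^^ Suc k) x) \<le> norm ((T ^^ k) x) * c" using c(2) by simp
    also have "\<dots> \<le> c ^ k * norm x * c" using Suc c(1) by (intro mult_right_mono) auto
    finally show ?case by (simp add: algebra_simps)
  qed simp
  have sm: "summable (\<lambda>k. (t ^ k / fact k) *\<^sub>R (T ^^ k) x)" for t
  proof (rule summable_comparison_test')
    show "summable (\<lambda>k. norm x * (inverse (fact k) * (\<bar>t\<bar> * c) ^ k))"
      by (intro summable_mult summable_exp)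
    show "norm ((t ^ k / fact k) *\<^sub>R (T ^^ k) x) \<le> norm x * (inverse (fact k) * (\<bar>t\<bar> * c) ^ k)" for k
    proof -
      have "norm ((t ^ k / fact k) *\<^sub>R (T ^^ k) x) = \<bar>t\<bar> ^ k / fact k * norm ((T ^^ k) x)"
        by (simp add: power_abs)
      also have "\<dots> \<le> \<bar>t\<bar> ^ k / fact k * (c ^ k * norm x)"
        using pow by (intro mult_left_mono) auto
      finally show ?thesis by (simp add: power_mult_distrib divide_simps mult_ac)
    qed
  qed
  then show "summable (\<lambda>k. (t ^ k / fact k) *\<^sub>R (T ^^ k) x)" .
  have "((\<lambda>t. ?g t \<bullet> b) has_real_derivative T (?g t) \<bullet> b) (at t)" if "b \<in> Basis" for b
  proof -
    define a where "a k = ((T ^^ k) x \<bullet> b) / fact k" for k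
    have eq: "(\<lambda>k. a k * t ^ k) = (\<lambda>k. ((t ^ k / fact k) *\<^sub>R (T ^^ k) x) \<bullet> b)" for t
      by (auto simp: a_def)
    have s: "summable (\<lambda>k. a k * t ^ k)" for t
      unfolding eq by (rule bounded_linear.summable[OF bounded_linear_inner_left sm])
    have ga: "?g t \<bullet> b = (\<Sum>k. a k * t ^ k)" for t
      unfolding eq by (rule bounded_linear.suminf[OF bounded_linear_inner_left sm])
    have "T (?g t) \<bullet> b = (\<Sum>k. T ((t ^ k / fact k) *\<^sub>R (T ^^ k) x)) \<bullet> b"
      by (subst T.suminf[OF sm]) simp
    also have "\<dots> = (\<Sum>k. T ((t ^ k / fact k) *\<^sub>R (T ^^ k) x) \<bullet> b)"
      by (rule bounded_linear.suminf[OF bounded_linear_inner_left T.summable[OF sm]])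
    also have "(\<lambda>k. T ((t ^ k / fact k) *\<^sub>R (T ^^ k) x) \<bullet> b) = (\<lambda>k. diffs a k * t ^ k)"
      by (auto simp: a_def diffs_def T.scaleR simp del: of_nat_Suc)
    finally have "T (?g t) \<bullet> b = (\<Sum>k. diffs a k * t ^ k)" .
    then show ?thesis
      unfolding ga using termdiffs_strong_converges_everywhere[OF s] by simp
  qed
  then show "(?g has_vector_derivative T (?g t)) (at t)"
    unfolding has_vector_derivative_def has_derivative_componentwise_within[of ?g]
    by (auto simp: has_field_derivative_def mult_commute_abs)
qed

text \<open>The matrix exponential \<open>e\<^sup>t\<^sup>M\<close>, the flow of the linear equation \<open>x' = M x\<close>.\<close>

definition flow :: "real ^ 'n ^ 'n \<Rightarrow> real \<Rightarrow> real ^ 'n ^ 'n" where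
  "flow M t = mat_exp (t *\<^sub>R M)"

lemma bounded_bilinear_matrix_matrix_mult [bounded_bilinear]:
  "bounded_bilinear ((**) :: real ^ 'n ^ 'm \<Rightarrow> real ^ 'p ^ 'n \<Rightarrow> real ^ 'p ^ 'm)"
  unfolding bilinear_conv_bounded_bilinear[symmetric] bilinear_def
  by (auto intro!: linearI simp: matrix_add_ldistrib scalar_matrix_assoc matrix_scalar_ac
      matrix_matrix_mult_def vec_eq_iff sum.distrib distrib_right distrib_left
      sum_distrib_left mult_ac)

lemma bounded_bilinear_matrix_vector_mult [bounded_bilinear]:
  "bounded_bilinear ((*v) :: real ^ 'n ^ 'm \<Rightarrow> real ^ 'n \<Rightarrow> real ^ 'm)"
  unfolding bilinear_conv_bounded_bilinear[symmetric] bilinear_def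
  by (auto intro!: linearI simp: matrix_vector_right_distrib matrix_vector_mult_add_rdistrib
      scaleR_matrix_vector_assoc matrix_vector_mult_scaleR)

lemma flow_series: "flow M t = (\<Sum>k. (t ^ k / fact k) *\<^sub>R (((**) M ^^ k) (mat 1)))"
proof -
  have "((**) (t *\<^sub>R M) ^^ k) (mat 1) = t ^ k *\<^sub>R ((**) M ^^ k) (mat 1)" for k
    by (induction k) (auto simp: scalar_matrix_assoc[symmetric] matrix_scalar_ac)
  then show ?thesis by (simp add: flow_def mat_exp_def mult.commute)
qed

lemma flow_0 [simp]: "flow M 0 = mat 1"
proof -
  have "flow M 0 = (\<Sum>k. if k = 0 then ((**) M ^^ k) (mat 1) else 0)"
    unfolding flow_series by (intro suminf_cong) (auto simp: power_0_left)
  also have "\<dots> = mat 1"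
    by (subst suminf_finite[of "{0}"]) auto
  finally show ?thesis .
qed

lemma flow_commute: "M ** flow M t = flow M t ** M"
proof -
  note T = bounded_bilinear.bounded_linear_right[OF bounded_bilinear_matrix_matrix_mult, of M]
  note T' = bounded_bilinear.bounded_linear_left[OF bounded_bilinear_matrix_matrix_mult, of M]
  note sm = power_series_operator(1)[OF T]
  have "M ** ((**) M ^^ k) (mat 1) = ((**) M ^^ k) (mat 1) ** M" for k
    by (induction k) (auto simp: matrix_mul_assoc)
  then show ?thesis
    unfolding flow_series
    by (simp add: bounded_linear.suminf[OF T sm] bounded_linear.suminf[OF T' sm]
        matrix_scalar_ac scalar_matrix_assoc[symmetric])
qed

lemma flow_has_vector_derivative:
  "(flow M has_vector_derivative M ** flow M t) (at t within S)"
  using power_series_operator(2)[OF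
      bounded_bilinear.bounded_linear_right[OF bounded_bilinear_matrix_matrix_mult, of M], of "mat 1" t]
  by (simp add: flow_series[abs_def] has_vector_derivative_at_within)

lemma flow_neg_has_vector_derivative:
  "((\<lambda>t. flow M (- t)) has_vector_derivative - (flow M (- t) ** M)) (at t within S)"
proof -
  have "(uminus has_vector_derivative - 1) (at t within S)"
    by (auto intro!: derivative_eq_intros)
  from vector_diff_chain_within[OF this flow_has_vector_derivative[of M]] show ?thesis
    by (simp add: flow_commute o_def)
qed

lemma continuous_on_flow:
  "continuous_on S g \<Longrightarrow> continuous_on S (\<lambda>x. flow M (g x))"
  by (rule continuous_on_compose2[of UNIV "flow M"])
    (auto intro!: continuous_at_imp_continuous_on has_vector_derivative_continuous
      flow_has_vector_derivative)

text \<open>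
  The group law: \<open>s \<mapsto> e\<^bsup>-sM\<^esup> e\<^bsup>(s+t)M\<^esup>\<close> has derivative zero.
\<close>

lemma flow_add: "flow M (s + t) = flow M s ** flow M t"
proof -
  have A: "flow M (- s) ** flow M (s + t) = flow M t" for s t
  proof -
    have "((\<lambda>s. flow M (s + t)) has_vector_derivative M ** flow M (s + t)) (at s)" for s
    proof -
      have "((\<lambda>s. s + t) has_vector_derivative 1) (at s)"
        by (auto intro!: derivative_eq_intros)
      from vector_diff_chain_at[OF this flow_has_vector_derivative[of M]] show ?thesis
        by (simp add: o_def)
    qed
    then have "((\<lambda>s. flow M (- s) ** flow M (s + t)) has_vector_derivative
        flow M (- s) ** (M ** flow M (s + t)) + - (flow M (- s) ** M) ** flow M (s + t)) (at s)" for s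
      by (intro bounded_bilinear.has_vector_derivative[OF bounded_bilinear_matrix_matrix_mult]
          flow_neg_has_vector_derivative)
    then have "((\<lambda>s. flow M (- s) ** flow M (s + t)) has_vector_derivative 0) (at s)" for s
      by (simp add: matrix_mul_assoc
          bounded_bilinear.minus_left[OF bounded_bilinear_matrix_matrix_mult])
    then obtain c where "\<And>s. flow M (- s) ** flow M (s + t) = c"
      using has_vector_derivative_zero_constant[of UNIV "\<lambda>s. flow M (- s) ** flow M (s + t)"] by auto
    from this[of s] this[of 0] show ?thesis by simp
  qed
  have "flow M s ** flow M (- s) = mat 1"
    using A[of "-s" 0] by simp
  then show ?thesis
    using arg_cong[OF A[of s t], of "(**) (flow M s)"] by (simp add: matrix_mul_assoc)
qed

lemma flow_add_vector: "flow M (s + t) *v x = flow M s *v (flow M t *v x)"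
  by (simp add: flow_add matrix_vector_mul_assoc)

lemma flow_inverse: "flow M t *v (flow M (- t) *v x) = x" "flow M (- t) *v (flow M t *v x) = x"
  by (simp_all flip: flow_add_vector)

text \<open>
  If \<open>\<langle>M x, x\<rangle> \<le> - a |x|\<^sup>2\<close>, then \<open>e\<^sup>2\<^sup>a\<^sup>t |e\<^sup>t\<^sup>M x|\<^sup>2\<close> is nonincreasing.
\<close>

lemma dissipative_flow_decay:
  assumes M: "\<And>x. (M *v x) \<bullet> x \<le> - a * (norm x)\<^sup>2" and "0 \<le> t"
  shows "norm (flow M t *v x) \<le> exp (- a * t) * norm x"
proof -
  define y where "y t = flow M t *v x" for t
  define g where "g t = exp (2 * a * t) * (y t \<bullet> y t)" for t
  have y: "(y has_vector_derivative M *v y t) (at t)" for t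
    using bounded_bilinear.has_vector_derivative[OF bounded_bilinear_matrix_vector_mult
        flow_has_vector_derivative has_vector_derivative_const]
    by (simp add: y_def[abs_def] matrix_vector_mul_assoc)
  have "((\<lambda>t. y t \<bullet> y t) has_vector_derivative y t \<bullet> (M *v y t) + (M *v y t) \<bullet> y t) (at t)" for t
    by (rule bounded_bilinear.has_vector_derivative[OF bounded_bilinear_inner y y])
  then have "((\<lambda>t. y t \<bullet> y t) has_real_derivative 2 * ((M *v y t) \<bullet> y t)) (at t)" for t
    by (simp add: has_real_derivative_iff_has_vector_derivative inner_commute)
  then have g': "(g has_real_derivative
      exp (2 * a * t) * (2 * ((M *v y t) \<bullet> y t) + 2 * a * (y t \<bullet> y t))) (at t)" for t
    unfolding g_def[abs_def] by (auto intro!: derivative_eq_intros simp: algebra_simps)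
  have "2 * ((M *v y t) \<bullet> y t) + 2 * a * (y t \<bullet> y t) \<le> 0" for t
    using M[of "y t"] by (simp add: power2_norm_eq_inner)
  then have "g t \<le> g 0"
    using g' \<open>0 \<le> t\<close> by (intro DERIV_nonpos_imp_nonincreasing[of 0 t g])
      (auto intro!: exI mult_nonneg_nonpos)
  then have "(exp (a * t) * norm (y t))\<^sup>2 \<le> (norm x)\<^sup>2"
    by (simp add: g_def y_def power_mult_distrib power2_norm_eq_inner exp_double[symmetric] mult.assoc)
  then have "exp (a * t) * norm (y t) \<le> norm x"
    by (rule power2_le_imp_le) simp
  then show ?thesis by (simp add: y_def exp_minus field_simps)
qed

section \<open>Right-continuous functions\<close>

text \<open>
  A right-continuous function is the pointwise limit of the step functions that take, on each interval
  of length \<open>1 / (n + 1)\<close>, its value at the right end point.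
\<close>

lemma right_continuous_imp_borel_measurable:
  fixes f :: "real \<Rightarrow> 'a::metric_space"
  assumes f: "\<And>t. (f \<longlongrightarrow> f t) (at_right t)"
  shows "f \<in> borel_measurable borel"
proof (rule borel_measurable_LIMSEQ_metric)
  define p :: "nat \<Rightarrow> real \<Rightarrow> real" where "p n t = (of_int \<lfloor>t * real (Suc n)\<rfloor> + 1) / real (Suc n)" for n t
  show "(\<lambda>t. f (p n t)) \<in> borel_measurable borel" for n
  proof -
    have "(\<lambda>k::int. f ((of_int k + 1) / real (Suc n))) \<in> measurable (count_space UNIV) borel"
      by simp
    moreover have "(\<lambda>t. \<lfloor>t * real (Suc n)\<rfloor>) \<in> measurable borel (count_space UNIV)"
      by measurable
    ultimately show ?thesis
      unfolding p_def[abs_def] by (rule measurable_compose[rotated])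
  qed
  fix t :: real
  have gt: "t < p n t" and le: "p n t \<le> t + 1 / real (Suc n)" for n
  proof -
    have "t * real (Suc n) < of_int \<lfloor>t * real (Suc n)\<rfloor> + 1"
      by linarith
    then show "t < p n t" by (simp add: p_def pos_less_divide_eq del: of_nat_Suc)
    have "of_int \<lfloor>t * real (Suc n)\<rfloor> + 1 \<le> (t + 1 / real (Suc n)) * real (Suc n)"
      by (simp add: distrib_right del: of_nat_Suc)
    then show "p n t \<le> t + 1 / real (Suc n)" by (simp add: p_def pos_divide_le_eq del: of_nat_Suc)
  qed
  have "(\<lambda>n. p n t) \<longlonglongrightarrow> t"
  proof (rule tendsto_sandwich)
    show "\<forall>\<^sub>F n in sequentially. t \<le> p n t" using gt less_imp_le by (intro always_eventually) blast
    show "\<forall>\<^sub>F n in sequentially. p n t \<le> t + 1 / real (Suc n)" using le by (intro always_eventually) blast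
    show "(\<lambda>n. t + 1 / real (Suc n)) \<longlonglongrightarrow> t"
      using tendsto_add[OF tendsto_const LIMSEQ_Suc[OF lim_1_over_n], of t] by simp
  qed simp
  then have "filterlim (\<lambda>n. p n t) (at_right t) sequentially"
  proof -
    have "p n t \<noteq> t" for n using gt[of n] by simp
    then show ?thesis
      using \<open>(\<lambda>n. p n t) \<longlonglongrightarrow> t\<close> gt by (simp add: filterlim_at)
  qed
  with f show "(\<lambda>n. f (p n t)) \<longlonglongrightarrow> f t" by (rule filterlim_compose)
qed

lemma continuous_on_imp_right_continuous:
  fixes x :: "real \<Rightarrow> 'a::topological_space"
  assumes "continuous_on {a..b} x" "a \<le> t" "t < b"
  shows "(x \<longlongrightarrow> x t) (at_right t)"
proof -
  have "continuous_on {t..b} x"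
    using assms by (auto intro: continuous_on_subset)
  then have "(x \<longlongrightarrow> x t) (at t within {t..b})"
    using assms by (auto simp: continuous_on)
  then show ?thesis using assms by (simp add: at_within_Icc_at_right)
qed

lemma absolutely_integrable_onI:
  fixes f :: "real \<Rightarrow> 'a::euclidean_space"
  assumes "f \<in> borel_measurable borel" "S \<in> sets borel" "g integrable_on S"
    and "\<And>x. x \<in> S \<Longrightarrow> norm (f x) \<le> g x"
  shows "f absolutely_integrable_on S"
  using assms
  by (intro measurable_bounded_by_integrable_imp_absolutely_integrable[where g = g])
    (auto intro!: measurable_restrict_space1 measurable_completion)

lemma flow_absolutely_integrable:
  fixes M :: "real ^ 'n ^ 'n"
  assumes "f absolutely_integrable_on {a..b}"
  shows "(\<lambda>r. flow M (- r) *v f r) absolutely_integrable_on {a..b::real}"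
proof (rule absolutely_integrable_bounded_measurable_product[where h = "(*v)", OF _ _ _ _ assms])
  show "bilinear ((*v) :: real ^ 'n ^ 'n \<Rightarrow> real ^ 'n \<Rightarrow> real ^ 'n)"
    by (simp add: bilinear_conv_bounded_bilinear bounded_bilinear_matrix_vector_mult)
  have c: "continuous_on {a..b} (\<lambda>r. flow M (- r))"
    by (intro continuous_on_flow continuous_intros)
  then show "(\<lambda>r. flow M (- r)) \<in> borel_measurable (lebesgue_on {a..b})"
    by (rule continuous_imp_measurable_on_sets_lebesgue) auto
  show "bounded ((\<lambda>r. flow M (- r)) ` {a..b})"
    using c by (intro compact_imp_bounded compact_continuous_image) auto
qed auto

lemma integral_has_right_derivative:
  fixes f :: "real \<Rightarrow> 'a::euclidean_space"
  assumes "f integrable_on {a..b}" "a \<le> t" "t < b" "(f \<longlongrightarrow> f t) (at_right t)"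
  shows "((\<lambda>u. integral {a..u} f) has_vector_derivative f t) (at_right t)"
proof -
  have tb: "f integrable_on {t..b}"
    using assms by (auto intro: integrable_on_subinterval)
  have "((\<lambda>u. integral {t..u} f) has_vector_derivative f t) (at t within {t..b})"
    using integral_has_vector_derivative_continuous_at[OF tb, of t "{}"] assms
    by (auto simp: continuous_within at_within_Icc_at_right)
  then have "((\<lambda>u. integral {a..t} f + integral {t..u} f) has_vector_derivative 0 + f t) (at t within {t..b})"
    by (intro has_vector_derivative_add has_vector_derivative_const)
  then have "((\<lambda>u. integral {a..u} f) has_vector_derivative 0 + f t) (at t within {t..b})"
  proof (rule has_vector_derivative_transform[rotated 2])
    fix u assume "u \<in> {t..b}"
    then show "integral {a..u} f = integral {a..t} f + integral {t..u} f"
      using assms by (intro Henstock_Kurzweil_Integration.integral_combine[symmetric])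
        (auto intro: integrable_on_subinterval)
  qed (use assms in auto)
  then show ?thesis
    using assms by (simp add: at_within_Icc_at_right)
qed

text \<open>
  The forcing terms below are merely right-continuous, so their indefinite integrals have only
  right derivatives; this is the uniqueness statement which then replaces the mean value theorem.
\<close>

lemma zero_right_derivative_imp_const:
  fixes h :: "real \<Rightarrow> 'a::real_normed_vector"
  assumes h: "continuous_on {a..b} h" and "a \<le> b"
    and d: "\<And>t. a \<le> t \<Longrightarrow> t < b \<Longrightarrow> (h has_vector_derivative 0) (at_right t)"
  shows "h b = h a"
proof -
  \<comment> \<open>The set of \<open>t\<close> such that the estimate holds on all of \<open>{a..t}\<close> is closed, and its supremum can
    always be pushed to the right.\<close>
  have bound: "norm (h b - h a) \<le> e * (b - a)" if "e > 0" for e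
  proof -
    define K where "K = {t\<in>{a..b}. norm (h t - h a) - e * (t - a) \<le> 0}"
    define S where "S = {t\<in>{a..b}. {a..t} \<subseteq> K}"
    have clK: "closed K"
      unfolding K_def
      by (intro continuous_on_closed_Collect_le continuous_intros h closed_atLeastAtMost)
    have aS: "a \<in> S" and bdd: "bdd_above S" and Sne: "S \<noteq> {}"
      using \<open>a \<le> b\<close> by (auto simp: S_def K_def intro!: bdd_aboveI[of _ b])
    define c where "c = Sup S"
    have ac: "a \<le> c" unfolding c_def using aS bdd by (rule cSup_upper)
    have cb: "c \<le> b" unfolding c_def using Sne by (rule cSup_least) (auto simp: S_def)
    have lt: "s \<in> K" if "a \<le> s" "s < c" for s
    proof -
      obtain t where "t \<in> S" "s < t" using \<open>s < c\<close> less_cSup_iff[OF Sne bdd] by (auto simp: c_def)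
      then show ?thesis using that by (auto simp: S_def)
    qed
    have cK: "c \<in> K"
    proof (cases "a = c")
      case True then show ?thesis using aS by (auto simp: S_def)
    next
      case False
      then have "closure {a..<c} \<subseteq> K"
        using lt by (intro closure_minimal clK) auto
      then show ?thesis using False ac by auto
    qed
    have "c = b"
    proof (rule ccontr)
      assume "c \<noteq> b"
      then have "c < b" using cb by simp
      then have "(h has_derivative (\<lambda>x. x *\<^sub>R 0)) (at c within {c<..})"
        using d[OF ac] by (simp add: has_vector_derivative_def)
      then obtain r where r: "r > 0"
        "\<And>y. y \<in> {c<..} \<Longrightarrow> norm (y - c) < r \<Longrightarrow> norm (h y - h c) \<le> e * norm (y - c)"
        using \<open>e > 0\<close> unfolding has_derivative_within_alt by (auto simp del: greaterThan_iff)
      define s where "s = min b (c + r / 2)"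
      have "s > c" "s \<le> b" using \<open>c < b\<close> r by (auto simp: s_def)
      have "t \<in> K" if "a \<le> t" "t \<le> s" for t
      proof (cases "t \<le> c")
        case True then show ?thesis using lt[of t] cK that by (cases "t = c") auto
      next
        case False
        then have "norm (h t - h c) \<le> e * (t - c)"
          using r(2)[of t] that \<open>r > 0\<close> by (auto simp: s_def)
        moreover have "norm (h c - h a) \<le> e * (c - a)" using cK by (auto simp: K_def)
        moreover have "norm (h t - h a) \<le> norm (h t - h c) + norm (h c - h a)"
          using norm_triangle_ineq[of "h t - h c" "h c - h a"] by simp
        ultimately show ?thesis using that \<open>s \<le> b\<close> by (auto simp: K_def algebra_simps)
      qed
      then have "s \<in> S" using \<open>s > c\<close> ac \<open>s \<le> b\<close> by (auto simp: S_def)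
      then have "s \<le> c" unfolding c_def using bdd by (intro cSup_upper)
      then show False using \<open>s > c\<close> by simp
    qed
    then show ?thesis using cK by (auto simp: K_def)
  qed
  have "norm (h b - h a) \<le> 0"
  proof (rule field_le_epsilon)
    fix e :: real assume "e > 0"
    have "norm (h b - h a) \<le> e / (b - a + 1) * (b - a)"
      using \<open>e > 0\<close> \<open>a \<le> b\<close> by (intro bound) auto
    also have "\<dots> \<le> e" using \<open>e > 0\<close> \<open>a \<le> b\<close> by (simp add: field_simps)
    finally show "norm (h b - h a) \<le> 0 + e" by simp
  qed
  then show ?thesis by simp
qed

section \<open>Variation of constants\<close>

text \<open>
  Multiplication by \<open>e\<^bsup>-tM\<^esup>\<close> removes the linear part. This form of the variation of constants formula, with
  \<open>e\<^bsup>-tM\<^esup> x t\<close> as an indefinite integral, is convenient because it is additive in the forcing and can be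
  restarted at any time.
\<close>

lemma flow_neg_mult_has_right_derivative:
  assumes "(x has_vector_derivative M *v x t + y) (at t within S)"
  shows "((\<lambda>t. flow M (- t) *v x t) has_vector_derivative flow M (- t) *v y) (at t within S)"
proof -
  have "((\<lambda>t. flow M (- t) *v x t) has_vector_derivative
     flow M (- t) *v (M *v x t + y) + - (flow M (- t) ** M) *v x t) (at t within S)"
    by (rule bounded_bilinear.has_vector_derivative[OF bounded_bilinear_matrix_vector_mult
          flow_neg_has_vector_derivative assms])
  then show ?thesis
    by (simp add: matrix_vector_right_distrib matrix_vector_mul_assoc
        bounded_bilinear.minus_left[OF bounded_bilinear_matrix_vector_mult])
qed

lemma flow_neg_tendsto: "((\<lambda>r. flow M (- r)) \<longlongrightarrow> flow M (- t)) (at_right t)"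
  using has_vector_derivative_continuous[OF flow_neg_has_vector_derivative]
  by (simp add: continuous_within)

text \<open>
  Both directions of the equivalence between the integrated equation and the variation of constants
  formula hold because the difference of the two sides has right derivative zero everywhere.
\<close>

lemma variation_of_constants:
  assumes "a \<le> b" and f: "f absolutely_integrable_on {a..b}"
    and fr: "\<And>t. a \<le> t \<Longrightarrow> t < b \<Longrightarrow> (f \<longlongrightarrow> f t) (at_right t)"
    and int: "(\<lambda>r. M *v x r + f r) integrable_on {a..b}"
    and x: "\<And>t. a \<le> t \<Longrightarrow> t \<le> b \<Longrightarrow> x t - x a = integral {a..t} (\<lambda>r. M *v x r + f r)"
  shows "flow M (- b) *v x b - flow M (- a) *v x a = integral {a..b} (\<lambda>r. flow M (- r) *v f r)"
proof -
  let ?g = "\<lambda>r. M *v x r + f r" and ?k = "\<lambda>r. flow M (- r) *v f r"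
  have xeq: "x t = x a + integral {a..t} ?g" if "t \<in> {a..b}" for t
    using x[of t] that by (simp add: diff_eq_eq add.commute)
  have cx: "continuous_on {a..b} x"
  proof (rule continuous_on_eq[OF _ xeq[symmetric]])
    show "continuous_on {a..b} (\<lambda>t. x a + integral {a..t} ?g)"
      by (intro continuous_on_add continuous_on_const indefinite_integral_continuous_1 int)
  qed
  have kint: "?k integrable_on {a..b}"
    using flow_absolutely_integrable[OF f] by (rule set_lebesgue_integral_eq_integral)
  have xr: "(x \<longlongrightarrow> x t) (at_right t)" if "a \<le> t" "t < b" for t
    using cx that by (rule continuous_on_imp_right_continuous)
  define h where "h t = flow M (- t) *v x t - integral {a..t} ?k" for t
  have "h b = h a"
  proof (rule zero_right_derivative_imp_const[where h = h and a = a and b = b])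
    show "continuous_on {a..b} h"
      unfolding h_def
      by (intro continuous_on_diff continuous_on_flow continuous_on_minus continuous_on_id cx
          indefinite_integral_continuous_1 kint
          bounded_bilinear.continuous_on[OF bounded_bilinear_matrix_vector_mult])
    fix t assume t: "a \<le> t" "t < b"
    have gr: "(?g \<longlongrightarrow> ?g t) (at_right t)"
      using fr[OF t] xr[OF t]
      by (intro tendsto_add bounded_linear.tendsto[OF matrix_vector_mul_bounded_linear])
    have "((\<lambda>u. x a + integral {a..u} ?g) has_vector_derivative 0 + ?g t) (at t within {t..b})"
      using integral_has_right_derivative[OF int t gr] t
      by (intro has_vector_derivative_add has_vector_derivative_const)
        (simp add: at_within_Icc_at_right)
    then have xd: "(x has_vector_derivative 0 + ?g t) (at t within {t..b})"
    proof (rule has_vector_derivative_transform[rotated 2])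
      show "x u = x a + integral {a..u} ?g" if "u \<in> {t..b}" for u
        using that t by (intro xeq) auto
    qed (use t in auto)
    have "((\<lambda>u. integral {a..u} ?k) has_vector_derivative ?k t) (at_right t)"
      by (intro integral_has_right_derivative[OF kint t] flow_neg_tendsto fr t
          bounded_bilinear.tendsto[OF bounded_bilinear_matrix_vector_mult])
    then have "(h has_vector_derivative ?k t - ?k t) (at_right t)"
      unfolding h_def[abs_def]
      using flow_neg_mult_has_right_derivative[OF xd[simplified]] t
      by (intro has_vector_derivative_diff) (auto simp: at_within_Icc_at_right)
    then show "(h has_vector_derivative 0) (at_right t)" by simp
  qed fact
  then show ?thesis using \<open>a \<le> b\<close> by (simp add: h_def algebra_simps)
qed

lemma variation_of_constants_converse:
  assumes "a \<le> b" and f: "f absolutely_integrable_on {a..b}"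
    and fr: "\<And>t. a \<le> t \<Longrightarrow> t < b \<Longrightarrow> (f \<longlongrightarrow> f t) (at_right t)"
    and x: "\<And>t. a \<le> t \<Longrightarrow> t \<le> b \<Longrightarrow>
      flow M (- t) *v x t - flow M (- a) *v x a = integral {a..t} (\<lambda>r. flow M (- r) *v f r)"
  shows "(\<lambda>r. M *v x r + f r) absolutely_integrable_on {a..b}"
    and "x b - x a = integral {a..b} (\<lambda>r. M *v x r + f r)"
proof -
  let ?g = "\<lambda>r. M *v x r + f r" and ?k = "\<lambda>r. flow M (- r) *v f r"
  define y where "y t = flow M (- a) *v x a + integral {a..t} ?k" for t
  have xeq: "x t = flow M t *v y t" if "t \<in> {a..b}" for t
  proof -
    have "flow M (- t) *v x t = y t" using x[of t] that by (auto simp: y_def algebra_simps)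
    then show ?thesis by (metis flow_inverse(1))
  qed
  have kint: "?k integrable_on {a..b}"
    using flow_absolutely_integrable[OF f] by (rule set_lebesgue_integral_eq_integral)
  have cy: "continuous_on {a..b} y"
    unfolding y_def by (intro continuous_on_add continuous_on_const indefinite_integral_continuous_1 kint)
  have cx: "continuous_on {a..b} x"
  proof (rule continuous_on_eq)
    show "continuous_on {a..b} (\<lambda>t. flow M t *v y t)"
      by (intro bounded_bilinear.continuous_on[OF bounded_bilinear_matrix_vector_mult]
          continuous_on_flow continuous_on_id cy)
  qed (simp add: xeq)
  show gint: "?g absolutely_integrable_on {a..b}"
    by (intro set_integral_add f absolutely_integrable_continuous_real
        bounded_linear.continuous_on[OF matrix_vector_mul_bounded_linear] cx)
  then have int: "?g integrable_on {a..b}" by (rule set_lebesgue_integral_eq_integral)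
  have xr: "(x \<longlongrightarrow> x t) (at_right t)" if "a \<le> t" "t < b" for t
    using cx that by (rule continuous_on_imp_right_continuous)
  define h where "h t = x t - integral {a..t} ?g" for t
  have "h b = h a"
  proof (rule zero_right_derivative_imp_const[where h = h and a = a and b = b])
    show "continuous_on {a..b} h"
      unfolding h_def by (intro continuous_on_diff cx indefinite_integral_continuous_1 int)
    fix t assume t: "a \<le> t" "t < b"
    have gr: "(?g \<longlongrightarrow> ?g t) (at_right t)"
      using fr[OF t] xr[OF t]
      by (intro tendsto_add bounded_linear.tendsto[OF matrix_vector_mul_bounded_linear])
    have "((\<lambda>u. integral {a..u} ?k) has_vector_derivative ?k t) (at_right t)"
      by (intro integral_has_right_derivative[OF kint t] flow_neg_tendsto fr t
          bounded_bilinear.tendsto[OF bounded_bilinear_matrix_vector_mult])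
    then have "(y has_vector_derivative 0 + ?k t) (at t within {t..b})"
      unfolding y_def[abs_def] using t
      by (intro has_vector_derivative_add has_vector_derivative_const)
        (auto simp: at_within_Icc_at_right)
    then have "((\<lambda>t. flow M t *v y t) has_vector_derivative
        flow M t *v (0 + ?k t) + (M ** flow M t) *v y t) (at t within {t..b})"
      by (intro bounded_bilinear.has_vector_derivative[OF bounded_bilinear_matrix_vector_mult]
          flow_has_vector_derivative)
    moreover have "flow M t *v (0 + ?k t) + (M ** flow M t) *v y t = ?g t"
      using xeq[of t] t by (simp add: flow_inverse flip: matrix_vector_mul_assoc)
    ultimately have "((\<lambda>t. flow M t *v y t) has_vector_derivative ?g t) (at t within {t..b})"
      by (simp only:)
    then have "(x has_vector_derivative ?g t) (at t within {t..b})"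
    proof (rule has_vector_derivative_transform[rotated 2])
      show "x u = flow M u *v y u" if "u \<in> {t..b}" for u
        using that t by (intro xeq) auto
    qed (use t in auto)
    then have "(h has_vector_derivative ?g t - ?g t) (at_right t)"
      unfolding h_def[abs_def] using t
      by (intro has_vector_derivative_diff integral_has_right_derivative[where b = b] int gr)
        (auto simp: at_within_Icc_at_right)
    then show "(h has_vector_derivative 0) (at_right t)" by simp
  qed fact
  then show "x b - x a = integral {a..b} ?g" using \<open>a \<le> b\<close> by (simp add: h_def algebra_simps)
qed

section \<open>Exponentially weighted integrals over half-lines\<close>

lemma absolutely_integrable_affine:
  fixes f :: "real \<Rightarrow> 'a::euclidean_space"
  assumes "\<bar>c\<bar> = 1"
  shows "(\<lambda>s. f (t + c * s)) absolutely_integrable_on {s. t + c * s \<in> S} \<longleftrightarrow> f absolutely_integrable_on S"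
    and "f absolutely_integrable_on S \<Longrightarrow>
      integral {s. t + c * s \<in> S} (\<lambda>s. f (t + c * s)) = integral S f"
proof -
  have c: "c \<noteq> 0" using assms by auto
  have ind: "indicator {s. t + c * s \<in> S} s *\<^sub>R f (t + c * s)
      = (\<lambda>x. indicator S x *\<^sub>R f x) (t + c * s)" for s
    by (simp add: indicator_def)
  show iff: "(\<lambda>s. f (t + c * s)) absolutely_integrable_on {s. t + c * s \<in> S}
      \<longleftrightarrow> f absolutely_integrable_on S"
    unfolding set_integrable_def ind by (rule lebesgue_integrable_real_affine_iff[OF c])
  show "integral {s. t + c * s \<in> S} (\<lambda>s. f (t + c * s)) = integral S f"
    if "f absolutely_integrable_on S"
  proof -
    have "integral {s. t + c * s \<in> S} (\<lambda>s. f (t + c * s))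
        = set_lebesgue_integral lebesgue {s. t + c * s \<in> S} (\<lambda>s. f (t + c * s))"
      by (rule set_lebesgue_integral_eq_integral(2)[symmetric]) (use iff that in blast)
    also have "\<dots> = integral\<^sup>L lebesgue (\<lambda>s. (\<lambda>x. indicator S x *\<^sub>R f x) (t + c * s))"
      by (simp only: set_lebesgue_integral_def ind)
    also have "\<dots> = integral\<^sup>L lebesgue (\<lambda>x. indicator S x *\<^sub>R f x)"
      by (subst lebesgue_integral_real_affine[OF c, of "\<lambda>x. indicator S x *\<^sub>R f x" t])
        (simp only: assms scaleR_one)
    also have "\<dots> = integral S f"
      using set_lebesgue_integral_eq_integral(2)[OF that] by (simp only: set_lebesgue_integral_def)
    finally show ?thesis .
  qed
qed

lemma has_integral_exp_from_minus_infinity: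
  assumes "a > (0::real)"
  shows "((\<lambda>s. exp (a * s)) has_integral exp (a * t) / a) {..t}"
proof -
  let ?f = "\<lambda>s. exp (- a * s)"
  have hi: "(?f has_integral exp (- a * (- t)) / a) {- t..}"
    using assms by (rule has_integral_exp_minus_to_infinity)
  then have ai: "?f absolutely_integrable_on {- t..}"
    by (intro nonnegative_absolutely_integrable_1) (auto simp: integrable_on_def)
  have S: "{s. 0 + (- 1) * s \<in> {- t..}} = {..t}" by auto
  have "(\<lambda>s. ?f (0 + (- 1) * s)) absolutely_integrable_on {s. 0 + (- 1) * s \<in> {- t..}}"
    using ai by (subst absolutely_integrable_affine(1)) auto
  then have 1: "(\<lambda>s. exp (a * s)) integrable_on {..t}"
    unfolding S by (auto dest: set_lebesgue_integral_eq_integral(1))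
  have "integral {s. 0 + (- 1) * s \<in> {- t..}} (\<lambda>s. ?f (0 + (- 1) * s)) = exp (a * t) / a"
    by (subst absolutely_integrable_affine(2)[OF _ ai]) (use integral_unique[OF hi] in auto)
  then have "integral {..t} (\<lambda>s. exp (a * s)) = exp (a * t) / a"
    unfolding S by simp
  with 1 show ?thesis by (simp add: has_integral_iff)
qed

lemma flow_integral:
  fixes M :: "real ^ 'n ^ 'n"
  shows "(\<lambda>s. flow M (t - s) *v f s) absolutely_integrable_on S \<longleftrightarrow>
      (\<lambda>s. flow M (- s) *v f s) absolutely_integrable_on S"
    and "(\<lambda>s. flow M (- s) *v f s) absolutely_integrable_on S \<Longrightarrow>
      integral S (\<lambda>s. flow M (t - s) *v f s) = flow M t *v integral S (\<lambda>s. flow M (- s) *v f s)"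
proof -
  have eq: "flow M (t - s) *v x = flow M t *v (flow M (- s) *v x)" for s x
    using flow_add_vector[of M t "- s" x] by simp
  have eq': "flow M (- s) *v x = flow M (- t) *v (flow M (t - s) *v x)" for s x
    using flow_add_vector[of M "- t" "t - s" x] by simp
  show "(\<lambda>s. flow M (t - s) *v f s) absolutely_integrable_on S \<longleftrightarrow>
      (\<lambda>s. flow M (- s) *v f s) absolutely_integrable_on S"
  proof
    assume "(\<lambda>s. flow M (- s) *v f s) absolutely_integrable_on S"
    from absolutely_integrable_linear[OF this matrix_vector_mul_bounded_linear, of "flow M t"]
    show "(\<lambda>s. flow M (t - s) *v f s) absolutely_integrable_on S"
      unfolding o_def eq .
  next
    assume "(\<lambda>s. flow M (t - s) *v f s) absolutely_integrable_on S"
    from absolutely_integrable_linear[OF this matrix_vector_mul_bounded_linear, of "flow M (- t)"]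
    show "(\<lambda>s. flow M (- s) *v f s) absolutely_integrable_on S"
      unfolding o_def eq'[symmetric] .
  qed
  assume "(\<lambda>s. flow M (- s) *v f s) absolutely_integrable_on S"
  then have "(\<lambda>s. flow M (- s) *v f s) integrable_on S"
    by (rule set_lebesgue_integral_eq_integral)
  from integral_linear[OF this matrix_vector_mul_bounded_linear, of "flow M t"]
  show "integral S (\<lambda>s. flow M (t - s) *v f s) = flow M t *v integral S (\<lambda>s. flow M (- s) *v f s)"
    by (simp add: o_def eq)
qed

lemma flow_borel_measurable:
  assumes "f \<in> borel_measurable borel"
  shows "(\<lambda>s. flow M (t - s) *v f s) \<in> borel_measurable borel"
proof -
  have "(\<lambda>s. flow M (t - s)) \<in> borel_measurable borel"
    by (intro borel_measurable_continuous_onI continuous_on_flow continuous_intros)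
  then have "(\<lambda>s. (flow M (t - s), f s)) \<in> borel_measurable borel"
    using assms by (rule borel_measurable_Pair)
  moreover have "continuous_on UNIV (\<lambda>p :: (real ^ 'a ^ 'a) \<times> (real ^ 'a). fst p *v snd p)"
    by (intro bounded_bilinear.continuous_on[OF bounded_bilinear_matrix_vector_mult] continuous_intros)
  ultimately show ?thesis
    using borel_measurable_continuous_on[of "\<lambda>p. fst p *v snd p"] by fastforce
qed

lemma integral_split_atMost:
  fixes k :: "real \<Rightarrow> 'a::euclidean_space"
  assumes "k integrable_on {..s}" "k integrable_on {s..t}" "s \<le> t"
  shows "integral {..t} k = integral {..s} k + integral {s..t} k"
proof -
  have "(k has_integral integral {..s} k + integral {s..t} k) ({..s} \<union> {s..t})"
  proof (rule has_integral_Un)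
    have "{..s} \<inter> {s..t} \<subseteq> {s}" by auto
    then show "negligible ({..s} \<inter> {s..t})" using negligible_sing negligible_subset by blast
  qed (use assms in auto)
  moreover have "{..s} \<union> {s..t} = {..t}" using assms by auto
  ultimately show ?thesis by (simp add: integral_unique)
qed

lemma integral_split_atLeast:
  fixes k :: "real \<Rightarrow> 'a::euclidean_space"
  assumes "k integrable_on {t..}" "k integrable_on {s..t}" "s \<le> t"
  shows "integral {s..} k = integral {s..t} k + integral {t..} k"
proof -
  have "(k has_integral integral {s..t} k + integral {t..} k) ({s..t} \<union> {t..})"
  proof (rule has_integral_Un)
    have "{s..t} \<inter> {t..} \<subseteq> {t}" by auto
    then show "negligible ({s..t} \<inter> {t..})" using negligible_sing negligible_subset by blast
  qed (use assms in auto)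
  moreover have "{s..t} \<union> {t..} = {s..}" using assms by auto
  ultimately show ?thesis by (simp add: integral_unique)
qed

lemma continuous_on_indefinite:
  fixes y :: "real \<Rightarrow> 'a::euclidean_space"
  assumes k: "\<And>s t. k integrable_on {s..t}"
    and y: "\<And>s t. s \<le> t \<Longrightarrow> y t - y s = integral {s..t} k"
  shows "continuous_on UNIV y"
proof -
  have "isCont y t" for t
  proof -
    have "continuous_on {t - 1..t + 1} (\<lambda>u. y (t - 1) + integral {t - 1..u} k)"
      by (intro continuous_on_add continuous_on_const indefinite_integral_continuous_1 k)
    then have "continuous_on {t - 1..t + 1} y"
      by (rule continuous_on_eq) (simp flip: y)
    then have "continuous_on {t - 1<..<t + 1} y"
      by (rule continuous_on_subset) auto
    then show ?thesis by (simp add: continuous_on_eq_continuous_at)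
  qed
  then show ?thesis by (simp add: continuous_at_imp_continuous_on)
qed

text \<open>
  Forward convolutions with a decaying flow, for forcings dominated by \<open>e\<^bsup>-cs\<^esup>\<close>. The two constants
  \<open>1 / (a - c)\<close> here and \<open>1 / (c - b)\<close> below are those of the contraction condition.
\<close>

context
  fixes M :: "real ^ 'n ^ 'n" and a c :: real
  assumes decay: "\<And>s x. 0 \<le> s \<Longrightarrow> norm (flow M s *v x) \<le> exp (- a * s) * norm x"
    and ca: "c < a"
begin

lemma stable_kernel_bound:
  assumes "norm y \<le> C * exp (- c * s)" "s \<le> t"
  shows "norm (flow M (t - s) *v y) \<le> C * exp (- a * t) * exp ((a - c) * s)"
proof -
  have "norm (flow M (t - s) *v y) \<le> exp (- a * (t - s)) * norm y"
    using decay[of "t - s"] assms by simp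
  also have "\<dots> \<le> exp (- a * (t - s)) * (C * exp (- c * s))"
    using assms by (intro mult_left_mono) auto
  also have "\<dots> = C * exp (- a * t) * exp ((a - c) * s)"
    by (simp add: algebra_simps flip: exp_add)
  finally show ?thesis .
qed

lemma stable_weight_integral:
  "((\<lambda>s. C * exp (- a * t) * exp ((a - c) * s)) has_integral C * exp (- c * t) / (a - c)) {..t}"
proof -
  have "((\<lambda>s. C * exp (- a * t) * exp ((a - c) * s)) has_integral
      C * exp (- a * t) * (exp ((a - c) * t) / (a - c))) {..t}"
    using ca by (intro has_integral_mult_right has_integral_exp_from_minus_infinity) simp
  moreover have "C * exp (- a * t) * (exp ((a - c) * t) / (a - c)) = C * exp (- c * t) / (a - c)"
    by (simp add: algebra_simps flip: exp_add)
  ultimately show ?thesis by (simp only:)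
qed

lemma stable_absolutely_integrable:
  assumes "f \<in> borel_measurable borel" and "\<And>s. s \<le> t \<Longrightarrow> norm (f s) \<le> C * exp (- c * s)"
  shows "(\<lambda>s. flow M (t - s) *v f s) absolutely_integrable_on {..t}"
proof (rule absolutely_integrable_onI[OF flow_borel_measurable[OF assms(1)]])
  show "(\<lambda>s. C * exp (- a * t) * exp ((a - c) * s)) integrable_on {..t}"
    using stable_weight_integral by (rule has_integral_integrable)
  show "norm (flow M (t - s) *v f s) \<le> C * exp (- a * t) * exp ((a - c) * s)" if "s \<in> {..t}" for s
    by (rule stable_kernel_bound) (use that assms in auto)
qed simp

lemma stable_integral_bound:
  assumes "(\<lambda>s. flow M (t - s) *v f s) integrable_on {..t}"
    and "\<And>s. s \<le> t \<Longrightarrow> norm (f s) \<le> C * exp (- c * s)"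
  shows "norm (integral {..t} (\<lambda>s. flow M (t - s) *v f s)) \<le> C * exp (- c * t) / (a - c)"
proof -
  have "norm (integral {..t} (\<lambda>s. flow M (t - s) *v f s))
      \<le> integral {..t} (\<lambda>s. C * exp (- a * t) * exp ((a - c) * s))"
    using assms stable_weight_integral[of C t]
    by (intro integral_norm_bound_integral stable_kernel_bound) (auto simp: has_integral_integrable)
  then show ?thesis unfolding integral_unique[OF stable_weight_integral] .
qed

end

text \<open>
  Backward convolutions with a flow which grows at most like \<open>e\<^bsup>-bs\<^esup>\<close> into the past.
\<close>

context
  fixes M :: "real ^ 'n ^ 'n" and b :: real
  assumes growth: "\<And>s x. s \<le> 0 \<Longrightarrow> norm (flow M s *v x) \<le> exp (- b * s) * norm x"
begin

lemma unstable_kernel_bound: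
  assumes "norm y \<le> C * exp (- c * s)" "t \<le> s"
  shows "norm (flow M (t - s) *v y) \<le> C * exp (- b * t) * exp (- (c - b) * s)"
proof -
  have "norm (flow M (t - s) *v y) \<le> exp (- b * (t - s)) * norm y"
    using growth[of "t - s"] assms by simp
  also have "\<dots> \<le> exp (- b * (t - s)) * (C * exp (- c * s))"
    using assms by (intro mult_left_mono) auto
  also have "\<dots> = C * exp (- b * t) * exp (- (c - b) * s)"
    by (simp add: algebra_simps flip: exp_add)
  finally show ?thesis .
qed

lemma unstable_weight_integral:
  assumes "b < c"
  shows "((\<lambda>s. C * exp (- b * t) * exp (- (c - b) * s)) has_integral C * exp (- c * t) / (c - b)) {t..}"
proof -
  have "((\<lambda>s. C * exp (- b * t) * exp (- (c - b) * s)) has_integral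
      C * exp (- b * t) * (exp (- (c - b) * t) / (c - b))) {t..}"
    using assms by (intro has_integral_mult_right has_integral_exp_minus_to_infinity) simp
  moreover have "C * exp (- b * t) * (exp (- (c - b) * t) / (c - b)) = C * exp (- c * t) / (c - b)"
    by (simp add: algebra_simps flip: exp_add)
  ultimately show ?thesis by (simp only:)
qed

lemma unstable_absolutely_integrable:
  assumes "f \<in> borel_measurable borel" and "b < c" and "\<And>s. t \<le> s \<Longrightarrow> norm (f s) \<le> C * exp (- c * s)"
  shows "(\<lambda>s. flow M (t - s) *v f s) absolutely_integrable_on {t..}"
proof (rule absolutely_integrable_onI[OF flow_borel_measurable[OF assms(1)]])
  show "(\<lambda>s. C * exp (- b * t) * exp (- (c - b) * s)) integrable_on {t..}"
    using unstable_weight_integral[OF assms(2)] by (rule has_integral_integrable)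
  show "norm (flow M (t - s) *v f s) \<le> C * exp (- b * t) * exp (- (c - b) * s)" if "s \<in> {t..}" for s
    by (rule unstable_kernel_bound) (use that assms in auto)
qed simp

lemma unstable_integral_bound:
  assumes "(\<lambda>s. flow M (t - s) *v f s) integrable_on S" and S: "S \<subseteq> {t..}" "S \<in> sets borel"
    and "b < c" "0 \<le> C" and "\<And>s. s \<in> S \<Longrightarrow> norm (f s) \<le> C * exp (- c * s)"
  shows "norm (integral S (\<lambda>s. flow M (t - s) *v f s)) \<le> C * exp (- c * t) / (c - b)"
proof -
  let ?g = "\<lambda>s. C * exp (- b * t) * exp (- (c - b) * s)"
  note hi = unstable_weight_integral[OF \<open>b < c\<close>, of C t]
  have "S \<in> sets lebesgue"
    by (rule sets_completionI_sets) (simp add: S)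
  moreover have "?g absolutely_integrable_on {t..}"
    using hi \<open>0 \<le> C\<close> by (intro nonnegative_absolutely_integrable_1) (auto simp: has_integral_integrable)
  ultimately have "?g absolutely_integrable_on S"
    using S(1) by (intro set_integrable_subset[of lebesgue "{t..}" ?g S])
  then have gS: "?g integrable_on S"
    by (rule set_lebesgue_integral_eq_integral)
  have "norm (integral S (\<lambda>s. flow M (t - s) *v f s)) \<le> integral S ?g"
    using assms gS by (intro integral_norm_bound_integral unstable_kernel_bound) auto
  also have "\<dots> \<le> integral {t..} ?g"
    using gS hi S \<open>0 \<le> C\<close> by (intro integral_subset_le) (auto simp: has_integral_integrable)
  finally show ?thesis unfolding integral_unique[OF hi] .
qed

lemma backward_integral_bound:
  assumes "(\<lambda>s. flow M (t - s) *v f s) integrable_on {t..0}"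
    and "0 < b" "0 \<le> C" and "\<And>s. t \<le> s \<Longrightarrow> s \<le> 0 \<Longrightarrow> norm (f s) \<le> C"
  shows "norm (integral {t..0} (\<lambda>s. flow M (t - s) *v f s)) \<le> C / b * exp (- b * t)"
proof -
  let ?g = "\<lambda>s. C * exp (- b * t) * exp (b * s)"
  have hi: "(?g has_integral C * exp (- b * t) * (exp (b * 0) / b)) {..0::real}"
    using \<open>0 < b\<close> by (intro has_integral_mult_right has_integral_exp_from_minus_infinity)
  have gS: "?g integrable_on {t..0}"
    by (intro integrable_continuous_interval continuous_intros)
  have "norm (integral {t..0} (\<lambda>s. flow M (t - s) *v f s)) \<le> integral {t..0} ?g"
    using assms gS unstable_kernel_bound[of _ C 0]
    by (intro integral_norm_bound_integral) (auto simp: mult.assoc)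
  also have "\<dots> \<le> integral {..0} ?g"
    using gS hi \<open>0 \<le> C\<close> by (intro integral_subset_le) (auto simp: has_integral_integrable)
  finally show ?thesis unfolding integral_unique[OF hi] by (simp add: mult_ac)
qed

end

section \<open>A fixed point theorem on the whole line\<close>

text \<open>
  Banach's theorem for the sum of the distances of the components. The product type carries the
  Euclidean combination of these distances, for which \<open>T\<close> need not be a contraction; but a
  sufficiently high power of \<open>T\<close> is one, since the two metrics are equivalent.
\<close>

lemma sum_contraction_has_fixed_point:
  fixes T :: "'a::complete_space \<times> 'b::complete_space \<Rightarrow> 'a \<times> 'b"
  defines "d \<equiv> \<lambda>p q :: 'a \<times> 'b. dist (fst p) (fst q) + dist (snd p) (snd q)"
  assumes \<kappa>: "0 \<le> \<kappa>" "\<kappa> < 1" and T: "\<And>p q. d (T p) (T q) \<le> \<kappa> * d p q"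
  shows "\<exists>p. T p = p"
proof -
  have iter: "d ((T ^^ n) p) ((T ^^ n) q) \<le> \<kappa> ^ n * d p q" for n p q
  proof (induction n)
    case (Suc n)
    have "d ((T ^^ Suc n) p) ((T ^^ Suc n) q) \<le> \<kappa> * d ((T ^^ n) p) ((T ^^ n) q)"
      using T by simp
    also have "\<dots> \<le> \<kappa> * (\<kappa> ^ n * d p q)" using Suc \<kappa>(1) by (rule mult_left_mono)
    finally show ?case by (simp add: mult.assoc)
  qed simp
  obtain N where N: "\<kappa> ^ N < 1 / 2"
    using real_arch_pow_inv[of "1 / 2" \<kappa>] \<kappa> by auto
  have le: "dist p q \<le> d p q" and ge: "d p q \<le> 2 * dist p q" for p q :: "'a \<times> 'b"
  proof -
    show "dist p q \<le> d p q"
      using sqrt_sum_squares_le_sum[of "dist (fst p) (fst q)" "dist (snd p) (snd q)"]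
      by (simp add: d_def dist_prod_def)
    show "d p q \<le> 2 * dist p q"
      using dist_fst_le[of p q] dist_snd_le[of p q] unfolding d_def by linarith
  qed
  have "\<exists>!p. (T ^^ N) p = p"
  proof (rule banach_fix_type)
    show "0 \<le> \<kappa> ^ N * 2" "\<kappa> ^ N * 2 < 1" using N \<kappa> by auto
    show "\<forall>p q. dist ((T ^^ N) p) ((T ^^ N) q) \<le> \<kappa> ^ N * 2 * dist p q"
    proof (intro allI)
      fix p q :: "'a \<times> 'b"
      have "dist ((T ^^ N) p) ((T ^^ N) q) \<le> \<kappa> ^ N * d p q" using le iter order_trans by blast
      also have "\<dots> \<le> \<kappa> ^ N * (2 * dist p q)" using ge \<kappa> by (intro mult_left_mono) auto
      finally show "dist ((T ^^ N) p) ((T ^^ N) q) \<le> \<kappa> ^ N * 2 * dist p q" by (simp add: mult.assoc)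
    qed
  qed
  then obtain p where p: "(T ^^ N) p = p" and uniq: "\<And>q. (T ^^ N) q = q \<Longrightarrow> q = p" by blast
  have "(T ^^ N) (T p) = T p" using p by (metis funpow_swap1)
  then show ?thesis using uniq by blast
qed

text \<open>
  Both half-line convolutions satisfy the variation of constants formula and are continuous.
\<close>

lemma stable_convolution_increment:
  fixes M :: "real ^ 'n ^ 'n"
  assumes f: "\<And>t. (\<lambda>s. flow M (t - s) *v f s) absolutely_integrable_on {..t}"
  defines "I \<equiv> \<lambda>t. integral {..t} (\<lambda>s. flow M (t - s) *v f s)"
  shows "(\<lambda>r. flow M (- r) *v f r) absolutely_integrable_on {s..t}"
    and "s \<le> t \<Longrightarrow> flow M (- t) *v I t - flow M (- s) *v I s = integral {s..t} (\<lambda>r. flow M (- r) *v f r)"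
    and "continuous_on UNIV I"
proof -
  let ?k = "\<lambda>r. flow M (- r) *v f r"
  have k: "?k absolutely_integrable_on {..t}" for t
    using f[of t] by (simp add: flow_integral)
  have k': "?k absolutely_integrable_on {s..t}" for s t
    by (rule set_integrable_subset[OF k[of t]]) auto
  then show "?k absolutely_integrable_on {s..t}" .
  have I: "I t = flow M t *v integral {..t} ?k" for t
    unfolding I_def by (rule flow_integral(2)[OF k])
  have y: "flow M (- t) *v I t = integral {..t} ?k" for t
    unfolding I by (rule flow_inverse)
  have inc: "integral {..t} ?k - integral {..s} ?k = integral {s..t} ?k" if "s \<le> t" for s t
    using integral_split_atMost[OF _ _ that, of ?k] k[of s] k'[of s t]
    by (simp add: set_lebesgue_integral_eq_integral(1))
  show "flow M (- t) *v I t - flow M (- s) *v I s = integral {s..t} ?k" if "s \<le> t"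
    unfolding y using that by (rule inc)
  have "continuous_on UNIV (\<lambda>t. integral {..t} ?k)"
    by (rule continuous_on_indefinite[OF _ inc]) (use k' in \<open>auto intro: set_lebesgue_integral_eq_integral(1)\<close>)
  then show "continuous_on UNIV I"
    unfolding I by (intro bounded_bilinear.continuous_on[OF bounded_bilinear_matrix_vector_mult]
        continuous_on_flow continuous_on_id)
qed

lemma unstable_convolution_increment:
  fixes M :: "real ^ 'n ^ 'n"
  assumes f: "\<And>t. (\<lambda>s. flow M (t - s) *v f s) absolutely_integrable_on {t..}"
  defines "I \<equiv> \<lambda>t. - integral {t..} (\<lambda>s. flow M (t - s) *v f s)"
  shows "(\<lambda>r. flow M (- r) *v f r) absolutely_integrable_on {s..t}"
    and "s \<le> t \<Longrightarrow> flow M (- t) *v I t - flow M (- s) *v I s = integral {s..t} (\<lambda>r. flow M (- r) *v f r)"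
    and "continuous_on UNIV I"
proof -
  let ?k = "\<lambda>r. flow M (- r) *v f r"
  have k: "?k absolutely_integrable_on {t..}" for t
    using f[of t] by (simp add: flow_integral)
  have k': "?k absolutely_integrable_on {s..t}" for s t
    by (rule set_integrable_subset[OF k[of s]]) auto
  then show "?k absolutely_integrable_on {s..t}" .
  have I: "I t = flow M t *v (- integral {t..} ?k)" for t
    unfolding I_def flow_integral(2)[OF k]
    by (simp add: bounded_bilinear.minus_right[OF bounded_bilinear_matrix_vector_mult])
  have y: "flow M (- t) *v I t = - integral {t..} ?k" for t
    unfolding I by (rule flow_inverse)
  have inc: "- integral {t..} ?k - - integral {s..} ?k = integral {s..t} ?k" if "s \<le> t" for s t
    using integral_split_atLeast[OF _ _ that, of ?k] k[of t] k'[of s t]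
    by (simp add: set_lebesgue_integral_eq_integral(1))
  show "flow M (- t) *v I t - flow M (- s) *v I s = integral {s..t} ?k" if "s \<le> t"
    unfolding y using that by (rule inc)
  have "continuous_on UNIV (\<lambda>t. - integral {t..} ?k)"
    by (rule continuous_on_indefinite[OF _ inc]) (use k' in \<open>auto intro: set_lebesgue_integral_eq_integral(1)\<close>)
  then show "continuous_on UNIV I"
    unfolding I by (intro bounded_bilinear.continuous_on[OF bounded_bilinear_matrix_vector_mult]
        continuous_on_flow continuous_on_id)
qed

text \<open>
  The flow of \<open>A\<close> decays at rate \<open>a\<close>, the one of \<open>B\<close> expands into the past at rate at most \<open>b\<close>, and the
  weight exponent \<open>c\<close> lies strictly in between.
\<close>

locale spectral_gap =
  fixes A :: "real ^ 'n ^ 'n" and B :: "real ^ 'm ^ 'm" and a b c :: real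
  assumes decay: "\<And>s x. 0 \<le> s \<Longrightarrow> norm (flow A s *v x) \<le> exp (- a * s) * norm x"
    and growth: "\<And>s y. s \<le> 0 \<Longrightarrow> norm (flow B s *v y) \<le> exp (- b * s) * norm y"
    and gap: "0 < b" "b < c" "c < a"
begin

text \<open>
  The Lyapunov--Perron operator on the whole line,
  \<open>w\<^sub>1 t = \<integral>\<^bsub>(-\<infinity>,t]\<^esub> e\<^bsup>(t-s)A\<^esup> \<Phi> s (w s) ds\<close> and \<open>w\<^sub>2 t = h t - \<integral>\<^bsub>[t,\<infinity>)\<^esub> e\<^bsup>(t-s)B\<^esup> \<Psi> s (w s) ds\<close>.
  It contracts the distance \<open>sup\<^sub>t e\<^sup>c\<^sup>t |w\<^sub>1 t - w\<^sub>1' t| + sup\<^sub>t e\<^sup>c\<^sup>t |w\<^sub>2 t - w\<^sub>2' t|\<close>, and the fixed point is as close to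
  the reference curve \<open>(r\<^sub>1, r\<^sub>2)\<close> as the defect of the latter permits. The unknowns of the proof are the
  weighted differences \<open>e\<^sup>c\<^sup>t (w t - r t)\<close>, which are bounded continuous functions.
\<close>

theorem weighted_fixed_point:
  fixes \<Phi> :: "real \<Rightarrow> (real ^ 'n) \<times> (real ^ 'm) \<Rightarrow> real ^ 'n"
    and \<Psi> :: "real \<Rightarrow> (real ^ 'n) \<times> (real ^ 'm) \<Rightarrow> real ^ 'm"
    and r\<^sub>1 :: "real \<Rightarrow> real ^ 'n" and r\<^sub>2 h :: "real \<Rightarrow> real ^ 'm"
  assumes \<Phi>_lip: "\<And>s p q. norm (\<Phi> s p - \<Phi> s q) \<le> K\<^sub>1 * (norm (fst p - fst q) + norm (snd p - snd q))"
    and \<Psi>_lip: "\<And>s p q. norm (\<Psi> s p - \<Psi> s q) \<le> K\<^sub>2 * (norm (fst p - fst q) + norm (snd p - snd q))"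
    and \<Phi>_meas: "\<And>w. w \<in> borel_measurable borel \<Longrightarrow> (\<lambda>s. \<Phi> s (w s)) \<in> borel_measurable borel"
    and \<Psi>_meas: "\<And>w. w \<in> borel_measurable borel \<Longrightarrow> (\<lambda>s. \<Psi> s (w s)) \<in> borel_measurable borel"
    and K: "0 \<le> K\<^sub>1" "0 \<le> K\<^sub>2" and \<kappa>: "K\<^sub>1 / (a - c) + K\<^sub>2 / (c - b) < 1"
    and cont: "continuous_on UNIV r\<^sub>1" "continuous_on UNIV r\<^sub>2" "continuous_on UNIV h"
    and int\<^sub>1: "\<And>t. (\<lambda>s. flow A (t - s) *v \<Phi> s (r\<^sub>1 s, r\<^sub>2 s)) absolutely_integrable_on {..t}"
    and int\<^sub>2: "\<And>t. (\<lambda>s. flow B (t - s) *v \<Psi> s (r\<^sub>1 s, r\<^sub>2 s)) absolutely_integrable_on {t..}"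
    and defect\<^sub>1: "\<And>t. exp (c * t) *
      norm (integral {..t} (\<lambda>s. flow A (t - s) *v \<Phi> s (r\<^sub>1 s, r\<^sub>2 s)) - r\<^sub>1 t) \<le> D\<^sub>1"
    and defect\<^sub>2: "\<And>t. exp (c * t) *
      norm (h t - integral {t..} (\<lambda>s. flow B (t - s) *v \<Psi> s (r\<^sub>1 s, r\<^sub>2 s)) - r\<^sub>2 t) \<le> D\<^sub>2"
  obtains w\<^sub>1 w\<^sub>2 where "continuous_on UNIV w\<^sub>1" "continuous_on UNIV w\<^sub>2"
    and "\<And>t. (\<lambda>s. flow A (t - s) *v \<Phi> s (w\<^sub>1 s, w\<^sub>2 s)) absolutely_integrable_on {..t}"
    and "\<And>t. w\<^sub>1 t = integral {..t} (\<lambda>s. flow A (t - s) *v \<Phi> s (w\<^sub>1 s, w\<^sub>2 s))"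
    and "\<And>t. (\<lambda>s. flow B (t - s) *v \<Psi> s (w\<^sub>1 s, w\<^sub>2 s)) absolutely_integrable_on {t..}"
    and "\<And>t. w\<^sub>2 t = h t - integral {t..} (\<lambda>s. flow B (t - s) *v \<Psi> s (w\<^sub>1 s, w\<^sub>2 s))"
    and "\<And>t. exp (c * t) * (norm (w\<^sub>1 t - r\<^sub>1 t) + norm (w\<^sub>2 t - r\<^sub>2 t))
           \<le> (D\<^sub>1 + D\<^sub>2) / (1 - (K\<^sub>1 / (a - c) + K\<^sub>2 / (c - b)))"
proof -
  define \<kappa> where "\<kappa> = K\<^sub>1 / (a - c) + K\<^sub>2 / (c - b)"
  have \<kappa>01: "0 \<le> \<kappa>" "\<kappa> < 1" using K \<kappa> gap by (auto simp: \<kappa>_def)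
  define d where "d p q = dist (fst p) (fst q) + dist (snd p) (snd q)"
    for p q :: "(real \<Rightarrow>\<^sub>C (real ^ 'n)) \<times> (real \<Rightarrow>\<^sub>C (real ^ 'm))"
  define W where "W p s = (r\<^sub>1 s + exp (- c * s) *\<^sub>R apply_bcontfun (fst p) s, r\<^sub>2 s + exp (- c * s) *\<^sub>R apply_bcontfun (snd p) s)"
    for p :: "(real \<Rightarrow>\<^sub>C (real ^ 'n)) \<times> (real \<Rightarrow>\<^sub>C (real ^ 'm))" and s
  define k\<^sub>1 where "k\<^sub>1 p t s = flow A (t - s) *v \<Phi> s (W p s)" for p t s
  define k\<^sub>2 where "k\<^sub>2 p t s = flow B (t - s) *v \<Psi> s (W p s)" for p t s
  define I\<^sub>1 where "I\<^sub>1 p t = integral {..t} (k\<^sub>1 p t)" for p t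
  define I\<^sub>2 where "I\<^sub>2 p t = integral {t..} (k\<^sub>2 p t)" for p t
  have dnn: "0 \<le> d p q" for p q by (simp add: d_def)
  have W0: "W 0 s = (r\<^sub>1 s, r\<^sub>2 s)" for s by (simp add: W_def)
  have Wmeas: "W p \<in> borel_measurable borel" for p
    unfolding W_def
    by (intro borel_measurable_continuous_onI continuous_intros cont continuous_on_apply_bcontfun)
  have Wdiff: "norm (fst (W p s) - fst (W q s)) + norm (snd (W p s) - snd (W q s)) \<le> d p q * exp (- c * s)" for p q s
  proof -
    have "norm (fst (W p s) - fst (W q s)) = exp (- c * s) * dist (apply_bcontfun (fst p) s) (apply_bcontfun (fst q) s)"
      "norm (snd (W p s) - snd (W q s)) = exp (- c * s) * dist (apply_bcontfun (snd p) s) (apply_bcontfun (snd q) s)"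
      by (simp_all add: W_def dist_norm flip: scaleR_diff_right)
    then show ?thesis
      using dist_bounded[of "fst p" s "fst q"] dist_bounded[of "snd p" s "snd q"]
      by (simp add: d_def mult.commute[of "dist _ _ + _"] distrib_left[symmetric])
  qed
  have \<Phi>d: "norm (\<Phi> s (W p s) - \<Phi> s (W q s)) \<le> K\<^sub>1 * d p q * exp (- c * s)" for p q s
    using \<Phi>_lip[of s "W p s" "W q s"] mult_left_mono[OF Wdiff K(1), of p s q] by (simp add: mult.assoc)
  have \<Psi>d: "norm (\<Psi> s (W p s) - \<Psi> s (W q s)) \<le> K\<^sub>2 * d p q * exp (- c * s)" for p q s
    using \<Psi>_lip[of s "W p s" "W q s"] mult_left_mono[OF Wdiff K(2), of p s q] by (simp add: mult.assoc)
  note subr = bounded_bilinear.diff_right[OF bounded_bilinear_matrix_vector_mult]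
  have kd\<^sub>1: "(\<lambda>s. k\<^sub>1 p t s - k\<^sub>1 q t s) absolutely_integrable_on {..t}" for p q t
    unfolding k\<^sub>1_def subr[symmetric]
    by (rule stable_absolutely_integrable[OF decay gap(3) _ \<Phi>d]) (auto intro!: borel_measurable_diff \<Phi>_meas Wmeas)
  have kd\<^sub>2: "(\<lambda>s. k\<^sub>2 p t s - k\<^sub>2 q t s) absolutely_integrable_on {t..}" for p q t
    unfolding k\<^sub>2_def subr[symmetric]
    by (rule unstable_absolutely_integrable[OF growth _ gap(2) \<Psi>d]) (auto intro!: borel_measurable_diff \<Psi>_meas Wmeas)
  have k\<^sub>1: "k\<^sub>1 p t absolutely_integrable_on {..t}" for p t
    using set_integral_add(1)[OF kd\<^sub>1[of t p 0] int\<^sub>1[of t]] by (simp add: k\<^sub>1_def[abs_def] W0)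
  have k\<^sub>2: "k\<^sub>2 p t absolutely_integrable_on {t..}" for p t
    using set_integral_add(1)[OF kd\<^sub>2[of t p 0] int\<^sub>2[of t]] by (simp add: k\<^sub>2_def[abs_def] W0)
  note int = set_lebesgue_integral_eq_integral(1)
  have Id\<^sub>1: "exp (c * t) * norm (I\<^sub>1 p t - I\<^sub>1 q t) \<le> K\<^sub>1 / (a - c) * d p q" for p q t
  proof -
    have "norm (I\<^sub>1 p t - I\<^sub>1 q t) = norm (integral {..t} (\<lambda>s. flow A (t - s) *v (\<Phi> s (W p s) - \<Phi> s (W q s))))"
      unfolding I\<^sub>1_def integral_diff[OF int[OF k\<^sub>1] int[OF k\<^sub>1], symmetric] by (simp add: k\<^sub>1_def[abs_def] subr)
    also have "\<dots> \<le> K\<^sub>1 * d p q * exp (- c * t) / (a - c)"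
      using int[OF kd\<^sub>1[of t p q]] by (intro stable_integral_bound[OF decay gap(3) _ \<Phi>d]) (simp_all add: k\<^sub>1_def subr)
    finally have "exp (c * t) * norm (I\<^sub>1 p t - I\<^sub>1 q t) \<le> exp (c * t) * (K\<^sub>1 * d p q * exp (- c * t) / (a - c))"
      by (intro mult_left_mono) auto
    also have "\<dots> = (exp (c * t) * exp (- c * t)) * (K\<^sub>1 / (a - c) * d p q)" by simp
    also have "exp (c * t) * exp (- c * t) = 1" by (simp flip: exp_add)
    finally show ?thesis by simp
  qed
  have Id\<^sub>2: "exp (c * t) * norm (I\<^sub>2 p t - I\<^sub>2 q t) \<le> K\<^sub>2 / (c - b) * d p q" for p q t
  proof -
    have "norm (I\<^sub>2 p t - I\<^sub>2 q t) = norm (integral {t..} (\<lambda>s. flow B (t - s) *v (\<Psi> s (W p s) - \<Psi> s (W q s))))"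
      unfolding I\<^sub>2_def integral_diff[OF int[OF k\<^sub>2] int[OF k\<^sub>2], symmetric] by (simp add: k\<^sub>2_def[abs_def] subr)
    also have "\<dots> \<le> K\<^sub>2 * d p q * exp (- c * t) / (c - b)"
      using int[OF kd\<^sub>2[of t p q]] K dnn
      by (intro unstable_integral_bound[OF growth _ _ _ gap(2) _ \<Psi>d]) (simp_all add: k\<^sub>2_def subr)
    finally have "exp (c * t) * norm (I\<^sub>2 p t - I\<^sub>2 q t) \<le> exp (c * t) * (K\<^sub>2 * d p q * exp (- c * t) / (c - b))"
      by (intro mult_left_mono) auto
    also have "\<dots> = (exp (c * t) * exp (- c * t)) * (K\<^sub>2 / (c - b) * d p q)" by simp
    also have "exp (c * t) * exp (- c * t) = 1" by (simp flip: exp_add)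
    finally show ?thesis by simp
  qed
  define G\<^sub>1 where "G\<^sub>1 p t = exp (c * t) *\<^sub>R (I\<^sub>1 p t - r\<^sub>1 t)" for p t
  define G\<^sub>2 where "G\<^sub>2 p t = exp (c * t) *\<^sub>R (h t - I\<^sub>2 p t - r\<^sub>2 t)" for p t
  have G0: "norm (G\<^sub>1 0 t) \<le> D\<^sub>1" "norm (G\<^sub>2 0 t) \<le> D\<^sub>2" for t
    using defect\<^sub>1[of t] defect\<^sub>2[of t]
    by (simp_all add: G\<^sub>1_def G\<^sub>2_def I\<^sub>1_def I\<^sub>2_def k\<^sub>1_def[abs_def] k\<^sub>2_def[abs_def] W0)
  have Gd\<^sub>1: "norm (G\<^sub>1 p t - G\<^sub>1 q t) \<le> K\<^sub>1 / (a - c) * d p q" for p q t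
  proof -
    have "G\<^sub>1 p t - G\<^sub>1 q t = exp (c * t) *\<^sub>R (I\<^sub>1 p t - I\<^sub>1 q t)"
      by (simp add: G\<^sub>1_def flip: scaleR_diff_right)
    then show ?thesis using Id\<^sub>1[of t p q] by simp
  qed
  have Gd\<^sub>2: "norm (G\<^sub>2 p t - G\<^sub>2 q t) \<le> K\<^sub>2 / (c - b) * d p q" for p q t
  proof -
    have "G\<^sub>2 p t - G\<^sub>2 q t = exp (c * t) *\<^sub>R (I\<^sub>2 q t - I\<^sub>2 p t)"
      by (simp add: G\<^sub>2_def flip: scaleR_diff_right)
    then show ?thesis using Id\<^sub>2[of t p q] by (simp add: norm_minus_commute)
  qed
  have "continuous_on UNIV (I\<^sub>1 p)" for p
    using stable_convolution_increment(3)[of A "\<lambda>s. \<Phi> s (W p s)"] k\<^sub>1[where p = p]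
    by (simp add: I\<^sub>1_def k\<^sub>1_def[abs_def])
  then have cI\<^sub>1: "continuous_on UNIV (\<lambda>t. I\<^sub>1 p t)" for p by simp
  have "continuous_on UNIV (\<lambda>t. - I\<^sub>2 p t)" for p
    using unstable_convolution_increment(3)[of B "\<lambda>s. \<Psi> s (W p s)"] k\<^sub>2[where p = p]
    by (simp add: I\<^sub>2_def k\<^sub>2_def[abs_def])
  then have cI\<^sub>2: "continuous_on UNIV (\<lambda>t. I\<^sub>2 p t)" for p
    using continuous_on_minus[of UNIV "\<lambda>t. - I\<^sub>2 p t"] by simp
  have G\<^sub>1: "G\<^sub>1 p \<in> bcontfun" for p
  proof -
    have "norm (G\<^sub>1 p t) \<le> K\<^sub>1 / (a - c) * d p 0 + D\<^sub>1" for t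
      using Gd\<^sub>1[of p t 0] G0(1)[of t] norm_triangle_ineq[of "G\<^sub>1 p t - G\<^sub>1 0 t" "G\<^sub>1 0 t"] by simp
    moreover have "continuous_on UNIV (G\<^sub>1 p)"
      unfolding G\<^sub>1_def[abs_def] by (intro continuous_intros cI\<^sub>1 cont)
    ultimately show ?thesis by (auto simp: bcontfun_def bounded_iff)
  qed
  have G\<^sub>2: "G\<^sub>2 p \<in> bcontfun" for p
  proof -
    have "norm (G\<^sub>2 p t) \<le> K\<^sub>2 / (c - b) * d p 0 + D\<^sub>2" for t
      using Gd\<^sub>2[of p t 0] G0(2)[of t] norm_triangle_ineq[of "G\<^sub>2 p t - G\<^sub>2 0 t" "G\<^sub>2 0 t"] by simp
    moreover have "continuous_on UNIV (G\<^sub>2 p)"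
      unfolding G\<^sub>2_def[abs_def] by (intro continuous_intros cI\<^sub>2 cont)
    ultimately show ?thesis by (auto simp: bcontfun_def bounded_iff)
  qed
  define T where "T p = (Bcontfun (G\<^sub>1 p), Bcontfun (G\<^sub>2 p))" for p
  have T: "apply_bcontfun (fst (T p)) = G\<^sub>1 p" "apply_bcontfun (snd (T p)) = G\<^sub>2 p" for p
    by (simp_all add: T_def Bcontfun_inverse G\<^sub>1 G\<^sub>2)
  have contr: "d (T p) (T q) \<le> \<kappa> * d p q" for p q
  proof -
    have "dist (fst (T p)) (fst (T q)) \<le> K\<^sub>1 / (a - c) * d p q"
      by (rule dist_bound) (use Gd\<^sub>1 in \<open>simp add: T dist_norm\<close>)
    moreover have "dist (snd (T p)) (snd (T q)) \<le> K\<^sub>2 / (c - b) * d p q"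
      by (rule dist_bound) (use Gd\<^sub>2 in \<open>simp add: T dist_norm\<close>)
    ultimately show ?thesis unfolding \<kappa>_def distrib_right by (simp add: d_def)
  qed
  obtain p where p: "T p = p"
    using sum_contraction_has_fixed_point[OF \<kappa>01, of T] contr unfolding d_def by blast
  have dp: "d p 0 \<le> (D\<^sub>1 + D\<^sub>2) / (1 - \<kappa>)"
  proof -
    have "dist (fst (T 0)) 0 \<le> D\<^sub>1"
      by (rule dist_bound) (use G0 in \<open>simp add: T dist_norm\<close>)
    moreover have "dist (snd (T 0)) 0 \<le> D\<^sub>2"
      by (rule dist_bound) (use G0 in \<open>simp add: T dist_norm\<close>)
    ultimately have "d (T 0) 0 \<le> D\<^sub>1 + D\<^sub>2" by (simp add: d_def)
    moreover have "d p 0 \<le> d (T p) (T 0) + d (T 0) 0"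
      unfolding p d_def
      using dist_triangle[of "fst p" 0 "fst (T 0)"] dist_triangle[of "snd p" 0 "snd (T 0)"] by simp
    ultimately have "d p 0 * (1 - \<kappa>) \<le> D\<^sub>1 + D\<^sub>2"
      using contr[of p 0] by (simp add: algebra_simps)
    then show ?thesis using \<kappa>01 by (simp add: pos_le_divide_eq)
  qed
  have Wp: "W p s = (I\<^sub>1 p s, h s - I\<^sub>2 p s)" for s
  proof -
    have "apply_bcontfun (fst p) s = G\<^sub>1 p s" "apply_bcontfun (snd p) s = G\<^sub>2 p s"
      using T[of p] by (simp_all add: p)
    then show ?thesis by (simp add: W_def G\<^sub>1_def G\<^sub>2_def flip: exp_add)
  qed
  show thesis
  proof
    show "continuous_on UNIV (\<lambda>t. I\<^sub>1 p t)" "continuous_on UNIV (\<lambda>t. h t - I\<^sub>2 p t)"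
      by (intro continuous_intros cI\<^sub>1 cI\<^sub>2 cont)+
    show "(\<lambda>s. flow A (t - s) *v \<Phi> s (I\<^sub>1 p s, h s - I\<^sub>2 p s)) absolutely_integrable_on {..t}" for t
      using k\<^sub>1[of t p] by (simp add: k\<^sub>1_def[abs_def] Wp)
    show "I\<^sub>1 p t = integral {..t} (\<lambda>s. flow A (t - s) *v \<Phi> s (I\<^sub>1 p s, h s - I\<^sub>2 p s))" for t
      unfolding Wp[symmetric] I\<^sub>1_def[of p t] k\<^sub>1_def[abs_def] ..
    show "(\<lambda>s. flow B (t - s) *v \<Psi> s (I\<^sub>1 p s, h s - I\<^sub>2 p s)) absolutely_integrable_on {t..}" for t
      using k\<^sub>2[of t p] by (simp add: k\<^sub>2_def[abs_def] Wp)
    show "h t - I\<^sub>2 p t = h t - integral {t..} (\<lambda>s. flow B (t - s) *v \<Psi> s (I\<^sub>1 p s, h s - I\<^sub>2 p s))" for t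
      unfolding Wp[symmetric] I\<^sub>2_def[of p t] k\<^sub>2_def[abs_def] ..
    show "exp (c * t) * (norm (I\<^sub>1 p t - r\<^sub>1 t) + norm (h t - I\<^sub>2 p t - r\<^sub>2 t))
        \<le> (D\<^sub>1 + D\<^sub>2) / (1 - (K\<^sub>1 / (a - c) + K\<^sub>2 / (c - b)))" for t
    proof -
      have "exp (c * t) * (norm (I\<^sub>1 p t - r\<^sub>1 t) + norm (h t - I\<^sub>2 p t - r\<^sub>2 t)) \<le> exp (c * t) * (d p 0 * exp (- c * t))"
        using Wdiff[of p t 0] by (intro mult_left_mono) (simp_all add: Wp W0)
      also have "\<dots> = d p 0" by (simp add: exp_minus)
      also note dp
      finally show ?thesis by (simp add: \<kappa>_def)
    qed
  qed
qed

end

section \<open>Backward orbits and the slow manifold\<close>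

text \<open>
  Gronwall's inequality in the homogeneous case. The maximum of \<open>e\<^bsup>-2Ct\<^esup> |D t|\<close> is at most half of itself.
\<close>

lemma integral_equation_zero:
  fixes D g :: "real \<Rightarrow> 'a::euclidean_space"
  assumes T: "0 \<le> T" and g: "g integrable_on {0..T}"
    and D: "\<And>t. 0 \<le> t \<Longrightarrow> t \<le> T \<Longrightarrow> D t = integral {0..t} g"
    and C: "0 < C" "\<And>t. 0 \<le> t \<Longrightarrow> t \<le> T \<Longrightarrow> norm (g t) \<le> C * norm (D t)"
  shows "D T = 0"
proof -
  have cD: "continuous_on {0..T} D"
  proof (rule continuous_on_eq)
    show "continuous_on {0..T} (\<lambda>t. integral {0..t} g)"
      by (rule indefinite_integral_continuous_1[OF g])
  qed (simp add: D)
  define e where "e t = exp (- (2 * C) * t) * norm (D t)" for t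
  have "continuous_on {0..T} e"
    unfolding e_def by (intro continuous_intros cD)
  then obtain t where t: "0 \<le> t" "t \<le> T" and max: "\<And>s. 0 \<le> s \<Longrightarrow> s \<le> T \<Longrightarrow> e s \<le> e t"
    using continuous_attains_sup[of "{0..T}" e] T by auto
  have Ds: "norm (D s) = exp (2 * C * s) * e s" for s
    by (simp add: e_def mult.assoc[symmetric] flip: exp_add)
  let ?b = "\<lambda>s. C * e t * exp (2 * C * s)"
  have hi: "(?b has_integral C * e t * (exp (2 * C * t) / (2 * C))) {..t}"
    using C by (intro has_integral_mult_right has_integral_exp_from_minus_infinity) simp
  have bint: "?b integrable_on {0..t}"
    by (intro integrable_continuous_interval continuous_intros)
  have et: "0 \<le> e t" by (simp add: e_def)
  have "norm (D t) \<le> integral {0..t} ?b"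
    unfolding D[OF t]
  proof (rule integral_norm_bound_integral)
    show "g integrable_on {0..t}" using t by (intro integrable_on_subinterval[OF g]) auto
    fix s assume "s \<in> {0..t}"
    then have s: "0 \<le> s" "s \<le> T" using t by auto
    have "norm (g s) \<le> C * (exp (2 * C * s) * e s)" using C(2)[OF s] by (simp only: Ds)
    also have "\<dots> \<le> C * (exp (2 * C * s) * e t)" using max[OF s] C by (intro mult_left_mono) auto
    finally show "norm (g s) \<le> ?b s" by (simp add: mult_ac)
  qed (rule bint)
  also have "\<dots> \<le> integral {..t} ?b"
    using bint hi C et by (intro integral_subset_le) (auto simp: has_integral_integrable)
  also have "\<dots> = exp (2 * C * t) * (e t / 2)" unfolding integral_unique[OF hi] using C by simp
  finally have "e t \<le> e t / 2" unfolding Ds by simp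
  then have "e T \<le> 0" using max[of T] T by simp
  then show ?thesis by (simp add: e_def mult_le_0_iff)
qed

text \<open>
  The coupled system \<open>x' = A x + F (x, y)\<close>, \<open>y' = B y + G (x, y)\<close> with bounded Lipschitz coupling terms,
  under the smallness condition which makes the operator above a contraction.
\<close>

locale forced_spectral_gap = spectral_gap A B a b c
  for A :: "real ^ 'n ^ 'n" and B :: "real ^ 'm ^ 'm" and a b c :: real +
  fixes F :: "(real ^ 'n) \<times> (real ^ 'm) \<Rightarrow> real ^ 'n"
    and G :: "(real ^ 'n) \<times> (real ^ 'm) \<Rightarrow> real ^ 'm"
    and K\<^sub>1 K\<^sub>2 M\<^sub>1 M\<^sub>2 :: real
  assumes F_lip: "\<And>p q. norm (F p - F q) \<le> K\<^sub>1 * (norm (fst p - fst q) + norm (snd p - snd q))"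
    and G_lip: "\<And>p q. norm (G p - G q) \<le> K\<^sub>2 * (norm (fst p - fst q) + norm (snd p - snd q))"
    and F_bound: "\<And>p. norm (F p) \<le> M\<^sub>1"
    and G_bound: "\<And>p. norm (G p) \<le> M\<^sub>2"
    and K: "0 \<le> K\<^sub>1" "0 \<le> K\<^sub>2" and contraction: "K\<^sub>1 / (a - c) + K\<^sub>2 / (c - b) < 1"
begin

text \<open>
  \<open>w\<close> is the solution on \<open>(-\<infinity>, 0]\<close> of the system driven by \<open>N\<close>, that is, with coupling terms evaluated at
  \<open>w s + N s\<close>, whose fast component is bounded in the past and whose slow component starts from \<open>y\<close>.
  Only the values of \<open>w\<close> and \<open>N\<close> at times \<open>\<le> 0\<close> matter.
\<close>

definition backward_orbit ::
  "(real \<Rightarrow> (real ^ 'n) \<times> (real ^ 'm)) \<Rightarrow> real ^ 'm \<Rightarrow> (real \<Rightarrow> (real ^ 'n) \<times> (real ^ 'm)) \<Rightarrow> bool"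
  where "backward_orbit N y w \<longleftrightarrow> continuous_on {..0} w \<and>
    (\<forall>t\<le>0. (\<lambda>s. flow A (t - s) *v F (w s + N s)) absolutely_integrable_on {..t} \<and>
           fst (w t) = integral {..t} (\<lambda>s. flow A (t - s) *v F (w s + N s)) \<and>
           (\<lambda>s. flow B (t - s) *v G (w s + N s)) absolutely_integrable_on {t..0} \<and>
           snd (w t) = flow B t *v y - integral {t..0} (\<lambda>s. flow B (t - s) *v G (w s + N s)))"

lemma M_nonneg: "0 \<le> M\<^sub>1" "0 \<le> M\<^sub>2"
  using F_bound[of undefined] G_bound[of undefined] norm_ge_zero order_trans by blast+

lemma F_continuous: "continuous_on UNIV F"
proof -
  have "dist (F p) (F q) \<le> (2 * K\<^sub>1) * dist p q" for p q
    using F_lip[of p q] K dist_fst_le[of p q] dist_snd_le[of p q]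
      mult_left_mono[of "norm (fst p - fst q) + norm (snd p - snd q)" "2 * dist p q" K\<^sub>1]
    by (simp add: dist_norm)
  then have "(2 * K\<^sub>1)-lipschitz_on UNIV F"
    using K by (auto simp: lipschitz_on_def)
  then show ?thesis by (rule lipschitz_on_continuous_on)
qed

lemma G_continuous: "continuous_on UNIV G"
proof -
  have "dist (G p) (G q) \<le> (2 * K\<^sub>2) * dist p q" for p q
    using G_lip[of p q] K dist_fst_le[of p q] dist_snd_le[of p q]
      mult_left_mono[of "norm (fst p - fst q) + norm (snd p - snd q)" "2 * dist p q" K\<^sub>2]
    by (simp add: dist_norm)
  then have "(2 * K\<^sub>2)-lipschitz_on UNIV G"
    using K by (auto simp: lipschitz_on_def)
  then show ?thesis by (rule lipschitz_on_continuous_on)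
qed

lemmas F_measurable = borel_measurable_continuous_on[OF F_continuous]
lemmas G_measurable = borel_measurable_continuous_on[OF G_continuous]

lemma integral_F_bound:
  assumes "(\<lambda>s. flow A (t - s) *v f s) integrable_on {..t}" "\<And>s. norm (f s) \<le> M\<^sub>1"
  shows "norm (integral {..t} (\<lambda>s. flow A (t - s) *v f s)) \<le> M\<^sub>1 / a"
  using stable_integral_bound[where M = A and a = a and c = 0 and f = f and t = t and C = "M\<^sub>1"]
    decay gap assms by auto

lemma weighted_le:
  assumes "t \<le> 0"
  shows "exp (c * t) \<le> 1" "exp (c * t) * exp (- b * t) \<le> 1"
proof -
  show "exp (c * t) \<le> 1" using assms gap by (simp add: mult_nonneg_nonpos)
  have "(c - b) * t \<le> 0" using assms gap by (intro mult_nonneg_nonpos) auto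
  then show "exp (c * t) * exp (- b * t) \<le> 1" by (simp add: algebra_simps flip: exp_add)
qed

text \<open>
  A backward orbit lies a priori in the weighted space, so that the contraction estimate
  below applies to any two of them.
\<close>

lemma backward_orbit_growth:
  assumes w: "backward_orbit N y w" and t: "t \<le> 0"
  shows "exp (c * t) * norm (fst (w t)) \<le> M\<^sub>1 / a"
    and "exp (c * t) * norm (snd (w t)) \<le> norm y + M\<^sub>2 / b"
proof -
  let ?f = "\<lambda>s. flow A (t - s) *v F (w s + N s)" and ?g = "\<lambda>s. flow B (t - s) *v G (w s + N s)"
  have W: "?f integrable_on {..t}" "fst (w t) = integral {..t} ?f"
    "?g integrable_on {t..0}" "snd (w t) = flow B t *v y - integral {t..0} ?g"
    using w t unfolding backward_orbit_def by (auto intro: set_lebesgue_integral_eq_integral(1))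
  have "norm (fst (w t)) \<le> M\<^sub>1 / a"
    unfolding W(2) by (rule integral_F_bound[OF W(1) F_bound])
  then have "exp (c * t) * norm (fst (w t)) \<le> 1 * (M\<^sub>1 / a)"
    using weighted_le[OF t] by (intro mult_mono) auto
  then show "exp (c * t) * norm (fst (w t)) \<le> M\<^sub>1 / a" by simp
  have "norm (integral {t..0} ?g) \<le> M\<^sub>2 / b * exp (- b * t)"
    by (rule backward_integral_bound[OF growth W(3) gap(1) M_nonneg(2) G_bound])
  moreover have "norm (flow B t *v y) \<le> exp (- b * t) * norm y" using growth t by blast
  ultimately have "norm (snd (w t)) \<le> exp (- b * t) * norm y + M\<^sub>2 / b * exp (- b * t)"
    unfolding W(4) using norm_triangle_ineq4[of "flow B t *v y" "integral {t..0} ?g"] by linarith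
  then have "norm (snd (w t)) \<le> exp (- b * t) * (norm y + M\<^sub>2 / b)"
    by (simp add: algebra_simps)
  then have "exp (c * t) * norm (snd (w t)) \<le> exp (c * t) * (exp (- b * t) * (norm y + M\<^sub>2 / b))"
    by (intro mult_left_mono) auto
  also have "\<dots> \<le> 1 * (norm y + M\<^sub>2 / b)"
    unfolding mult.assoc[symmetric] using weighted_le[OF t] M_nonneg gap by (intro mult_right_mono) auto
  finally show "exp (c * t) * norm (snd (w t)) \<le> norm y + M\<^sub>2 / b" by simp
qed

lemma backward_orbit_dist:
  assumes w: "backward_orbit N y w" and w': "backward_orbit N y' w'" and t: "t \<le> 0"
  shows "exp (c * t) * (norm (fst (w t) - fst (w' t)) + norm (snd (w t) - snd (w' t)))
    \<le> norm (y - y') / (1 - (K\<^sub>1 / (a - c) + K\<^sub>2 / (c - b)))"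
proof -
  define e where "e t = exp (c * t) * (norm (fst (w t) - fst (w' t)) + norm (snd (w t) - snd (w' t)))" for t
  define d where "d = (SUP t\<in>{..0}. e t)"
  have "e t \<le> 2 * (M\<^sub>1 / a) + (norm y + M\<^sub>2 / b) + (norm y' + M\<^sub>2 / b)" if "t \<le> 0" for t
  proof -
    have "e t \<le> exp (c * t) * ((norm (fst (w t)) + norm (fst (w' t))) + (norm (snd (w t)) + norm (snd (w' t))))"
      unfolding e_def by (intro mult_left_mono add_mono norm_triangle_ineq4) auto
    then show ?thesis
      using backward_orbit_growth[OF w that] backward_orbit_growth[OF w' that] by (simp add: distrib_left)
  qed
  then have bdd: "bdd_above (e ` {..0})" by (auto intro!: bdd_aboveI2)
  have ed: "e t \<le> d" if "t \<le> 0" for t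
    unfolding d_def using that bdd by (intro cSUP_upper) auto
  have d0: "0 \<le> d" using ed[of 0] by (auto simp: e_def intro: order_trans[rotated])
  have wd: "norm (fst (w s + N s) - fst (w' s + N s)) + norm (snd (w s + N s) - snd (w' s + N s)) \<le> d * exp (- c * s)"
    if "s \<le> 0" for s
  proof -
    have "norm (fst (w s) - fst (w' s)) + norm (snd (w s) - snd (w' s)) = e s * exp (- c * s)"
      by (simp add: e_def mult.commute[of "exp (c * s)"] mult.assoc flip: exp_add)
    also have "\<dots> \<le> d * exp (- c * s)" using ed[OF that] by (rule mult_right_mono) simp
    finally show ?thesis by simp
  qed
  have Fd: "norm (F (w s + N s) - F (w' s + N s)) \<le> K\<^sub>1 * d * exp (- c * s)" if "s \<le> 0" for s
    using order_trans[OF F_lip mult_left_mono[OF wd[OF that] K(1)]] by (simp add: mult.assoc)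
  have Gd: "norm (G (w s + N s) - G (w' s + N s)) \<le> K\<^sub>2 * d * exp (- c * s)" if "s \<le> 0" for s
    using order_trans[OF G_lip mult_left_mono[OF wd[OF that] K(2)]] by (simp add: mult.assoc)
  note subr = bounded_bilinear.diff_right[OF bounded_bilinear_matrix_vector_mult]
  note int = set_lebesgue_integral_eq_integral(1)
  have main: "e t \<le> (K\<^sub>1 / (a - c) + K\<^sub>2 / (c - b)) * d + norm (y - y')" if t: "t \<le> 0" for t
  proof -
    let ?f = "\<lambda>w s. flow A (t - s) *v F (w s + N s)" and ?g = "\<lambda>w s. flow B (t - s) *v G (w s + N s)"
    have W: "?f w integrable_on {..t}" "fst (w t) = integral {..t} (?f w)"
      "?g w integrable_on {t..0}" "snd (w t) = flow B t *v y - integral {t..0} (?g w)"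
      using w t unfolding backward_orbit_def by (auto intro: int)
    have W': "?f w' integrable_on {..t}" "fst (w' t) = integral {..t} (?f w')"
      "?g w' integrable_on {t..0}" "snd (w' t) = flow B t *v y' - integral {t..0} (?g w')"
      using w' t unfolding backward_orbit_def by (auto intro: int)
    have "norm (fst (w t) - fst (w' t))
        = norm (integral {..t} (\<lambda>s. flow A (t - s) *v (F (w s + N s) - F (w' s + N s))))"
      unfolding W W' integral_diff[OF W(1) W'(1), symmetric] by (simp add: subr)
    also have "\<dots> \<le> K\<^sub>1 * d * exp (- c * t) / (a - c)"
      using integrable_diff[OF W(1) W'(1)] t
      by (intro stable_integral_bound[OF decay gap(3) _ Fd]) (simp_all add: subr)
    finally have 1: "norm (fst (w t) - fst (w' t)) \<le> exp (- c * t) * (K\<^sub>1 / (a - c) * d)"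
      by (simp add: mult_ac)
    have eq: "snd (w t) - snd (w' t) = flow B t *v (y - y')
        - integral {t..0} (\<lambda>s. flow B (t - s) *v (G (w s + N s) - G (w' s + N s)))"
      unfolding W W' subr integral_diff[OF W(3) W'(3)] by simp
    have "norm (integral {t..0} (\<lambda>s. flow B (t - s) *v (G (w s + N s) - G (w' s + N s))))
        \<le> K\<^sub>2 * d * exp (- c * t) / (c - b)"
      using integrable_diff[OF W(3) W'(3)] d0 K
      by (intro unstable_integral_bound[OF growth _ _ _ gap(2) _ Gd]) (auto simp: subr)
    moreover have "norm (flow B t *v (y - y')) \<le> exp (- b * t) * norm (y - y')"
      using growth t by blast
    ultimately have 2: "norm (snd (w t) - snd (w' t))
        \<le> exp (- b * t) * norm (y - y') + exp (- c * t) * (K\<^sub>2 / (c - b) * d)"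
      unfolding eq by (intro order_trans[OF norm_triangle_ineq4] add_mono) (auto simp: mult_ac)
    have "e t \<le> exp (c * t) * (exp (- c * t) * (K\<^sub>1 / (a - c) * d)
        + (exp (- b * t) * norm (y - y') + exp (- c * t) * (K\<^sub>2 / (c - b) * d)))"
      unfolding e_def using 1 2 by (intro mult_left_mono add_mono) auto
    also have "\<dots> = (exp (c * t) * exp (- c * t)) * (K\<^sub>1 / (a - c) + K\<^sub>2 / (c - b)) * d
        + (exp (c * t) * exp (- b * t)) * norm (y - y')"
      by (simp only: distrib_left distrib_right mult_ac)
    also have "exp (c * t) * exp (- c * t) = 1" by (simp flip: exp_add)
    also have "(exp (c * t) * exp (- b * t)) * norm (y - y') \<le> 1 * norm (y - y')"
      using weighted_le[OF t] by (intro mult_right_mono) auto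
    finally show ?thesis by simp
  qed
  have "d \<le> (K\<^sub>1 / (a - c) + K\<^sub>2 / (c - b)) * d + norm (y - y')"
    unfolding d_def by (rule cSUP_least) (use main in \<open>auto simp: d_def\<close>)
  then have "d * (1 - (K\<^sub>1 / (a - c) + K\<^sub>2 / (c - b))) \<le> norm (y - y')"
    by (simp add: algebra_simps)
  then have "d \<le> norm (y - y') / (1 - (K\<^sub>1 / (a - c) + K\<^sub>2 / (c - b)))"
    using contraction by (simp add: pos_le_divide_eq)
  then show ?thesis using ed[OF t] by (simp add: e_def)
qed

lemma backward_orbit_unique:
  assumes "backward_orbit N y w" "backward_orbit N y w'" "t \<le> 0"
  shows "w t = w' t"
proof -
  have "exp (c * t) * (norm (fst (w t) - fst (w' t)) + norm (snd (w t) - snd (w' t))) \<le> 0"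
    using backward_orbit_dist[OF assms] by simp
  then have "norm (fst (w t) - fst (w' t)) + norm (snd (w t) - snd (w' t)) \<le> 0"
    by (simp add: mult_le_0_iff)
  then have "norm (fst (w t) - fst (w' t)) = 0" "norm (snd (w t) - snd (w' t)) = 0"
    using norm_ge_zero[of "fst (w t) - fst (w' t)"] norm_ge_zero[of "snd (w t) - snd (w' t)"] by linarith+
  then show ?thesis by (simp add: prod_eq_iff)
qed

lemma backward_orbit_exists:
  assumes N: "N \<in> borel_measurable borel"
  shows "\<exists>w. backward_orbit N y w"
proof -
  \<comment> \<open>The whole-line fixed point theorem applies after switching off the coupling at positive times.\<close>
  define \<Phi> where "\<Phi> s p = (if s \<le> 0 then F (p + N s) else 0)" for s p
  define \<Psi> where "\<Psi> s p = (if s \<le> 0 then G (p + N s) else 0)" for s p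
  define h where "h t = flow B (min t 0) *v y" for t
  have meas: "(\<lambda>s. \<Phi> s (w s)) \<in> borel_measurable borel" "(\<lambda>s. \<Psi> s (w s)) \<in> borel_measurable borel"
    if "w \<in> borel_measurable borel" for w
    unfolding \<Phi>_def \<Psi>_def using that N by (auto intro!: measurable_If F_measurable G_measurable)
  have h: "continuous_on UNIV h"
    unfolding h_def by (intro bounded_bilinear.continuous_on[OF bounded_bilinear_matrix_vector_mult]
        continuous_on_flow continuous_intros)
  have hm: "(\<lambda>s. (0, h s)) \<in> borel_measurable borel"
    by (intro borel_measurable_continuous_onI continuous_intros h)
  have one: "1 \<le> exp (- c * s)" if "s \<le> 0" for s
    using that gap by (simp add: mult_nonneg_nonpos)
  have \<Phi>b: "norm (\<Phi> s p) \<le> M\<^sub>1 * exp (- c * s)" for s p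
    using F_bound[of "p + N s"] M_nonneg mult_left_mono[OF one M_nonneg(1), of s] by (auto simp: \<Phi>_def)
  have \<Psi>b: "norm (\<Psi> s p) \<le> M\<^sub>2 * exp (- c * s)" for s p
    using G_bound[of "p + N s"] M_nonneg mult_left_mono[OF one M_nonneg(2), of s] by (auto simp: \<Psi>_def)
  have ee: "exp (c * t) * (C * exp (- c * t) / x) = C / x" for t C x :: real
  proof -
    have "exp (c * t) * (C * exp (- c * t) / x) = (exp (c * t) * exp (- c * t)) * (C / x)" by simp
    also have "exp (c * t) * exp (- c * t) = 1" by (simp flip: exp_add)
    finally show ?thesis by simp
  qed
  have i1: "(\<lambda>s. flow A (t - s) *v \<Phi> s (0, h s)) absolutely_integrable_on {..t}" for t
    by (rule stable_absolutely_integrable[OF decay gap(3) meas(1)[OF hm] \<Phi>b]) auto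
  have i2: "(\<lambda>s. flow B (t - s) *v \<Psi> s (0, h s)) absolutely_integrable_on {t..}" for t
    by (rule unstable_absolutely_integrable[OF growth meas(2)[OF hm] gap(2) \<Psi>b]) auto
  note int = set_lebesgue_integral_eq_integral(1)
  obtain w\<^sub>1 w\<^sub>2 where w: "continuous_on UNIV w\<^sub>1" "continuous_on UNIV w\<^sub>2"
    "\<And>t. (\<lambda>s. flow A (t - s) *v \<Phi> s (w\<^sub>1 s, w\<^sub>2 s)) absolutely_integrable_on {..t}"
    "\<And>t. w\<^sub>1 t = integral {..t} (\<lambda>s. flow A (t - s) *v \<Phi> s (w\<^sub>1 s, w\<^sub>2 s))"
    "\<And>t. (\<lambda>s. flow B (t - s) *v \<Psi> s (w\<^sub>1 s, w\<^sub>2 s)) absolutely_integrable_on {t..}"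
    "\<And>t. w\<^sub>2 t = h t - integral {t..} (\<lambda>s. flow B (t - s) *v \<Psi> s (w\<^sub>1 s, w\<^sub>2 s))"
  proof (rule weighted_fixed_point[of \<Phi> K\<^sub>1 \<Psi> K\<^sub>2 "\<lambda>_. 0" h h "M\<^sub>1 / (a - c)" "M\<^sub>2 / (c - b)"])
    show "norm (\<Phi> s p - \<Phi> s q) \<le> K\<^sub>1 * (norm (fst p - fst q) + norm (snd p - snd q))" for s p q
      using F_lip[of "p + N s" "q + N s"] K by (simp add: \<Phi>_def)
    show "norm (\<Psi> s p - \<Psi> s q) \<le> K\<^sub>2 * (norm (fst p - fst q) + norm (snd p - snd q))" for s p q
      using G_lip[of "p + N s" "q + N s"] K by (simp add: \<Psi>_def)
    show "exp (c * t) * norm (integral {..t} (\<lambda>s. flow A (t - s) *v \<Phi> s (0, h s)) - 0) \<le> M\<^sub>1 / (a - c)" for t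
      using order_trans[OF mult_left_mono[OF stable_integral_bound[OF decay gap(3) int[OF i1] \<Phi>b, of t], of "exp (c * t)"]
          eq_refl[OF ee]] by simp
    show "exp (c * t) * norm (h t - integral {t..} (\<lambda>s. flow B (t - s) *v \<Psi> s (0, h s)) - h t) \<le> M\<^sub>2 / (c - b)" for t
      using order_trans[OF mult_left_mono[OF unstable_integral_bound[OF growth int[OF i2] _ _ gap(2) M_nonneg(2) \<Psi>b, of t], of "exp (c * t)"]
          eq_refl[OF ee]] by simp
  qed (assumption | rule that meas K contraction h i1 i2 continuous_on_const)+
  have "backward_orbit N y (\<lambda>t. (w\<^sub>1 t, w\<^sub>2 t))"
    unfolding backward_orbit_def
  proof (intro conjI allI impI)
    show "continuous_on {..0} (\<lambda>t. (w\<^sub>1 t, w\<^sub>2 t))"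
      using w(1,2) by (auto intro!: continuous_on_Pair intro: continuous_on_subset)
    fix t :: real assume t: "t \<le> 0"
    have eq1: "flow A (t - s) *v F ((w\<^sub>1 s, w\<^sub>2 s) + N s) = flow A (t - s) *v \<Phi> s (w\<^sub>1 s, w\<^sub>2 s)" if "s \<in> {..t}" for s
      using that t by (simp add: \<Phi>_def)
    have eq2: "flow B (t - s) *v G ((w\<^sub>1 s, w\<^sub>2 s) + N s) = flow B (t - s) *v \<Psi> s (w\<^sub>1 s, w\<^sub>2 s)" if "s \<in> {t..0}" for s
      using that t by (simp add: \<Psi>_def)
    show "(\<lambda>s. flow A (t - s) *v F ((w\<^sub>1 s, w\<^sub>2 s) + N s)) absolutely_integrable_on {..t}"
      by (rule iffD2[OF set_integrable_cong[OF refl refl eq1] w(3)])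
    show "fst (w\<^sub>1 t, w\<^sub>2 t) = integral {..t} (\<lambda>s. flow A (t - s) *v F ((w\<^sub>1 s, w\<^sub>2 s) + N s))"
    proof -
      have "integral {..t} (\<lambda>s. flow A (t - s) *v F ((w\<^sub>1 s, w\<^sub>2 s) + N s))
        = integral {..t} (\<lambda>s. flow A (t - s) *v \<Phi> s (w\<^sub>1 s, w\<^sub>2 s))"
        by (rule integral_cong) (rule eq1)
      then show ?thesis using w(4)[of t] by simp
    qed
    have i: "(\<lambda>s. flow B (t - s) *v \<Psi> s (w\<^sub>1 s, w\<^sub>2 s)) absolutely_integrable_on {t..0}"
      by (rule set_integrable_subset[OF w(5)[of t]]) auto
    show "(\<lambda>s. flow B (t - s) *v G ((w\<^sub>1 s, w\<^sub>2 s) + N s)) absolutely_integrable_on {t..0}"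
      by (rule iffD2[OF set_integrable_cong[OF refl refl eq2] i])
    have "integral {t..} (\<lambda>s. flow B (t - s) *v \<Psi> s (w\<^sub>1 s, w\<^sub>2 s))
      = integral {t..} (\<lambda>s. if s \<in> {..0} then flow B (t - s) *v G ((w\<^sub>1 s, w\<^sub>2 s) + N s) else 0)"
      by (rule integral_cong) (simp add: \<Psi>_def)
    also have "\<dots> = integral ({..0} \<inter> {t..}) (\<lambda>s. flow B (t - s) *v G ((w\<^sub>1 s, w\<^sub>2 s) + N s))"
      by (rule Henstock_Kurzweil_Integration.integral_restrict_Int)
    also have "{..0} \<inter> {t..} = {t..0}" by auto
    finally show "snd (w\<^sub>1 t, w\<^sub>2 t) = flow B t *v y - integral {t..0} (\<lambda>s. flow B (t - s) *v G ((w\<^sub>1 s, w\<^sub>2 s) + N s))"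
      using w(6)[of t] t by (simp add: h_def)
  qed
  then show ?thesis by blast
qed

end

section \<open>The orbit on the manifold tracking a given solution\<close>

context forced_spectral_gap
begin

lemma bounded_borel_absolutely_integrable:
  fixes f :: "real \<Rightarrow> 'a::euclidean_space"
  assumes "f \<in> borel_measurable borel" "\<And>s. norm (f s) \<le> M"
  shows "f absolutely_integrable_on {s..t}"
  by (rule absolutely_integrable_onI[where g = "\<lambda>_. M"]) (use assms in auto)

text \<open>
  Here \<open>q\<close> solves the driven system on \<open>[0, \<infinity>)\<close> and is constant on \<open>(-\<infinity>, 0]\<close>. There is a complete orbit \<open>w\<close>
  whose past, seen from any time \<open>\<tau>\<close>, is the backward orbit of the driving path shifted by \<open>\<tau>\<close>, and which
  approaches \<open>q\<close> at rate \<open>c\<close>. Backward orbits grow at most like \<open>e\<^bsup>-ct\<^esup>\<close> as \<open>t \<rightarrow> -\<infinity>\<close>, so that lying on the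
  manifold and attracting \<open>q\<close> are a single condition, a weighted bound on \<open>w - q\<close> over the whole line.
\<close>

theorem tracking_orbit:
  assumes N: "\<And>t. (N \<longlongrightarrow> N t) (at_right t)"
    and q: "continuous_on UNIV q" and q0: "\<And>t. t \<le> 0 \<Longrightarrow> q t = q 0"
    and qA: "\<And>t. 0 \<le> t \<Longrightarrow> fst (q t) - fst (q 0) = integral {0..t} (\<lambda>r. A *v fst (q r) + F (q r + N r))"
    and qB: "\<And>t. 0 \<le> t \<Longrightarrow> snd (q t) - snd (q 0) = integral {0..t} (\<lambda>r. B *v snd (q r) + G (q r + N r))"
  obtains w where "continuous_on UNIV w"
    and "\<And>\<tau>. backward_orbit (\<lambda>s. N (s + \<tau>)) (snd (w \<tau>)) (\<lambda>t. w (t + \<tau>))"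
    and "\<And>s t. s \<le> t \<Longrightarrow> (\<lambda>r. B *v snd (w r) + G (w r + N r)) absolutely_integrable_on {s..t}"
    and "\<And>s t. s \<le> t \<Longrightarrow> snd (w t) - snd (w s) = integral {s..t} (\<lambda>r. B *v snd (w r) + G (w r + N r))"
    and "\<And>t. exp (c * t) * (norm (fst (w t) - fst (q t)) + norm (snd (w t) - snd (q t)))
      \<le> ((M\<^sub>1 / a + norm (fst (q 0))) + (2 * norm (snd (q 0)) + M\<^sub>2 / b)) / (1 - (K\<^sub>1 / (a - c) + K\<^sub>2 / (c - b)))"
proof -
  note int = set_lebesgue_integral_eq_integral(1)
  have Nm: "N \<in> borel_measurable borel"
    by (rule right_continuous_imp_borel_measurable[OF N])
  have meas: "(\<lambda>s. F (w s + N s)) \<in> borel_measurable borel" "(\<lambda>s. G (w s + N s)) \<in> borel_measurable borel"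
    if "w \<in> borel_measurable borel" for w
    using that Nm by (auto intro!: F_measurable G_measurable)
  have rc: "((\<lambda>r. F (w r + N r)) \<longlongrightarrow> F (w t + N t)) (at_right t)"
    "((\<lambda>r. G (w r + N r)) \<longlongrightarrow> G (w t + N t)) (at_right t)"
    if w: "continuous_on UNIV w" for w t
  proof -
    have "(w \<longlongrightarrow> w t) (at_right t)"
      using w by (metis continuous_on_def UNIV_I tendsto_within_subset subset_UNIV)
    then have "((\<lambda>r. w r + N r) \<longlongrightarrow> w t + N t) (at_right t)"
      by (rule tendsto_add[OF _ N])
    then show "((\<lambda>r. F (w r + N r)) \<longlongrightarrow> F (w t + N t)) (at_right t)"
      "((\<lambda>r. G (w r + N r)) \<longlongrightarrow> G (w t + N t)) (at_right t)"
      by (auto intro: continuous_on_tendsto_compose[OF F_continuous] continuous_on_tendsto_compose[OF G_continuous])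
  qed
  have qm: "q \<in> borel_measurable borel" by (rule borel_measurable_continuous_onI[OF q])
  \<comment> \<open>For \<open>t \<ge> 0\<close> the unknown in the slow component is its difference from \<open>q\<close>, so the coupling along \<open>q\<close>
    is subtracted from \<open>\<Psi>\<close> and reappears in \<open>h\<close>. As integrals over empty intervals vanish, \<open>h\<close> is the
    linear evolution \<open>e\<^sup>t\<^sup>B q\<^sub>2(0)\<close> for \<open>t \<le> 0\<close>.\<close>
  define \<Psi> where "\<Psi> s p = G (p + N s) - (if 0 \<le> s then G (q s + N s) else 0)" for s p
  define k where "k r = flow B (- r) *v G (q r + N r)" for r
  define k\<^sub>0 where "k\<^sub>0 r = (if r \<in> {0..} then k r else 0)" for r
  define h where "h t = flow B t *v (snd (q 0) + integral {0..t} k)" for t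
  have kint: "k absolutely_integrable_on {s..t}" for s t
    unfolding k_def[abs_def]
    by (intro flow_absolutely_integrable bounded_borel_absolutely_integrable[OF meas(2)[OF qm] G_bound])
  have k\<^sub>0int: "k\<^sub>0 absolutely_integrable_on {s..t}" for s t
  proof -
    have "(\<lambda>r. if 0 \<le> r then G (q r + N r) else 0) \<in> borel_measurable borel"
      using meas(2)[OF qm] by (intro measurable_If) auto
    then have "(\<lambda>r. if 0 \<le> r then G (q r + N r) else 0) absolutely_integrable_on {s..t}"
      by (rule bounded_borel_absolutely_integrable[where M = M\<^sub>2]) (use G_bound M_nonneg in \<open>simp del: split_paired_All\<close>)
    from flow_absolutely_integrable[OF this, of B] show ?thesis
      unfolding k\<^sub>0_def[abs_def] k_def
      by (rule iffD2[OF set_integrable_cong[OF refl refl], rotated]) auto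
  qed
  have kinc: "integral {0..t} k - integral {0..s} k = integral {s..t} k\<^sub>0" if "s \<le> t" for s t
  proof (cases "0 \<le> s")
    case True
    have "integral {s..t} k\<^sub>0 = integral {s..t} k"
      using True by (intro integral_cong) (simp add: k\<^sub>0_def)
    moreover have "integral {0..s} k + integral {s..t} k = integral {0..t} k"
      by (rule Henstock_Kurzweil_Integration.integral_combine[OF True that int[OF kint]])
    ultimately show ?thesis by (metis add_diff_cancel_left')
  next
    case False
    have "integral {s..t} k\<^sub>0 = integral ({0..} \<inter> {s..t}) k"
      unfolding k\<^sub>0_def[abs_def] by (rule Henstock_Kurzweil_Integration.integral_restrict_Int)
    also have "{0..} \<inter> {s..t} = {0..t}" using False by auto
    finally show ?thesis using False by simp
  qed
  have hinc: "flow B (- t) *v h t - flow B (- s) *v h s = integral {s..t} k\<^sub>0" if "s \<le> t" for s t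
    using kinc[OF that] by (simp add: h_def flow_inverse)
  have "continuous_on UNIV (\<lambda>t. integral {0..t} k)"
    by (rule continuous_on_indefinite[OF int[OF k\<^sub>0int] kinc])
  then have h: "continuous_on UNIV h"
    unfolding h_def by (intro bounded_bilinear.continuous_on[OF bounded_bilinear_matrix_vector_mult]
        continuous_on_flow continuous_on_add continuous_on_const continuous_on_id)
  have hq: "h t = snd (q t)" if "0 \<le> t" for t
  proof -
    have "flow B (- t) *v snd (q t) - flow B (- 0) *v snd (q 0) = integral {0..t} k"
      unfolding k_def[abs_def]
    proof (rule variation_of_constants[OF that])
      show i: "(\<lambda>r. G (q r + N r)) absolutely_integrable_on {0..t}"
        by (rule bounded_borel_absolutely_integrable[OF meas(2)[OF qm] G_bound])
      have "(\<lambda>r. B *v snd (q r)) integrable_on {0..t}"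
        by (intro integrable_continuous_interval bounded_linear.continuous_on[OF matrix_vector_mul_bounded_linear]
            continuous_on_snd continuous_on_subset[OF q]) auto
      then show "(\<lambda>r. B *v snd (q r) + G (q r + N r)) integrable_on {0..t}"
        by (rule integrable_add[OF _ int[OF i]])
    qed (use rc[OF q] qB in auto)
    then have "snd (q 0) + integral {0..t} k = flow B (- t) *v snd (q t)" by (simp add: algebra_simps)
    then show ?thesis by (simp only: h_def flow_inverse)
  qed
  have hneg: "h t = flow B t *v snd (q 0)" if "t \<le> 0" for t
  proof -
    have "integral {0..t} k = 0" using that by (cases "t = 0") auto
    then show ?thesis by (simp add: h_def)
  qed
  let ?f = "\<lambda>r. flow A (- r) *v F (q r + N r)"
  have \<Psi>m: "(\<lambda>s. \<Psi> s (w s)) \<in> borel_measurable borel" if "w \<in> borel_measurable borel" for w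
    unfolding \<Psi>_def using meas(2)[OF that] meas(2)[OF qm]
    by (intro borel_measurable_diff measurable_If) auto
  have one: "1 \<le> exp (- c * s)" if "s \<le> 0" for s
    using that gap by (simp add: mult_nonneg_nonpos)
  have \<Psi>q: "norm (\<Psi> s (q s)) \<le> M\<^sub>2 * exp (- c * s)" for s
    using G_bound[of "q s + N s"] M_nonneg mult_left_mono[OF one M_nonneg(2), of s] by (auto simp: \<Psi>_def)
  have i1: "(\<lambda>s. flow A (t - s) *v F (q s + N s)) absolutely_integrable_on {..t}" for t
    by (rule stable_absolutely_integrable[where c = 0 and C = M\<^sub>1 and a = a]) (use decay gap meas(1)[OF qm] F_bound in auto)
  have i2: "(\<lambda>s. flow B (t - s) *v \<Psi> s (q s)) absolutely_integrable_on {t..}" for t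
    by (rule unstable_absolutely_integrable[OF growth \<Psi>m[OF qm] gap(2) \<Psi>q]) auto
  have Ib: "norm (integral {..t} (\<lambda>s. flow A (t - s) *v F (q s + N s))) \<le> M\<^sub>1 / a" for t
    by (rule integral_F_bound[OF int[OF i1] F_bound])
  \<comment> \<open>The defect of \<open>q\<close>: in the fast component only the mismatch at time 0 and the past contribute.\<close>
  have defect1: "exp (c * t) * norm (integral {..t} (\<lambda>s. flow A (t - s) *v F (q s + N s)) - fst (q t))
      \<le> M\<^sub>1 / a + norm (fst (q 0))" for t
  proof (cases "0 \<le> t")
    case True
    have inc: "flow A (- t) *v fst (q t) - flow A (- 0) *v fst (q 0) = integral {0..t} ?f"
    proof (rule variation_of_constants[OF True])
      show i: "(\<lambda>r. F (q r + N r)) absolutely_integrable_on {0..t}"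
        by (rule bounded_borel_absolutely_integrable[OF meas(1)[OF qm] F_bound])
      have "(\<lambda>r. A *v fst (q r)) integrable_on {0..t}"
        by (intro integrable_continuous_interval bounded_linear.continuous_on[OF matrix_vector_mul_bounded_linear]
            continuous_on_fst continuous_on_subset[OF q]) auto
      then show "(\<lambda>r. A *v fst (q r) + F (q r + N r)) integrable_on {0..t}"
        by (rule integrable_add[OF _ int[OF i]])
    qed (use rc[OF q] qA in auto)
    let ?I = "\<lambda>t. integral {..t} (\<lambda>s. flow A (t - s) *v F (q s + N s))"
    have cancel: "P - P' = R - R' \<Longrightarrow> P - R = P' - R'" for P P' R R' :: "real ^ 'n"
      by (simp add: algebra_simps)
    have "flow A (- t) *v ?I t - flow A (- 0) *v ?I 0 = flow A (- t) *v fst (q t) - flow A (- 0) *v fst (q 0)"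
      unfolding inc by (rule stable_convolution_increment(2)[OF i1 True])
    then have "flow A (- t) *v (?I t - fst (q t)) = flow A (- 0) *v (?I 0 - fst (q 0))"
      unfolding bounded_bilinear.diff_right[OF bounded_bilinear_matrix_vector_mult] by (rule cancel)
    from arg_cong[OF this, of "(*v) (flow A t)"]
    have eq: "?I t - fst (q t) = flow A t *v (?I 0 - fst (q 0))"
      by (simp only: flow_inverse(1) minus_zero flow_0 matrix_vector_mul_lid)
    have "norm (?I t - fst (q t)) \<le> exp (- a * t) * norm (?I 0 - fst (q 0))"
      unfolding eq by (rule decay[OF True])
    also have "\<dots> \<le> exp (- a * t) * (M\<^sub>1 / a + norm (fst (q 0)))"
      using Ib[of 0] norm_triangle_ineq4[of "?I 0" "fst (q 0)"]
      by (intro mult_left_mono[OF _ exp_ge_zero]) linarith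
    finally have "exp (c * t) * norm (?I t - fst (q t)) \<le> exp (c * t) * (exp (- a * t) * (M\<^sub>1 / a + norm (fst (q 0))))"
      by (intro mult_left_mono) auto
    also have "\<dots> = exp ((c - a) * t) * (M\<^sub>1 / a + norm (fst (q 0)))"
      by (simp add: algebra_simps mult.assoc[symmetric] flip: exp_add)
    also have "\<dots> \<le> 1 * (M\<^sub>1 / a + norm (fst (q 0)))"
      using True gap M_nonneg by (intro mult_right_mono) (auto simp: mult_nonpos_nonneg intro!: add_nonneg_nonneg)
    finally show ?thesis by simp
  next
    case False
    then have t: "t \<le> 0" by simp
    let ?I = "integral {..t} (\<lambda>s. flow A (t - s) *v F (q s + N s))"
    have "norm (?I - fst (q t)) \<le> M\<^sub>1 / a + norm (fst (q 0))"
      using Ib[of t] norm_triangle_ineq4[of ?I "fst (q 0)"] q0[OF t] by simp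
    then have "exp (c * t) * norm (?I - fst (q t)) \<le> 1 * (M\<^sub>1 / a + norm (fst (q 0)))"
      using weighted_le[OF t] by (intro mult_mono) auto
    then show ?thesis by simp
  qed
  \<comment> \<open>In the slow component the defect vanishes at times \<open>t \<ge> 0\<close>.\<close>
  have defect2: "exp (c * t) * norm (h t - integral {t..} (\<lambda>s. flow B (t - s) *v \<Psi> s (q s)) - snd (q t))
      \<le> 2 * norm (snd (q 0)) + M\<^sub>2 / b" for t
  proof (cases "0 \<le> t")
    case True
    have "integral {t..} (\<lambda>s. flow B (t - s) *v \<Psi> s (q s)) = integral {t..} (\<lambda>s. 0)"
      using True by (intro integral_cong) (simp add: \<Psi>_def)
    then show ?thesis using hq[OF True] M_nonneg gap by simp
  next
    case False
    then have t: "t \<le> 0" by simp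
    let ?g = "\<lambda>s. flow B (t - s) *v \<Psi> s (q s)"
    have "integral {t..} ?g = integral {t..} (\<lambda>s. if s \<in> {..0} then ?g s else 0)"
      by (rule integral_cong) (auto simp: \<Psi>_def)
    also have "\<dots> = integral ({..0} \<inter> {t..}) ?g"
      by (rule Henstock_Kurzweil_Integration.integral_restrict_Int)
    also have "{..0} \<inter> {t..} = {t..0}" by auto
    finally have eq: "integral {t..} ?g = integral {t..0} ?g" .
    have gi: "?g absolutely_integrable_on {t..0}"
      by (rule set_integrable_subset[OF i2[of t]]) auto
    have \<Psi>M: "norm (\<Psi> s (q s)) \<le> M\<^sub>2" for s
      using G_bound[of "q s + N s"] M_nonneg by (simp add: \<Psi>_def)
    have gb: "norm (integral {t..0} ?g) \<le> M\<^sub>2 / b * exp (- b * t)"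
      by (rule backward_integral_bound[OF growth int[OF gi] gap(1) M_nonneg(2) \<Psi>M])
    have hb: "norm (h t) \<le> exp (- b * t) * norm (snd (q 0))"
      unfolding hneg[OF t] by (rule growth[OF t])
    have "norm (h t - integral {t..} ?g - snd (q t)) \<le> norm (h t) + norm (integral {t..0} ?g) + norm (snd (q 0))"
      unfolding eq q0[OF t]
      using norm_triangle_ineq4[of "h t - integral {t..0} ?g" "snd (q 0)"] norm_triangle_ineq4[of "h t" "integral {t..0} ?g"]
      by linarith
    also have "\<dots> \<le> exp (- b * t) * (norm (snd (q 0)) + M\<^sub>2 / b) + norm (snd (q 0))"
      using hb gb by (simp add: algebra_simps)
    finally have "exp (c * t) * norm (h t - integral {t..} ?g - snd (q t))
        \<le> exp (c * t) * (exp (- b * t) * (norm (snd (q 0)) + M\<^sub>2 / b) + norm (snd (q 0)))"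
      by (rule mult_left_mono) simp
    also have "\<dots> = (exp (c * t) * exp (- b * t)) * (norm (snd (q 0)) + M\<^sub>2 / b) + exp (c * t) * norm (snd (q 0))"
      by (simp only: distrib_left mult.assoc)
    also have "\<dots> \<le> 1 * (norm (snd (q 0)) + M\<^sub>2 / b) + 1 * norm (snd (q 0))"
      using weighted_le[OF t] M_nonneg gap by (intro add_mono mult_right_mono) auto
    finally show ?thesis by simp
  qed
  obtain w\<^sub>1 w\<^sub>2 where w: "continuous_on UNIV w\<^sub>1" "continuous_on UNIV w\<^sub>2"
    "\<And>t. (\<lambda>s. flow A (t - s) *v F ((w\<^sub>1 s, w\<^sub>2 s) + N s)) absolutely_integrable_on {..t}"
    "\<And>t. w\<^sub>1 t = integral {..t} (\<lambda>s. flow A (t - s) *v F ((w\<^sub>1 s, w\<^sub>2 s) + N s))"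
    "\<And>t. (\<lambda>s. flow B (t - s) *v \<Psi> s (w\<^sub>1 s, w\<^sub>2 s)) absolutely_integrable_on {t..}"
    "\<And>t. w\<^sub>2 t = h t - integral {t..} (\<lambda>s. flow B (t - s) *v \<Psi> s (w\<^sub>1 s, w\<^sub>2 s))"
    "\<And>t. exp (c * t) * (norm (w\<^sub>1 t - fst (q t)) + norm (w\<^sub>2 t - snd (q t)))
      \<le> ((M\<^sub>1 / a + norm (fst (q 0))) + (2 * norm (snd (q 0)) + M\<^sub>2 / b)) / (1 - (K\<^sub>1 / (a - c) + K\<^sub>2 / (c - b)))"
  proof (rule weighted_fixed_point[of "\<lambda>s p. F (p + N s)" K\<^sub>1 \<Psi> K\<^sub>2 "\<lambda>t. fst (q t)" "\<lambda>t. snd (q t)" h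
        "M\<^sub>1 / a + norm (fst (q 0))" "2 * norm (snd (q 0)) + M\<^sub>2 / b"])
    show "norm (F (p + N s) - F (p' + N s)) \<le> K\<^sub>1 * (norm (fst p - fst p') + norm (snd p - snd p'))" for s p p'
      using F_lip[of "p + N s" "p' + N s"] by simp
    show "norm (\<Psi> s p - \<Psi> s p') \<le> K\<^sub>2 * (norm (fst p - fst p') + norm (snd p - snd p'))" for s p p'
      using G_lip[of "p + N s" "p' + N s"] by (simp add: \<Psi>_def)
    show "continuous_on UNIV (\<lambda>t. fst (q t))" "continuous_on UNIV (\<lambda>t. snd (q t))"
      using q by (auto intro: continuous_on_fst continuous_on_snd)
    show "(\<lambda>s. flow A (t - s) *v F ((fst (q s), snd (q s)) + N s)) absolutely_integrable_on {..t}" for t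
      using i1 by simp
    show "(\<lambda>s. flow B (t - s) *v \<Psi> s (fst (q s), snd (q s))) absolutely_integrable_on {t..}" for t
      using i2 by simp
    show "exp (c * t) * norm (integral {..t} (\<lambda>s. flow A (t - s) *v F ((fst (q s), snd (q s)) + N s)) - fst (q t))
        \<le> M\<^sub>1 / a + norm (fst (q 0))" for t
      using defect1[of t] by simp
    show "exp (c * t) * norm (h t - integral {t..} (\<lambda>s. flow B (t - s) *v \<Psi> s (fst (q s), snd (q s))) - snd (q t))
        \<le> 2 * norm (snd (q 0)) + M\<^sub>2 / b" for t
      using defect2[of t] by simp
  qed (assumption | rule that meas \<Psi>m K contraction h)+
  define W where "W t = (w\<^sub>1 t, w\<^sub>2 t)" for t
  have W: "fst (W t) = w\<^sub>1 t" "snd (W t) = w\<^sub>2 t" for t by (simp_all add: W_def)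
  note w = w[folded W_def]
  have Wc: "continuous_on UNIV W"
    unfolding W_def[abs_def] using w(1,2) by (rule continuous_on_Pair)
  have Wm: "W \<in> borel_measurable borel" by (rule borel_measurable_continuous_onI[OF Wc])
  let ?k = "\<lambda>r. flow B (- r) *v G (W r + N r)"
  have gint: "(\<lambda>r. G (W r + N r)) absolutely_integrable_on {s..t}" for s t
    by (rule bounded_borel_absolutely_integrable[OF meas(2)[OF Wm] G_bound])
  have mild: "flow B (- t) *v w\<^sub>2 t - flow B (- s) *v w\<^sub>2 s = integral {s..t} ?k" if "s \<le> t" for s t
  proof -
    let ?l = "\<lambda>r. flow B (- r) *v \<Psi> r (W r)"
    note inc = unstable_convolution_increment[OF w(5)]
    have "integral {s..t} ?k = integral {s..t} (\<lambda>r. k\<^sub>0 r + ?l r)"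
      by (rule integral_cong)
        (simp add: \<Psi>_def k\<^sub>0_def k_def bounded_bilinear.diff_right[OF bounded_bilinear_matrix_vector_mult])
    also have "\<dots> = integral {s..t} k\<^sub>0 + integral {s..t} ?l"
      by (rule integral_add[OF int[OF k\<^sub>0int] int[OF inc(1)]])
    also have "\<dots> = (flow B (- t) *v h t - flow B (- s) *v h s)
      + (flow B (- t) *v (- integral {t..} (\<lambda>r. flow B (t - r) *v \<Psi> r (W r)))
         - flow B (- s) *v (- integral {s..} (\<lambda>r. flow B (s - r) *v \<Psi> r (W r))))"
      by (simp only: inc(2)[OF that] hinc[OF that])
    finally show ?thesis
      by (simp add: w(6)[of t] w(6)[of s] bounded_bilinear.diff_right[OF bounded_bilinear_matrix_vector_mult]
          bounded_bilinear.minus_right[OF bounded_bilinear_matrix_vector_mult])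
  qed
  show thesis
  proof (rule that[of W])
    show "continuous_on UNIV W" by (rule Wc)
    show "exp (c * t) * (norm (fst (W t) - fst (q t)) + norm (snd (W t) - snd (q t)))
      \<le> ((M\<^sub>1 / a + norm (fst (q 0))) + (2 * norm (snd (q 0)) + M\<^sub>2 / b)) / (1 - (K\<^sub>1 / (a - c) + K\<^sub>2 / (c - b)))" for t
      unfolding W by (rule w(7))
    fix s t :: real assume st: "s \<le> t"
    show "(\<lambda>r. B *v snd (W r) + G (W r + N r)) absolutely_integrable_on {s..t}"
      unfolding W by (rule variation_of_constants_converse(1)[OF st gint rc(2)[OF Wc] mild]) auto
    show "snd (W t) - snd (W s) = integral {s..t} (\<lambda>r. B *v snd (W r) + G (W r + N r))"
      unfolding W by (rule variation_of_constants_converse(2)[OF st gint rc(2)[OF Wc] mild]) auto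
  next
    \<comment> \<open>The fast equation is translated in time, the slow one restarted at \<open>\<tau>\<close>.\<close>
    fix \<tau> :: real
    show "backward_orbit (\<lambda>s. N (s + \<tau>)) (snd (W \<tau>)) (\<lambda>t. W (t + \<tau>))"
      unfolding backward_orbit_def W
    proof (intro conjI allI impI)
      show "continuous_on {..0} (\<lambda>t. W (t + \<tau>))"
        by (rule continuous_on_compose2[OF Wc]) (auto intro!: continuous_intros)
      fix t :: real assume t: "t \<le> 0"
      let ?f = "\<lambda>s. flow A (t + \<tau> - s) *v F (W s + N s)" and ?g = "\<lambda>s. flow B (t + \<tau> - s) *v G (W s + N s)"
      have S: "{s. \<tau> + 1 * s \<in> {..t + \<tau>}} = {..t}" "{s. \<tau> + 1 * s \<in> {t + \<tau>..\<tau>}} = {t..0}" by auto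
      have f: "(\<lambda>s. ?f (\<tau> + 1 * s)) = (\<lambda>s. flow A (t - s) *v F (W (s + \<tau>) + N (s + \<tau>)))"
        and g: "(\<lambda>s. ?g (\<tau> + 1 * s)) = (\<lambda>s. flow B (t - s) *v G (W (s + \<tau>) + N (s + \<tau>)))"
        by (simp_all add: algebra_simps)
      note fi = w(3)[of "t + \<tau>"]
      have gi: "?g absolutely_integrable_on {t + \<tau>..\<tau>}"
        using flow_absolutely_integrable[OF gint] by (simp add: flow_integral(1))
      show "(\<lambda>s. flow A (t - s) *v F (W (s + \<tau>) + N (s + \<tau>))) absolutely_integrable_on {..t}"
        using fi absolutely_integrable_affine(1)[where c = 1 and f = ?f and t = \<tau> and S = "{..t + \<tau>}"] unfolding S f by simp
      show "w\<^sub>1 (t + \<tau>) = integral {..t} (\<lambda>s. flow A (t - s) *v F (W (s + \<tau>) + N (s + \<tau>)))"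
        using absolutely_integrable_affine(2)[OF _ fi, where c = 1 and t = \<tau>] w(4)[of "t + \<tau>"] unfolding S f by simp
      show "(\<lambda>s. flow B (t - s) *v G (W (s + \<tau>) + N (s + \<tau>))) absolutely_integrable_on {t..0}"
        using gi absolutely_integrable_affine(1)[where c = 1 and f = ?g and t = \<tau> and S = "{t + \<tau>..\<tau>}"] unfolding S g by simp
      have "integral {t..0} (\<lambda>s. flow B (t - s) *v G (W (s + \<tau>) + N (s + \<tau>))) = integral {t + \<tau>..\<tau>} ?g"
        using absolutely_integrable_affine(2)[OF _ gi, where c = 1 and t = \<tau>] unfolding S g by simp
      also have "\<dots> = flow B (t + \<tau>) *v integral {t + \<tau>..\<tau>} ?k"
        by (rule flow_integral(2)[OF flow_absolutely_integrable[OF gint]])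
      also have "integral {t + \<tau>..\<tau>} ?k = flow B (- \<tau>) *v w\<^sub>2 \<tau> - flow B (- (t + \<tau>)) *v w\<^sub>2 (t + \<tau>)"
        using mild[of "t + \<tau>" \<tau>] t by simp
      also have "flow B (t + \<tau>) *v \<dots> = flow B t *v w\<^sub>2 \<tau> - w\<^sub>2 (t + \<tau>)"
        using flow_add_vector[of B "t + \<tau>" "- \<tau>" "w\<^sub>2 \<tau>"]
        by (simp only: bounded_bilinear.diff_right[OF bounded_bilinear_matrix_vector_mult] flow_inverse) simp
      finally show "w\<^sub>2 (t + \<tau>) = flow B t *v w\<^sub>2 \<tau>
          - integral {t..0} (\<lambda>s. flow B (t - s) *v G (W (s + \<tau>) + N (s + \<tau>)))"
        by simp
    qed
  qed
qed

end

section \<open>The slow map and the reduced equation\<close>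

context forced_spectral_gap
begin

lemma backward_orbit_cong:
  assumes w: "backward_orbit N y w" and eq: "\<And>t. t \<le> 0 \<Longrightarrow> w' t = w t"
  shows "backward_orbit N y w'"
  unfolding backward_orbit_def
proof (intro conjI allI impI)
  show "continuous_on {..0} w'"
    by (rule continuous_on_eq[of _ w]) (use w eq in \<open>auto simp: backward_orbit_def\<close>)
  fix t :: real assume t: "t \<le> 0"
  let ?f = "\<lambda>w s. flow A (t - s) *v F (w s + N s)" and ?g = "\<lambda>w s. flow B (t - s) *v G (w s + N s)"
  have f: "?f w' s = ?f w s" if "s \<in> {..t}" for s using eq[of s] that t by simp
  have g: "?g w' s = ?g w s" if "s \<in> {t..0}" for s using eq[of s] that by simp
  have W: "?f w absolutely_integrable_on {..t}" "fst (w t) = integral {..t} (?f w)"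
    "?g w absolutely_integrable_on {t..0}" "snd (w t) = flow B t *v y - integral {t..0} (?g w)"
    using w t unfolding backward_orbit_def by auto
  show "?f w' absolutely_integrable_on {..t}"
    by (rule iffD2[OF set_integrable_cong[OF refl refl f] W(1)])
  show "?g w' absolutely_integrable_on {t..0}"
    by (rule iffD2[OF set_integrable_cong[OF refl refl g] W(3)])
  have "integral {..t} (?f w') = integral {..t} (?f w)" by (rule integral_cong) (rule f)
  then show "fst (w' t) = integral {..t} (?f w')" using W(2) eq[OF t] by simp
  have "integral {t..0} (?g w') = integral {t..0} (?g w)" by (rule integral_cong) (rule g)
  then show "snd (w' t) = flow B t *v y - integral {t..0} (?g w')" using W(4) eq[OF t] by simp
qed

text \<open>
  The graph map of the invariant manifold of the system driven by \<open>N\<close>: the fast component at time 0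
  of the backward orbit through \<open>y\<close>. Functions extensional on \<open>{..0}\<close> make this orbit unique.
\<close>

definition slow_map :: "(real \<Rightarrow> (real ^ 'n) \<times> (real ^ 'm)) \<Rightarrow> real ^ 'm \<Rightarrow> real ^ 'n" where
  "slow_map N y = fst ((THE w. w \<in> extensional {..0} \<and> backward_orbit N y w) 0)"

lemma slow_map_eq:
  assumes w: "backward_orbit N y w"
  shows "slow_map N y = fst (w 0)"
proof -
  have "(THE w. w \<in> extensional {..0} \<and> backward_orbit N y w) = restrict w {..0}"
  proof (rule the_equality)
    have "backward_orbit N y (restrict w {..0})"
      by (rule backward_orbit_cong[OF w]) simp
    then show "restrict w {..0} \<in> extensional {..0} \<and> backward_orbit N y (restrict w {..0})" by simp
    fix w' assume w': "w' \<in> extensional {..0} \<and> backward_orbit N y w'"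
    show "w' = restrict w {..0}"
    proof (rule extensionalityI[of _ "{..0}"])
      show "w' t = restrict w {..0} t" if "t \<in> {..0}" for t
        using backward_orbit_unique[of N y w' w t] w w' that by simp
    qed (use w' in auto)
  qed
  then show ?thesis by (simp add: slow_map_def)
qed

lemma slow_map_lipschitz:
  assumes N: "N \<in> borel_measurable borel"
  shows "norm (slow_map N y - slow_map N y') \<le> norm (y - y') / (1 - (K\<^sub>1 / (a - c) + K\<^sub>2 / (c - b)))"
proof -
  obtain w w' where w: "backward_orbit N y w" "backward_orbit N y' w'"
    using backward_orbit_exists[OF N] by blast
  have "norm (fst (w 0) - fst (w' 0)) \<le> exp (c * 0) * (norm (fst (w 0) - fst (w' 0)) + norm (snd (w 0) - snd (w' 0)))"
    by simp
  also have "\<dots> \<le> norm (y - y') / (1 - (K\<^sub>1 / (a - c) + K\<^sub>2 / (c - b)))"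
    by (rule backward_orbit_dist[OF w]) simp
  finally show ?thesis by (simp add: slow_map_eq[OF w(1)] slow_map_eq[OF w(2)])
qed

text \<open>
  The slow map is Lipschitz, hence so is the right-hand side of the reduced equation. The term \<open>g\<close>
  carries additive noise, which cancels in the difference of two solutions.
\<close>

lemma reduced_equation_unique:
  assumes N: "N \<in> borel_measurable borel" and T: "0 \<le> T" and init: "v 0 = v' 0"
    and u: "\<And>t. 0 \<le> t \<Longrightarrow> u t = slow_map (\<lambda>s. N (s + t)) (v t - snd (N t)) + fst (N t)"
    and u': "\<And>t. 0 \<le> t \<Longrightarrow> u' t = slow_map (\<lambda>s. N (s + t)) (v' t - snd (N t)) + fst (N t)"
    and int: "(\<lambda>r. B *v v r + G (u r, v r)) integrable_on {0..T}"
      "(\<lambda>r. B *v v' r + G (u' r, v' r)) integrable_on {0..T}"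
    and v: "\<And>t. 0 \<le> t \<Longrightarrow> t \<le> T \<Longrightarrow> v t - v 0 = integral {0..t} (\<lambda>r. B *v v r + G (u r, v r)) + g t"
    and v': "\<And>t. 0 \<le> t \<Longrightarrow> t \<le> T \<Longrightarrow> v' t - v' 0 = integral {0..t} (\<lambda>r. B *v v' r + G (u' r, v' r)) + g t"
  shows "v T = v' T"
proof -
  define \<kappa> where "\<kappa> = K\<^sub>1 / (a - c) + K\<^sub>2 / (c - b)"
  obtain C where C: "0 < C" "\<And>x. norm (B *v x) \<le> norm x * C"
    using bounded_linear.pos_bounded[OF matrix_vector_mul_bounded_linear, of B] by blast
  have \<kappa>: "0 < 1 - \<kappa>" using contraction by (simp add: \<kappa>_def)
  define C' where "C' = C + K\<^sub>2 * (1 / (1 - \<kappa>) + 1)"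
  let ?g = "\<lambda>r. (B *v v r + G (u r, v r)) - (B *v v' r + G (u' r, v' r))"
  have "v T - v' T = 0"
  proof (rule integral_equation_zero[OF T, where g = ?g and C = C'])
    show "?g integrable_on {0..T}" using int by (rule integrable_diff)
    show "0 < C'" using C K \<kappa> by (simp add: C'_def add_pos_nonneg)
    fix t assume t: "0 \<le> t" "t \<le> T"
    let ?h = "\<lambda>r. B *v v r + G (u r, v r)" and ?h' = "\<lambda>r. B *v v' r + G (u' r, v' r)"
    have "?h integrable_on {0..t}" "?h' integrable_on {0..t}"
      using t by (auto intro: integrable_on_subinterval[OF int(1)] integrable_on_subinterval[OF int(2)])
    then have "integral {0..t} ?g = integral {0..t} ?h - integral {0..t} ?h'"
      by (rule integral_diff)
    also have "\<dots> = (v t - v 0) - (v' t - v' 0)"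
      unfolding v[OF t] v'[OF t] by simp
    finally show "v t - v' t = integral {0..t} ?g"
      unfolding init by simp
    have "norm (u t - u' t) \<le> norm (v t - v' t) / (1 - \<kappa>)"
    proof -
      have "(\<lambda>s. N (s + t)) \<in> borel_measurable borel"
        by (rule measurable_compose[OF _ N]) simp
      from slow_map_lipschitz[OF this, of "v t - snd (N t)" "v' t - snd (N t)"] show ?thesis
        using u[OF t(1)] u'[OF t(1)] by (simp add: \<kappa>_def)
    qed
    then have "norm (G (u t, v t) - G (u' t, v' t)) \<le> K\<^sub>2 * (norm (v t - v' t) / (1 - \<kappa>) + norm (v t - v' t))"
      using K by (intro order_trans[OF G_lip] mult_left_mono) auto
    moreover have "norm (B *v v t - B *v v' t) \<le> norm (v t - v' t) * C"
      using C(2)[of "v t - v' t"] by (simp add: bounded_bilinear.diff_right[OF bounded_bilinear_matrix_vector_mult])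
    ultimately have "norm ((B *v v t - B *v v' t) + (G (u t, v t) - G (u' t, v' t)))
        \<le> norm (v t - v' t) * C + K\<^sub>2 * (norm (v t - v' t) / (1 - \<kappa>) + norm (v t - v' t))"
      using norm_triangle_ineq[of "B *v v t - B *v v' t" "G (u t, v t) - G (u' t, v' t)"] by linarith
    also have "\<dots> = C' * norm (v t - v' t)"
      by (simp add: C'_def algebra_simps)
    also have "(B *v v t - B *v v' t) + (G (u t, v t) - G (u' t, v' t)) = ?g t"
      by (rule add_diff_add[symmetric])
    finally show "norm (?g t) \<le> C' * norm (v t - v' t)" .
  qed
  then show ?thesis by simp
qed

end

section \<open>Exponential tracking by the random invariant manifold\<close>

lemma continuous_on_half_line_indefinite:
  fixes x :: "real \<Rightarrow> 'a::euclidean_space"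
  assumes k: "\<And>s t. 0 \<le> s \<Longrightarrow> s \<le> t \<Longrightarrow> k integrable_on {s..t}"
    and x: "\<And>s t. 0 \<le> s \<Longrightarrow> s \<le> t \<Longrightarrow> x t - x s = integral {s..t} k"
  shows "continuous_on UNIV (\<lambda>t. x (max t 0))"
proof (rule continuous_on_indefinite)
  let ?k = "\<lambda>r. if r \<in> {0..} then k r else 0"
  have S: "{0..} \<inter> {s..t} = {max s 0..t}" for s t :: real by auto
  have k': "k integrable_on {max s 0..t}" for s t
    using k[of "max s 0" t] by (cases "max s 0 \<le> t") auto
  then show "?k integrable_on {s..t}" for s t
    unfolding integrable_restrict_Int S .
  show "x (max t 0) - x (max s 0) = integral {s..t} ?k" if "s \<le> t" for s t
    unfolding Henstock_Kurzweil_Integration.integral_restrict_Int S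
    using x[of "max s 0" t] that by (cases "0 \<le> t") (auto simp: max_def)
qed

lemma path_shift_path_shift: "path_shift s (path_shift t w) = path_shift (s + t) w"
  by (simp add: path_shift_def fun_eq_iff add_ac)

text \<open>
  An element of a shift-invariant set is an image under the shift by 0, hence fixed by it.
\<close>

lemma shift_invariant_vanishes_at_0:
  assumes "shift_invariant W" "\<omega> \<in> W"
  shows "path_shift 0 (fst \<omega>) = fst \<omega>" "path_shift 0 (snd \<omega>) = snd \<omega>"
proof -
  obtain \<eta> where "\<omega> = shift_pair 0 \<eta>" using assms unfolding shift_invariant_def by blast
  then show "path_shift 0 (fst \<omega>) = fst \<omega>" "path_shift 0 (snd \<omega>) = snd \<omega>"
    by (simp_all add: shift_pair_def path_shift_path_shift)
qed

lemma solves_onD: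
  assumes "solves_on T x f g"
  shows "cadlag_on T x"
    and "s \<in> T \<Longrightarrow> t \<in> T \<Longrightarrow> s \<le> t \<Longrightarrow> f absolutely_integrable_on {s..t}"
    and "s \<in> T \<Longrightarrow> t \<in> T \<Longrightarrow> s \<le> t \<Longrightarrow> x t - x s = integral {s..t} f + (g t - g s)"
  using assms unfolding solves_on_def by blast+

theorem theorem3p3:
  fixes A :: "real ^ 'n ^ 'n" and B Q :: "real ^ 'm ^ 'm"
    and U :: "(real ^ 'n) \<times> (real ^ 'm) \<Rightarrow> real ^ 'n"
    and V :: "(real ^ 'n) \<times> (real ^ 'm) \<Rightarrow> real ^ 'm"
    and \<alpha> \<delta> \<sigma>\<^sub>1 \<sigma>\<^sub>2 \<gamma>\<^sub>1 \<gamma>\<^sub>2 \<gamma>\<^sub>3 L M\<^sub>U M\<^sub>V \<mu> \<epsilon>\<^sub>0 \<epsilon> :: real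
    and \<nu> :: "(real ^ 'm) measure"
    and P\<^sub>1 :: "(real \<Rightarrow> real ^ 'n) measure" and P\<^sub>2 :: "(real \<Rightarrow> real ^ 'm) measure"
    and \<zeta> :: "real \<Rightarrow> (real \<Rightarrow> real ^ 'n) \<Rightarrow> real ^ 'n"
    and \<xi> :: "(real \<Rightarrow> real ^ 'm) \<Rightarrow> real ^ 'm"
    and \<Omega> :: "real \<Rightarrow> ((real \<Rightarrow> real ^ 'n) \<times> (real \<Rightarrow> real ^ 'm)) set"
    and \<omega> :: "(real \<Rightarrow> real ^ 'n) \<times> (real \<Rightarrow> real ^ 'm)"
    and u :: "real \<Rightarrow> real ^ 'n" and v :: "real \<Rightarrow> real ^ 'm"
    and u\<^sub>0 :: "real ^ 'n" and v\<^sub>0 :: "real ^ 'm"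
  assumes "1 < \<alpha>" and "\<alpha> < 2"
    and "two_sided_levy_law P\<^sub>1 (stable_exponent \<alpha>)"
    and "\<And>z. 0 \<le> z \<bullet> (Q *v z)" and "0 < \<delta>" and "\<delta> < 1" and "levy_measure \<nu>"
    and "two_sided_levy_law P\<^sub>2 (levy_khintchine_exponent Q \<delta> \<nu>)"
    and "U \<in> borel_measurable borel" and "V \<in> borel_measurable borel"
    and "\<sigma>\<^sub>1 \<noteq> 0" and "\<sigma>\<^sub>2 \<noteq> 0"
    and H1: "\<gamma>\<^sub>1 > 0" "\<And>x. (A *v x) \<bullet> x \<le> - \<gamma>\<^sub>1 * (norm x)\<^sup>2"
    and H2: "\<gamma>\<^sub>2 > 0" "\<gamma>\<^sub>3 \<ge> 0"
      "\<And>t. t \<le> 0 \<Longrightarrow> onorm ((*v) (mat_exp (t *\<^sub>R B))) \<le> exp (- \<gamma>\<^sub>2 * t)"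
      "\<And>t. t > 0 \<Longrightarrow> onorm ((*v) (mat_exp (t *\<^sub>R B))) \<le> exp (- \<gamma>\<^sub>3 * t)"
    and H3: "L > 0"
      "\<And>x\<^sub>1 x\<^sub>2 y\<^sub>1 y\<^sub>2. norm (U (x\<^sub>1, y\<^sub>1) - U (x\<^sub>2, y\<^sub>2)) \<le> L * (norm (x\<^sub>1 - x\<^sub>2) + norm (y\<^sub>1 - y\<^sub>2))"
      "\<And>x\<^sub>1 x\<^sub>2 y\<^sub>1 y\<^sub>2. norm (V (x\<^sub>1, y\<^sub>1) - V (x\<^sub>2, y\<^sub>2)) \<le> L * (norm (x\<^sub>1 - x\<^sub>2) + norm (y\<^sub>1 - y\<^sub>2))"
    and H4: "\<gamma>\<^sub>1 > L"
    and H5: "bdd_above (range (\<lambda>z. norm (U z)))" "M\<^sub>U = (SUP z. norm (U z))"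
      "bdd_above (range (\<lambda>z. norm (V z)))" "M\<^sub>V = (SUP z. norm (V z))"
    and stationary_measurable:
      "\<And>e. e > 0 \<Longrightarrow> \<zeta> e \<in> borel_measurable P\<^sub>1" "\<xi> \<in> borel_measurable P\<^sub>2"
    and full_invariant_set:
      "\<And>e. e > 0 \<Longrightarrow> \<Omega> e \<subseteq> space (P\<^sub>1 \<Otimes>\<^sub>M P\<^sub>2)"
      "\<And>e. e > 0 \<Longrightarrow> shift_invariant (\<Omega> e)"
      "\<And>e. e > 0 \<Longrightarrow> AE \<eta> in P\<^sub>1 \<Otimes>\<^sub>M P\<^sub>2. \<eta> \<in> \<Omega> e"
    and stationary_solutions:
      "\<And>e \<omega>\<^sub>1 \<omega>\<^sub>2. e > 0 \<Longrightarrow> (\<omega>\<^sub>1, \<omega>\<^sub>2) \<in> \<Omega> e \<Longrightarrow>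
         solves_on UNIV (\<lambda>t. \<zeta> e (path_shift t \<omega>\<^sub>1)) (\<lambda>t. (1 / e) *\<^sub>R (A *v \<zeta> e (path_shift t \<omega>\<^sub>1)))
           (\<lambda>t. (\<sigma>\<^sub>1 / e powr (1 / \<alpha>)) *\<^sub>R \<omega>\<^sub>1 t)"
      "\<And>e \<omega>\<^sub>1 \<omega>\<^sub>2. e > 0 \<Longrightarrow> (\<omega>\<^sub>1, \<omega>\<^sub>2) \<in> \<Omega> e \<Longrightarrow>
         solves_on UNIV (\<lambda>t. \<xi> (path_shift t \<omega>\<^sub>2)) (\<lambda>t. B *v \<xi> (path_shift t \<omega>\<^sub>2)) (\<lambda>t. \<sigma>\<^sub>2 *\<^sub>R \<omega>\<^sub>2 t)"
    and "\<mu> > 0" and "\<gamma>\<^sub>1 - \<mu> > L" and "\<epsilon>\<^sub>0 > 0"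
    and "\<And>e. 0 < e \<Longrightarrow> e \<le> \<epsilon>\<^sub>0 \<Longrightarrow> \<mu> - e * \<gamma>\<^sub>2 > 0"
    and "\<And>e. 0 < e \<Longrightarrow> e \<le> \<epsilon>\<^sub>0 \<Longrightarrow> L / (\<gamma>\<^sub>1 - \<mu>) + e * L / (\<mu> - e * \<gamma>\<^sub>2) < 1"
    and "0 < \<epsilon>" and "\<epsilon> \<le> \<epsilon>\<^sub>0" and "\<omega> \<in> \<Omega> \<epsilon>"
    and solution_u: "solves_on {0..} u (\<lambda>t. (1 / \<epsilon>) *\<^sub>R (A *v u t) + (1 / \<epsilon>) *\<^sub>R U (u t, v t))
      (\<lambda>t. (\<sigma>\<^sub>1 / \<epsilon> powr (1 / \<alpha>)) *\<^sub>R fst \<omega> t)"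
    and solution_v: "solves_on {0..} v (\<lambda>t. B *v v t + V (u t, v t)) (\<lambda>t. \<sigma>\<^sub>2 *\<^sub>R snd \<omega> t)"
    and "u 0 = u\<^sub>0" and "v 0 = v\<^sub>0"
  shows "\<exists>z\<^sub>0 \<in> random_manifold A B U V (\<zeta> \<epsilon>) \<xi> \<epsilon> \<omega>. \<exists>u' v'.
    reduced_solution A B U V (\<zeta> \<epsilon>) \<xi> \<epsilon> \<sigma>\<^sub>2 \<omega> u' v' \<and> (u' 0, v' 0) = z\<^sub>0 \<and>
    (\<forall>u'' v''. reduced_solution A B U V (\<zeta> \<epsilon>) \<xi> \<epsilon> \<sigma>\<^sub>2 \<omega> u'' v'' \<and> (u'' 0, v'' 0) = z\<^sub>0 \<longrightarrow>
       (\<forall>t\<ge>0. u'' t = u' t \<and> v'' t = v' t)) \<and>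
    (\<forall>t\<ge>0. norm (u t - u' t) + norm (v t - v' t)
       \<le> exp (- (\<mu> / \<epsilon>) * t) / (1 - (L / (\<gamma>\<^sub>1 - \<mu>) + \<epsilon> * L / (\<mu> - \<epsilon> * \<gamma>\<^sub>2))) *
          (2 * (norm (u\<^sub>0 - \<zeta> \<epsilon> (fst \<omega>)) + norm (v\<^sub>0 - \<xi> (snd \<omega>)))
             + 2 * (M\<^sub>U / \<gamma>\<^sub>1) + M\<^sub>V / \<gamma>\<^sub>2))"
proof -
  note int = set_lebesgue_integral_eq_integral(1)
  note \<epsilon> = \<open>0 < \<epsilon>\<close>
  have gap: "\<mu> - \<epsilon> * \<gamma>\<^sub>2 > 0"
    by (rule \<open>\<And>e. 0 < e \<Longrightarrow> e \<le> \<epsilon>\<^sub>0 \<Longrightarrow> \<mu> - e * \<gamma>\<^sub>2 > 0\<close>[OF \<epsilon> \<open>\<epsilon> \<le> \<epsilon>\<^sub>0\<close>])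
  have contraction: "L / (\<gamma>\<^sub>1 - \<mu>) + \<epsilon> * L / (\<mu> - \<epsilon> * \<gamma>\<^sub>2) < 1"
    by (rule \<open>\<And>e. 0 < e \<Longrightarrow> e \<le> \<epsilon>\<^sub>0 \<Longrightarrow> L / (\<gamma>\<^sub>1 - \<mu>) + e * L / (\<mu> - e * \<gamma>\<^sub>2) < 1\<close>[OF \<epsilon> \<open>\<epsilon> \<le> \<epsilon>\<^sub>0\<close>])
  define A' where "A' = (1 / \<epsilon>) *\<^sub>R A"
  define F where "F z = (1 / \<epsilon>) *\<^sub>R U z" for z
  define N where "N t = (\<zeta> \<epsilon> (path_shift t (fst \<omega>)), \<xi> (path_shift t (snd \<omega>)))" for t
  have \<kappa>: "(L / \<epsilon>) / (\<gamma>\<^sub>1 / \<epsilon> - \<mu> / \<epsilon>) + L / (\<mu> / \<epsilon> - \<gamma>\<^sub>2) = L / (\<gamma>\<^sub>1 - \<mu>) + \<epsilon> * L / (\<mu> - \<epsilon> * \<gamma>\<^sub>2)"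
  proof -
    have "(L / \<epsilon>) / (\<gamma>\<^sub>1 / \<epsilon> - \<mu> / \<epsilon>) = L / (\<gamma>\<^sub>1 - \<mu>)"
      using \<epsilon> by (simp flip: diff_divide_distrib)
    moreover have "\<mu> / \<epsilon> - \<gamma>\<^sub>2 = (\<mu> - \<epsilon> * \<gamma>\<^sub>2) / \<epsilon>" using \<epsilon> by (simp add: diff_divide_distrib)
    ultimately show ?thesis by (simp only: divide_divide_eq_right mult.commute)
  qed
  have U_bound: "norm (U z) \<le> M\<^sub>U" and V_bound: "norm (V z) \<le> M\<^sub>V" for z
    using H5 by (auto intro: cSUP_upper)
  interpret S: forced_spectral_gap A' B "\<gamma>\<^sub>1 / \<epsilon>" \<gamma>\<^sub>2 "\<mu> / \<epsilon>" F V "L / \<epsilon>" L "M\<^sub>U / \<epsilon>" M\<^sub>V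
  proof
    show "norm (flow A' s *v x) \<le> exp (- (\<gamma>\<^sub>1 / \<epsilon>) * s) * norm x" if "0 \<le> s" for s x
    proof (rule dissipative_flow_decay[OF _ that])
      show "(A' *v x) \<bullet> x \<le> - (\<gamma>\<^sub>1 / \<epsilon>) * (norm x)\<^sup>2" for x
        using divide_right_mono[OF H1(2)[of x], of \<epsilon>] \<epsilon>
        by (simp add: A'_def flip: scaleR_matrix_vector_assoc)
    qed
    show "norm (flow B s *v y) \<le> exp (- \<gamma>\<^sub>2 * s) * norm y" if "s \<le> 0" for s y
    proof -
      have "norm (flow B s *v y) \<le> onorm ((*v) (flow B s)) * norm y"
        by (rule onorm[OF matrix_vector_mul_bounded_linear])
      also have "\<dots> \<le> exp (- \<gamma>\<^sub>2 * s) * norm y"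
        unfolding flow_def using H2(3)[OF that] by (rule mult_right_mono) simp
      finally show ?thesis .
    qed
    show "0 < \<gamma>\<^sub>2" by (rule H2(1))
    show "\<gamma>\<^sub>2 < \<mu> / \<epsilon>" using gap \<epsilon> by (simp add: pos_less_divide_eq mult.commute)
    show "\<mu> / \<epsilon> < \<gamma>\<^sub>1 / \<epsilon>" using \<open>\<gamma>\<^sub>1 - \<mu> > L\<close> \<open>L > 0\<close> \<epsilon> by (simp add: divide_strict_right_mono)
    show "norm (F p - F q) \<le> L / \<epsilon> * (norm (fst p - fst q) + norm (snd p - snd q))" for p q
    proof -
      have "norm (F p - F q) = norm (U p - U q) / \<epsilon>"
        using \<epsilon> by (simp add: F_def flip: scaleR_diff_right)
      also have "\<dots> \<le> L * (norm (fst p - fst q) + norm (snd p - snd q)) / \<epsilon>"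
        using H3(2)[of "fst p" "snd p" "fst q" "snd q"] \<epsilon> by (simp add: divide_right_mono)
      finally show ?thesis by simp
    qed
    show "norm (V p - V q) \<le> L * (norm (fst p - fst q) + norm (snd p - snd q))" for p q
      using H3(3)[of "fst p" "snd p" "fst q" "snd q"] by simp
    show "norm (F p) \<le> M\<^sub>U / \<epsilon>" for p
      using U_bound[of p] \<epsilon> by (simp add: F_def divide_right_mono)
    show "norm (V p) \<le> M\<^sub>V" for p by (rule V_bound)
    show "0 \<le> L / \<epsilon>" "0 \<le> L" using \<epsilon> \<open>L > 0\<close> by auto
    show "(L / \<epsilon>) / (\<gamma>\<^sub>1 / \<epsilon> - \<mu> / \<epsilon>) + L / (\<mu> / \<epsilon> - \<gamma>\<^sub>2) < 1"
      unfolding \<kappa> by (rule contraction)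
  qed
  have shift0: "path_shift 0 (fst \<omega>) = fst \<omega>" "path_shift 0 (snd \<omega>) = snd \<omega>"
    using shift_invariant_vanishes_at_0[OF full_invariant_set(2)[OF \<epsilon>] \<open>\<omega> \<in> \<Omega> \<epsilon>\<close>] by auto
  have map_eq: "manifold_map A B U V (\<zeta> \<epsilon>) \<xi> \<epsilon> (shift_pair \<tau> \<omega>) y = S.slow_map (\<lambda>s. N (s + \<tau>)) y" for \<tau> y
  proof -
    have p: "(fst (w r) + \<zeta> \<epsilon> (path_shift r (fst (shift_pair \<tau> \<omega>))), snd (w r) + \<xi> (path_shift r (snd (shift_pair \<tau> \<omega>))))
        = w r + N (r + \<tau>)" for w r
      by (simp add: N_def shift_pair_def path_shift_path_shift prod_eq_iff)
    have e: "mat_exp ((x / \<epsilon>) *\<^sub>R A) = flow A' x" "mat_exp (x *\<^sub>R B) = flow B x" for x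
      by (simp_all add: flow_def A'_def)
    have "lyapunov_perron A B U V (\<zeta> \<epsilon>) \<xi> \<epsilon> (shift_pair \<tau> \<omega>) y w \<longleftrightarrow> S.backward_orbit (\<lambda>s. N (s + \<tau>)) y w" for w
      unfolding lyapunov_perron_def S.backward_orbit_def Let_def p e F_def[symmetric] ..
    then show ?thesis
      by (simp add: manifold_map_def lyapunov_perron_solution_def S.slow_map_def)
  qed
  have shift_pair_0: "shift_pair 0 \<omega> = \<omega>"
    by (simp add: shift_pair_def shift0)

  \<comment> \<open>The stationary process is cadlag and solves the linear equations along the path.\<close>
  have \<omega>: "(fst \<omega>, snd \<omega>) \<in> \<Omega> \<epsilon>" using \<open>\<omega> \<in> \<Omega> \<epsilon>\<close> by simp
  have N1: "solves_on UNIV (\<lambda>t. fst (N t)) (\<lambda>t. A' *v fst (N t)) (\<lambda>t. (\<sigma>\<^sub>1 / \<epsilon> powr (1 / \<alpha>)) *\<^sub>R fst \<omega> t)"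
    using stationary_solutions(1)[OF \<epsilon> \<omega>] by (simp add: N_def A'_def scaleR_matrix_vector_assoc)
  have N2: "solves_on UNIV (\<lambda>t. snd (N t)) (\<lambda>t. B *v snd (N t)) (\<lambda>t. \<sigma>\<^sub>2 *\<^sub>R snd \<omega> t)"
    using stationary_solutions(2)[OF \<epsilon> \<omega>] by (simp add: N_def)
  have Nr: "(N \<longlongrightarrow> N t) (at_right t)" for t
  proof -
    have "((\<lambda>t. (fst (N t), snd (N t))) \<longlongrightarrow> (fst (N t), snd (N t))) (at_right t)"
      using solves_onD(1)[OF N1] solves_onD(1)[OF N2] by (intro tendsto_Pair) (auto simp: cadlag_on_def)
    then show ?thesis by simp
  qed
  have Nm: "N \<in> borel_measurable borel" by (rule right_continuous_imp_borel_measurable[OF Nr])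

  \<comment> \<open>Subtracting it removes the noise from the equations.\<close>
  define z where "z t = (u t, v t) - N t" for t
  have zN: "z t + N t = (u t, v t)" for t by (simp add: z_def)
  define f where "f r = A' *v fst (z r) + F (z r + N r)" for r
  define g where "g r = B *v snd (z r) + V (z r + N r)" for r
  have fz: "f integrable_on {s..t}" "fst (z t) - fst (z s) = integral {s..t} f" if "0 \<le> s" "s \<le> t" for s t
  proof -
    have st: "s \<in> {0..}" "t \<in> {0..}" using that by auto
    have eq: "f = (\<lambda>r. ((1 / \<epsilon>) *\<^sub>R (A *v u r) + (1 / \<epsilon>) *\<^sub>R U (u r, v r)) - A' *v fst (N r))"
      by (simp add: fun_eq_iff f_def zN F_def, simp add: z_def A'_def scaleR_matrix_vector_assoc
          bounded_bilinear.diff_right[OF bounded_bilinear_matrix_vector_mult])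
    note iu = int[OF solves_onD(2)[OF solution_u st that(2)]]
    note iN = int[OF solves_onD(2)[OF N1 UNIV_I UNIV_I that(2)]]
    show "f integrable_on {s..t}" unfolding eq by (rule integrable_diff[OF iu iN])
    have "fst (z t) - fst (z s) = (u t - u s) - (fst (N t) - fst (N s))" by (simp add: z_def)
    also have "\<dots> = integral {s..t} (\<lambda>r. (1 / \<epsilon>) *\<^sub>R (A *v u r) + (1 / \<epsilon>) *\<^sub>R U (u r, v r))
        - integral {s..t} (\<lambda>r. A' *v fst (N r))"
      unfolding solves_onD(3)[OF solution_u st that(2)] solves_onD(3)[OF N1 UNIV_I UNIV_I that(2)] by simp
    also have "\<dots> = integral {s..t} f" unfolding eq by (rule integral_diff[OF iu iN, symmetric])
    finally show "fst (z t) - fst (z s) = integral {s..t} f" .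
  qed
  have gz: "g integrable_on {s..t}" "snd (z t) - snd (z s) = integral {s..t} g" if "0 \<le> s" "s \<le> t" for s t
  proof -
    have st: "s \<in> {0..}" "t \<in> {0..}" using that by auto
    have eq: "g = (\<lambda>r. (B *v v r + V (u r, v r)) - B *v snd (N r))"
      by (simp add: fun_eq_iff g_def zN, simp add: z_def
          bounded_bilinear.diff_right[OF bounded_bilinear_matrix_vector_mult])
    note iv = int[OF solves_onD(2)[OF solution_v st that(2)]]
    note iN = int[OF solves_onD(2)[OF N2 UNIV_I UNIV_I that(2)]]
    show "g integrable_on {s..t}" unfolding eq by (rule integrable_diff[OF iv iN])
    have "snd (z t) - snd (z s) = (v t - v s) - (snd (N t) - snd (N s))" by (simp add: z_def)
    also have "\<dots> = integral {s..t} (\<lambda>r. B *v v r + V (u r, v r)) - integral {s..t} (\<lambda>r. B *v snd (N r))"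
      unfolding solves_onD(3)[OF solution_v st that(2)] solves_onD(3)[OF N2 UNIV_I UNIV_I that(2)] by simp
    also have "\<dots> = integral {s..t} g" unfolding eq by (rule integral_diff[OF iv iN, symmetric])
    finally show "snd (z t) - snd (z s) = integral {s..t} g" .
  qed
  define q where "q t = z (max t 0)" for t
  have q: "continuous_on UNIV q"
  proof -
    have "continuous_on UNIV (\<lambda>t. fst (z (max t 0)))" "continuous_on UNIV (\<lambda>t. snd (z (max t 0)))"
      using continuous_on_half_line_indefinite[of f "\<lambda>t. fst (z t)"] fz
        continuous_on_half_line_indefinite[of g "\<lambda>t. snd (z t)"] gz by blast+
    then have "continuous_on UNIV (\<lambda>t. (fst (q t), snd (q t)))"
      unfolding q_def by (rule continuous_on_Pair)
    then show ?thesis by simp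
  qed
  obtain w where w: "continuous_on UNIV w"
    "\<And>\<tau>. S.backward_orbit (\<lambda>s. N (s + \<tau>)) (snd (w \<tau>)) (\<lambda>t. w (t + \<tau>))"
    "\<And>s t. s \<le> t \<Longrightarrow> (\<lambda>r. B *v snd (w r) + V (w r + N r)) absolutely_integrable_on {s..t}"
    "\<And>s t. s \<le> t \<Longrightarrow> snd (w t) - snd (w s) = integral {s..t} (\<lambda>r. B *v snd (w r) + V (w r + N r))"
    "\<And>t. exp (\<mu> / \<epsilon> * t) * (norm (fst (w t) - fst (q t)) + norm (snd (w t) - snd (q t)))
      \<le> ((M\<^sub>U / \<epsilon> / (\<gamma>\<^sub>1 / \<epsilon>) + norm (fst (q 0))) + (2 * norm (snd (q 0)) + M\<^sub>V / \<gamma>\<^sub>2))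
        / (1 - ((L / \<epsilon>) / (\<gamma>\<^sub>1 / \<epsilon> - \<mu> / \<epsilon>) + L / (\<mu> / \<epsilon> - \<gamma>\<^sub>2)))"
  proof (rule S.tracking_orbit[OF Nr q])
    show "q t = q 0" if "t \<le> 0" for t using that by (simp add: q_def)
    show "fst (q t) - fst (q 0) = integral {0..t} (\<lambda>r. A' *v fst (q r) + F (q r + N r))" if "0 \<le> t" for t
    proof -
      have "integral {0..t} (\<lambda>r. A' *v fst (q r) + F (q r + N r)) = integral {0..t} f"
        by (rule integral_cong) (simp add: q_def f_def)
      then show ?thesis using fz(2)[of 0 t] that by (simp add: q_def)
    qed
    show "snd (q t) - snd (q 0) = integral {0..t} (\<lambda>r. B *v snd (q r) + V (q r + N r))" if "0 \<le> t" for t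
    proof -
      have "integral {0..t} (\<lambda>r. B *v snd (q r) + V (q r + N r)) = integral {0..t} g"
        by (rule integral_cong) (simp add: q_def g_def)
      then show ?thesis using gz(2)[of 0 t] that by (simp add: q_def)
    qed
  qed (assumption | rule that)+
  define u' where "u' t = fst (w t + N t)" for t
  define v' where "v' t = snd (w t + N t)" for t
  have uv': "(u' t, v' t) = w t + N t" for t by (simp add: u'_def v'_def prod_eq_iff)
  have on_manifold: "manifold_map A B U V (\<zeta> \<epsilon>) \<xi> \<epsilon> (shift_pair t \<omega>) (snd (w t)) = fst (w t)" for t
    unfolding map_eq using S.slow_map_eq[OF w(2)[of t]] by simp
  have v'_solves: "solves_on {0..} v' (\<lambda>t. B *v v' t + V (u' t, v' t)) (\<lambda>t. \<sigma>\<^sub>2 *\<^sub>R snd \<omega> t)"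
    unfolding solves_on_def
  proof (intro conjI ballI impI)
    show "cadlag_on {0..} v'"
      unfolding cadlag_on_def
    proof (intro ballI conjI)
      fix t :: real
      have wt: "((\<lambda>t. snd (w t)) \<longlongrightarrow> snd (w t)) (at t)"
        using w(1) by (intro tendsto_snd) (simp add: continuous_on_def)
      have cN: "cadlag_on UNIV (\<lambda>t. snd (N t))" by (rule solves_onD(1)[OF N2])
      have "((\<lambda>t. snd (w t) + snd (N t)) \<longlongrightarrow> snd (w t) + snd (N t)) (at_right t)"
        using cN by (intro tendsto_add tendsto_within_subset[OF wt]) (auto simp: cadlag_on_def)
      then have "(v' \<longlongrightarrow> v' t) (at_right t)" by (simp add: v'_def[abs_def])
      then show "(v' \<longlongrightarrow> v' t) (at t within {0..} \<inter> {t<..})" by (rule tendsto_within_subset) auto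
      obtain l where "((\<lambda>t. snd (N t)) \<longlongrightarrow> l) (at_left t)"
        using cN by (auto simp: cadlag_on_def)
      then have "((\<lambda>t. snd (w t) + snd (N t)) \<longlongrightarrow> snd (w t) + l) (at_left t)"
        by (intro tendsto_add tendsto_within_subset[OF wt]) auto
      then have "(v' \<longlongrightarrow> snd (w t) + l) (at_left t)" by (simp add: v'_def[abs_def])
      then have "(v' \<longlongrightarrow> snd (w t) + l) (at t within {0..} \<inter> {..<t})" by (rule tendsto_within_subset) auto
      then show "\<exists>l. (v' \<longlongrightarrow> l) (at t within {0..} \<inter> {..<t})" by blast
    qed
    fix s t :: real assume st: "s \<le> t"
    have eq: "(\<lambda>r. B *v v' r + V (u' r, v' r)) = (\<lambda>r. (B *v snd (w r) + V (w r + N r)) + B *v snd (N r))"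
      by (simp only: uv') (simp add: v'_def matrix_vector_right_distrib add_ac)
    note iw = w(3)[OF st] and iN = solves_onD(2)[OF N2 UNIV_I UNIV_I st]
    show "(\<lambda>r. B *v v' r + V (u' r, v' r)) absolutely_integrable_on {s..t}"
      unfolding eq by (rule set_integral_add(1)[OF iw iN])
    have "v' t - v' s = (snd (w t) - snd (w s)) + (snd (N t) - snd (N s))" by (simp add: v'_def)
    also have "\<dots> = (integral {s..t} (\<lambda>r. B *v snd (w r) + V (w r + N r)) + integral {s..t} (\<lambda>r. B *v snd (N r)))
        + (\<sigma>\<^sub>2 *\<^sub>R snd \<omega> t - \<sigma>\<^sub>2 *\<^sub>R snd \<omega> s)"
      unfolding w(4)[OF st] solves_onD(3)[OF N2 UNIV_I UNIV_I st] by simp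
    also have "integral {s..t} (\<lambda>r. B *v snd (w r) + V (w r + N r)) + integral {s..t} (\<lambda>r. B *v snd (N r))
        = integral {s..t} (\<lambda>r. B *v v' r + V (u' r, v' r))"
      unfolding eq by (rule integral_add[OF int[OF iw] int[OF iN], symmetric])
    finally show "v' t - v' s = integral {s..t} (\<lambda>r. B *v v' r + V (u' r, v' r)) + (\<sigma>\<^sub>2 *\<^sub>R snd \<omega> t - \<sigma>\<^sub>2 *\<^sub>R snd \<omega> s)" .
  qed
  have reduced: "reduced_solution A B U V (\<zeta> \<epsilon>) \<xi> \<epsilon> \<sigma>\<^sub>2 \<omega> u' v'"
    unfolding reduced_solution_def
  proof (intro conjI allI impI)
    fix t :: real
    have "v' t - \<xi> (path_shift t (snd \<omega>)) = snd (w t)" by (simp add: v'_def N_def)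
    then show "u' t = manifold_map A B U V (\<zeta> \<epsilon>) \<xi> \<epsilon> (shift_pair t \<omega>) (v' t - \<xi> (path_shift t (snd \<omega>)))
        + \<zeta> \<epsilon> (path_shift t (fst \<omega>))"
      by (simp add: on_manifold u'_def N_def)
  qed (rule v'_solves)
  have initial: "(u' 0, v' 0) \<in> random_manifold A B U V (\<zeta> \<epsilon>) \<xi> \<epsilon> \<omega>"
    using on_manifold[of 0]
    by (auto simp: random_manifold_def shift_pair_0 u'_def v'_def N_def shift0)
  have unique: "u'' t = u' t \<and> v'' t = v' t"
    if red: "reduced_solution A B U V (\<zeta> \<epsilon>) \<xi> \<epsilon> \<sigma>\<^sub>2 \<omega> u'' v''" and init: "(u'' 0, v'' 0) = (u' 0, v' 0)"
      and t: "0 \<le> t" for u'' v'' t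
  proof -
    have R: "x t = S.slow_map (\<lambda>s. N (s + t)) (y t - snd (N t)) + fst (N t)"
      "(\<lambda>r. B *v y r + V (x r, y r)) integrable_on {0..t}"
      "y t - y 0 = integral {0..t} (\<lambda>r. B *v y r + V (x r, y r)) + (\<sigma>\<^sub>2 *\<^sub>R snd \<omega> t - \<sigma>\<^sub>2 *\<^sub>R snd \<omega> 0)"
      if r: "reduced_solution A B U V (\<zeta> \<epsilon>) \<xi> \<epsilon> \<sigma>\<^sub>2 \<omega> x y" and t: "0 \<le> t" for x y t
    proof -
      have y: "solves_on {0..} y (\<lambda>t. B *v y t + V (x t, y t)) (\<lambda>t. \<sigma>\<^sub>2 *\<^sub>R snd \<omega> t)"
        using r by (simp add: reduced_solution_def)
      show "x t = S.slow_map (\<lambda>s. N (s + t)) (y t - snd (N t)) + fst (N t)"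
        using r t by (simp add: reduced_solution_def map_eq N_def)
      show "(\<lambda>r. B *v y r + V (x r, y r)) integrable_on {0..t}"
        using t by (intro int[OF solves_onD(2)[OF y]]) auto
      show "y t - y 0 = integral {0..t} (\<lambda>r. B *v y r + V (x r, y r)) + (\<sigma>\<^sub>2 *\<^sub>R snd \<omega> t - \<sigma>\<^sub>2 *\<^sub>R snd \<omega> 0)"
        using t by (intro solves_onD(3)[OF y]) auto
    qed
    have "v'' t = v' t"
      by (rule S.reduced_equation_unique[where u = u'' and u' = u' and N = N
            and g = "\<lambda>t. \<sigma>\<^sub>2 *\<^sub>R snd \<omega> t - \<sigma>\<^sub>2 *\<^sub>R snd \<omega> 0", OF Nm t _ R(1)[OF red] R(1)[OF reduced]
            R(2)[OF red t] R(2)[OF reduced t] R(3)[OF red] R(3)[OF reduced]]) (use init in auto)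
    then show ?thesis using R(1)[OF red t] R(1)[OF reduced t] by simp
  qed
  have bound: "norm (u t - u' t) + norm (v t - v' t)
       \<le> exp (- (\<mu> / \<epsilon>) * t) / (1 - (L / (\<gamma>\<^sub>1 - \<mu>) + \<epsilon> * L / (\<mu> - \<epsilon> * \<gamma>\<^sub>2))) *
          (2 * (norm (u\<^sub>0 - \<zeta> \<epsilon> (fst \<omega>)) + norm (v\<^sub>0 - \<xi> (snd \<omega>))) + 2 * (M\<^sub>U / \<gamma>\<^sub>1) + M\<^sub>V / \<gamma>\<^sub>2)"
    if t: "0 \<le> t" for t
  proof -
    define k where "k = 1 - (L / (\<gamma>\<^sub>1 - \<mu>) + \<epsilon> * L / (\<mu> - \<epsilon> * \<gamma>\<^sub>2))"
    define X where "X = norm (u t - u' t) + norm (v t - v' t)"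
    define D where "D = 2 * (norm (u\<^sub>0 - \<zeta> \<epsilon> (fst \<omega>)) + norm (v\<^sub>0 - \<xi> (snd \<omega>))) + 2 * (M\<^sub>U / \<gamma>\<^sub>1) + M\<^sub>V / \<gamma>\<^sub>2"
    have k: "0 < k" using contraction by (simp add: k_def)
    have "0 \<le> M\<^sub>U" using U_bound norm_ge_zero order_trans by blast
    then have M: "0 \<le> M\<^sub>U / \<gamma>\<^sub>1" using H1(1) by simp
    have q0: "fst (q 0) = u\<^sub>0 - \<zeta> \<epsilon> (fst \<omega>)" "snd (q 0) = v\<^sub>0 - \<xi> (snd \<omega>)"
      by (simp_all add: q_def z_def N_def shift0 \<open>u 0 = u\<^sub>0\<close> \<open>v 0 = v\<^sub>0\<close>)
    have "fst (w t) - fst (q t) = u' t - u t" "snd (w t) - snd (q t) = v' t - v t"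
      using t by (simp_all add: q_def z_def u'_def v'_def)
    then have X: "norm (fst (w t) - fst (q t)) + norm (snd (w t) - snd (q t)) = X"
      by (simp add: X_def norm_minus_commute)
    have "exp (\<mu> / \<epsilon> * t) * X
      \<le> ((M\<^sub>U / \<gamma>\<^sub>1 + norm (u\<^sub>0 - \<zeta> \<epsilon> (fst \<omega>))) + (2 * norm (v\<^sub>0 - \<xi> (snd \<omega>)) + M\<^sub>V / \<gamma>\<^sub>2)) / k"
      using w(5)[of t] \<epsilon> unfolding X \<kappa> k_def q0 by simp
    also have "\<dots> \<le> D / k"
    proof (rule divide_right_mono)
      have "m + x + (2 * y + n) \<le> 2 * (x + y) + 2 * m + n" if "0 \<le> m" "0 \<le> x" for m n x y :: real
        using that by simp
      from this[OF M norm_ge_zero]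
      show "(M\<^sub>U / \<gamma>\<^sub>1 + norm (u\<^sub>0 - \<zeta> \<epsilon> (fst \<omega>))) + (2 * norm (v\<^sub>0 - \<xi> (snd \<omega>)) + M\<^sub>V / \<gamma>\<^sub>2) \<le> D"
        unfolding D_def .
    qed (use k in simp)
    finally have "exp (- (\<mu> / \<epsilon>) * t) * (exp (\<mu> / \<epsilon> * t) * X) \<le> exp (- (\<mu> / \<epsilon>) * t) * (D / k)"
      by (intro mult_left_mono) auto
    also have "exp (- (\<mu> / \<epsilon>) * t) * (exp (\<mu> / \<epsilon> * t) * X) = X"
    proof -
      have "exp (- (\<mu> / \<epsilon>) * t) * exp (\<mu> / \<epsilon> * t) = 1" by (simp flip: exp_add)
      then show ?thesis by (simp only: mult.assoc[symmetric] mult_1_left)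
    qed
    finally have "X \<le> exp (- (\<mu> / \<epsilon>) * t) / k * D"
      by (simp only: times_divide_eq_left times_divide_eq_right)
    then show ?thesis unfolding X_def k_def D_def .
  qed
  show ?thesis
  proof (rule bexI[OF _ initial], intro exI conjI)
    show "reduced_solution A B U V (\<zeta> \<epsilon>) \<xi> \<epsilon> \<sigma>\<^sub>2 \<omega> u' v'" by (rule reduced)
    show "(u' 0, v' 0) = (u' 0, v' 0)" ..
    show "\<forall>u'' v''. reduced_solution A B U V (\<zeta> \<epsilon>) \<xi> \<epsilon> \<sigma>\<^sub>2 \<omega> u'' v'' \<and> (u'' 0, v'' 0) = (u' 0, v' 0)
        \<longrightarrow> (\<forall>t\<ge>0. u'' t = u' t \<and> v'' t = v' t)"
      using unique by blast
    show "\<forall>t\<ge>0. norm (u t - u' t) + norm (v t - v' t)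
       \<le> exp (- (\<mu> / \<epsilon>) * t) / (1 - (L / (\<gamma>\<^sub>1 - \<mu>) + \<epsilon> * L / (\<mu> - \<epsilon> * \<gamma>\<^sub>2))) *
          (2 * (norm (u\<^sub>0 - \<zeta> \<epsilon> (fst \<omega>)) + norm (v\<^sub>0 - \<xi> (snd \<omega>))) + 2 * (M\<^sub>U / \<gamma>\<^sub>1) + M\<^sub>V / \<gamma>\<^sub>2)"
      using bound by blast
  qed
qed

end
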